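(* For every $r\ge 1$, the free regular $\star$-monoid $\mathbf{F}_r^\star$ has trivial cohomological dimension $2$.
   Context: Let $A$ be a set with $|A|=r$, let $A_\star=\{a^\star : a\in A\}$ be a disjoint copy of $A$, set $(a^\star)^\star=a$, and extend to an involution on words over $A\cup A_\star$ by $(xy)^\star=y^\star x^\star$. The free regular $\star$-monoid of rank $r$, denoted $\mathbf{F}_r^\star$, is the monoid with generators $A\cup A_\star$ and defining relations $ww^\star w=w$ for all words $w\in(A\cup A_\star)^\ast$. For a monoid $M$ and a $\mathbb{Z}M$-module $B$, $H^q(M,B)=\mathrm{Ext}^q_{\mathbb{Z}M}(\mathbb{Z},B)$, with $\mathbb{Z}$ the trivial $\mathbb{Z}M$-module (left and right versions agree here since $\mathbf{F}_r^\star$ has an involutive anti-automorphism). The trivial cohomological dimension of $M$ is the least integer $k$ such that $H^q(M,B)=0$ for all $q>k$ and all trivial $\mathbb{Z}M$-modules $B$ (abelian groups on which every element of $M$ acts as the identity). *)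

theory Defs
  imports "HOL-Algebra.Elementary_Groups" "HOL-Algebra.AbelCoset" "HOL-Algebra.Module"
begin

section \<open>Monoid presentations and the free regular star-monoid\<close>

inductive pres_cong :: "'x set \<Rightarrow> ('x list \<times> 'x list) set \<Rightarrow> 'x list \<Rightarrow> 'x list \<Rightarrow> bool"
  for X :: "'x set" and R :: "('x list \<times> 'x list) set" where
  pc_rel: "\<lbrakk>(u, v) \<in> R; u \<in> lists X; v \<in> lists X\<rbrakk> \<Longrightarrow> pres_cong X R u v"
| pc_refl: "u \<in> lists X \<Longrightarrow> pres_cong X R u u"
| pc_sym: "pres_cong X R u v \<Longrightarrow> pres_cong X R v u"
| pc_trans: "\<lbrakk>pres_cong X R u v; pres_cong X R v w\<rbrakk> \<Longrightarrow> pres_cong X R u w"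
| pc_append: "\<lbrakk>pres_cong X R u u'; pres_cong X R v v'\<rbrakk> \<Longrightarrow> pres_cong X R (u @ v) (u' @ v')"

definition pres_class :: "'x set \<Rightarrow> ('x list \<times> 'x list) set \<Rightarrow> 'x list \<Rightarrow> 'x list set" where
  "pres_class X R u = {v. pres_cong X R u v}"

definition presented_monoid :: "'x set \<Rightarrow> ('x list \<times> 'x list) set \<Rightarrow> 'x list set monoid" where
  "presented_monoid X R =
     \<lparr>carrier = pres_class X R ` lists X,
      mult = (\<lambda>P Q. \<Union>u\<in>P. \<Union>v\<in>Q. pres_class X R (u @ v)),
      one = pres_class X R []\<rparr>"

text \<open>\<open>Inl a\<close> is the generator \<open>a\<close> and \<open>Inr a\<close> is its starred copy.\<close>

definition star_alphabet :: "'a set \<Rightarrow> ('a + 'a) set" where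
  "star_alphabet A = Inl ` A \<union> Inr ` A"

fun letter_star :: "'a + 'a \<Rightarrow> 'a + 'a" where
  "letter_star (Inl a) = Inr a"
| "letter_star (Inr a) = Inl a"

definition word_star :: "('a + 'a) list \<Rightarrow> ('a + 'a) list" where
  "word_star w = rev (map letter_star w)"

definition free_regular_star_monoid :: "'a set \<Rightarrow> ('a + 'a) list set monoid" where
  "free_regular_star_monoid A =
     presented_monoid (star_alphabet A)
       {(w @ word_star w @ w, w) | w. w \<in> lists (star_alphabet A)}"


section \<open>The integral monoid ring\<close>

text \<open>Elements are finitely supported functions \<open>f\<close>, standing for the formal
  sum of the \<open>f m \<cdot> m\<close>.\<close>

definition supp :: "('m \<Rightarrow> int) \<Rightarrow> 'm set" where
  "supp f = {m. f m \<noteq> 0}"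

definition delta :: "'m \<Rightarrow> 'm \<Rightarrow> int" where
  "delta m = (\<lambda>x. if x = m then 1 else 0)"

definition monoid_ring :: "('m, 'z) monoid_scheme \<Rightarrow> ('m \<Rightarrow> int) ring" where
  "monoid_ring M =
     \<lparr>carrier = {f. finite (supp f) \<and> supp f \<subseteq> carrier M},
      mult = (\<lambda>f g m. \<Sum>(x, y) \<in> {(x, y) \<in> supp f \<times> supp g. x \<otimes>\<^bsub>M\<^esub> y = m}. f x * g y),
      one = delta \<one>\<^bsub>M\<^esub>,
      zero = (\<lambda>m. 0),
      add = (\<lambda>f g m. f m + g m)\<rparr>"


section \<open>Left modules\<close>

text \<open>The locale \<^locale>\<open>module\<close> requires a commutative ring of scalars. We reuse its record
  type; the ring fields \<open>mult\<close> and \<open>one\<close> of a module are irrelevant here.\<close>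

locale left_module = R?: ring R + M?: abelian_group M
  for R :: "('r, 'c) ring_scheme" (structure) and M :: "('r, 'm, 'd) module_scheme" (structure) +
  assumes smult_closed:
      "\<lbrakk>a \<in> carrier R; x \<in> carrier M\<rbrakk> \<Longrightarrow> a \<odot>\<^bsub>M\<^esub> x \<in> carrier M"
    and smult_l_distr:
      "\<lbrakk>a \<in> carrier R; b \<in> carrier R; x \<in> carrier M\<rbrakk> \<Longrightarrow>
         (a \<oplus>\<^bsub>R\<^esub> b) \<odot>\<^bsub>M\<^esub> x = (a \<odot>\<^bsub>M\<^esub> x) \<oplus>\<^bsub>M\<^esub> (b \<odot>\<^bsub>M\<^esub> x)"
    and smult_r_distr:
      "\<lbrakk>a \<in> carrier R; x \<in> carrier M; y \<in> carrier M\<rbrakk> \<Longrightarrow>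
         a \<odot>\<^bsub>M\<^esub> (x \<oplus>\<^bsub>M\<^esub> y) = (a \<odot>\<^bsub>M\<^esub> x) \<oplus>\<^bsub>M\<^esub> (a \<odot>\<^bsub>M\<^esub> y)"
    and smult_assoc:
      "\<lbrakk>a \<in> carrier R; b \<in> carrier R; x \<in> carrier M\<rbrakk> \<Longrightarrow>
         (a \<otimes>\<^bsub>R\<^esub> b) \<odot>\<^bsub>M\<^esub> x = a \<odot>\<^bsub>M\<^esub> (b \<odot>\<^bsub>M\<^esub> x)"
    and smult_one: "x \<in> carrier M \<Longrightarrow> \<one>\<^bsub>R\<^esub> \<odot>\<^bsub>M\<^esub> x = x"

definition lmod_hom ::
    "('r, 'c) ring_scheme \<Rightarrow> ('r, 'p, 'd) module_scheme \<Rightarrow> ('r, 'q, 'e) module_scheme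
       \<Rightarrow> ('p \<Rightarrow> 'q) set" where
  "lmod_hom R P Q =
     {f \<in> carrier P \<rightarrow> carrier Q.
        (\<forall>x\<in>carrier P. \<forall>y\<in>carrier P. f (x \<oplus>\<^bsub>P\<^esub> y) = f x \<oplus>\<^bsub>Q\<^esub> f y) \<and>
        (\<forall>a\<in>carrier R. \<forall>x\<in>carrier P. f (a \<odot>\<^bsub>P\<^esub> x) = a \<odot>\<^bsub>Q\<^esub> f x)}"

text \<open>Projectivity is the lifting property against surjections \<open>X \<rightarrow> Y\<close>. The modules \<open>X\<close> have
  elements of type \<open>'p \<Rightarrow> 'r\<close> and \<open>Y\<close> elements of type \<open>'p\<close>. This loses nothing: the type of \<open>X\<close>
  accommodates the free module on the set \<open>carrier P\<close>, so \<open>P\<close> is a direct summand of a free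
  module, which gives the lifting property in all types.\<close>

definition projective_lmodule ::
    "('r, 'c) ring_scheme \<Rightarrow> ('r, 'p) module \<Rightarrow> bool" where
  "projective_lmodule R P \<longleftrightarrow>
     left_module R P \<and>
     (\<forall>(X :: ('r, 'p \<Rightarrow> 'r) module) (Y :: ('r, 'p) module) g f.
        left_module R X \<and> left_module R Y \<and>
        g \<in> lmod_hom R X Y \<and> g ` carrier X = carrier Y \<and> f \<in> lmod_hom R P Y \<longrightarrow>
        (\<exists>h \<in> lmod_hom R P X. \<forall>x\<in>carrier P. g (h x) = f x))"

text \<open>\<open>\<cdots> \<rightarrow> P 2 \<rightarrow> P 1 \<rightarrow> P 0 \<rightarrow> N \<rightarrow> 0\<close> exact, with \<open>d n : P (Suc n) \<rightarrow> P n\<close> and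
  augmentation \<open>e : P 0 \<rightarrow> N\<close>.\<close>

definition projective_resolution ::
    "('r, 'c) ring_scheme \<Rightarrow> ('r, 'n) module \<Rightarrow> (nat \<Rightarrow> ('r, 'p) module)
       \<Rightarrow> (nat \<Rightarrow> 'p \<Rightarrow> 'p) \<Rightarrow> ('p \<Rightarrow> 'n) \<Rightarrow> bool" where
  "projective_resolution R N P d e \<longleftrightarrow>
     left_module R N \<and>
     (\<forall>n. projective_lmodule R (P n)) \<and>
     (\<forall>n. d n \<in> lmod_hom R (P (Suc n)) (P n)) \<and>
     e \<in> lmod_hom R (P 0) N \<and>
     e ` carrier (P 0) = carrier N \<and>
     a_kernel (P 0) N e = d 0 ` carrier (P (Suc 0)) \<and>
     (\<forall>n. a_kernel (P (Suc n)) (P n) (d n) = d (Suc n) ` carrier (P (Suc (Suc n))))"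


section \<open>Ext groups\<close>

text \<open>Homomorphisms are restricted to be \<open>undefined\<close> outside \<open>carrier P\<close>, so that distinct
  elements of the Hom group are distinct as maps on \<open>carrier P\<close>.\<close>

definition Hom_group ::
    "('r, 'c) ring_scheme \<Rightarrow> ('r, 'p, 'd) module_scheme \<Rightarrow> ('r, 'b, 'e) module_scheme
       \<Rightarrow> ('p \<Rightarrow> 'b) monoid" where
  "Hom_group R P B =
     \<lparr>carrier = lmod_hom R P B \<inter> extensional (carrier P),
      mult = (\<lambda>f g. \<lambda>x\<in>carrier P. f x \<oplus>\<^bsub>B\<^esub> g x),
      one = (\<lambda>x\<in>carrier P. \<zero>\<^bsub>B\<^esub>)\<rparr>"

definition coboundary_map ::
    "(nat \<Rightarrow> ('r, 'p) module) \<Rightarrow> (nat \<Rightarrow> 'p \<Rightarrow> 'p) \<Rightarrow> nat \<Rightarrow> ('p \<Rightarrow> 'b) \<Rightarrow> 'p \<Rightarrow> 'b" where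
  "coboundary_map P d q f = (\<lambda>x\<in>carrier (P (Suc q)). f (d q x))"

definition cocycles ::
    "('r, 'c) ring_scheme \<Rightarrow> (nat \<Rightarrow> ('r, 'p) module) \<Rightarrow> (nat \<Rightarrow> 'p \<Rightarrow> 'p)
       \<Rightarrow> ('r, 'b) module \<Rightarrow> nat \<Rightarrow> ('p \<Rightarrow> 'b) set" where
  "cocycles R P d B q =
     kernel (Hom_group R (P q) B) (Hom_group R (P (Suc q)) B) (coboundary_map P d q)"

fun coboundaries ::
    "('r, 'c) ring_scheme \<Rightarrow> (nat \<Rightarrow> ('r, 'p) module) \<Rightarrow> (nat \<Rightarrow> 'p \<Rightarrow> 'p)
       \<Rightarrow> ('r, 'b) module \<Rightarrow> nat \<Rightarrow> ('p \<Rightarrow> 'b) set" where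
  "coboundaries R P d B 0 = {\<one>\<^bsub>Hom_group R (P 0) B\<^esub>}"
| "coboundaries R P d B (Suc q) = coboundary_map P d q ` carrier (Hom_group R (P q) B)"

text \<open>\<open>Ext_group R P d B q\<close> is \<open>Ext\<close> in degree \<open>q\<close> from \<open>N\<close> to \<open>B\<close> over \<open>R\<close>, computed from a
  projective resolution \<open>P\<close>, \<open>d\<close> of \<open>N\<close>.\<close>

definition Ext_group ::
    "('r, 'c) ring_scheme \<Rightarrow> (nat \<Rightarrow> ('r, 'p) module) \<Rightarrow> (nat \<Rightarrow> 'p \<Rightarrow> 'p)
       \<Rightarrow> ('r, 'b) module \<Rightarrow> nat \<Rightarrow> ('p \<Rightarrow> 'b) set monoid" where
  "Ext_group R P d B q =
     (Hom_group R (P q) B)\<lparr>carrier := cocycles R P d B q\<rparr> Mod coboundaries R P d B q"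


section \<open>Trivial cohomological dimension\<close>

definition trivial_lmodule ::
    "('m, 'z) monoid_scheme \<Rightarrow> ('m \<Rightarrow> int, 'b) module \<Rightarrow> bool" where
  "trivial_lmodule M B \<longleftrightarrow>
     left_module (monoid_ring M) B \<and>
     (\<forall>m\<in>carrier M. \<forall>b\<in>carrier B. delta m \<odot>\<^bsub>B\<^esub> b = b)"

text \<open>The integers with every monoid element acting as the identity, so that \<open>f\<close> acts as
  multiplication by the sum of its coefficients.\<close>

definition trivial_int_module :: "('m \<Rightarrow> int, int) module" where
  "trivial_int_module =
     \<lparr>carrier = UNIV, mult = (*), one = 1, zero = 0, add = (+),
      smult = (\<lambda>f z. (\<Sum>m\<in>supp f. f m) * z)\<rparr>"

definition trivial_cohomology_vanishes_above ::
    "('m, 'z) monoid_scheme \<Rightarrow> (nat \<Rightarrow> ('m \<Rightarrow> int, 'p) module) \<Rightarrow> (nat \<Rightarrow> 'p \<Rightarrow> 'p)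
       \<Rightarrow> 'b itself \<Rightarrow> int \<Rightarrow> bool" where
  "trivial_cohomology_vanishes_above M P d (_ :: 'b itself) k \<longleftrightarrow>
     (\<forall>q. int q > k \<longrightarrow>
        (\<forall>B :: ('m \<Rightarrow> int, 'b) module.
           trivial_lmodule M B \<longrightarrow> trivial_group (Ext_group (monoid_ring M) P d B q)))"

text \<open>\<open>P\<close>, \<open>d\<close> is meant to be a projective resolution of \<^const>\<open>trivial_int_module\<close> over
  \<^term>\<open>monoid_ring M\<close>, and \<open>'b\<close> is the type from which the elements of coefficient modules are
  drawn; it should be infinite, since a small type need not contain enough coefficient modules.\<close>

definition has_trivial_cohomological_dimension ::
    "('m, 'z) monoid_scheme \<Rightarrow> (nat \<Rightarrow> ('m \<Rightarrow> int, 'p) module) \<Rightarrow> (nat \<Rightarrow> 'p \<Rightarrow> 'p)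
       \<Rightarrow> 'b itself \<Rightarrow> int \<Rightarrow> bool" where
  "has_trivial_cohomological_dimension M P d T k \<longleftrightarrow>
     trivial_cohomology_vanishes_above M P d T k \<and>
     (\<forall>j. trivial_cohomology_vanishes_above M P d T j \<longrightarrow> k \<le> j)"


section \<open>The constructions are well defined\<close>


lemma pres_cong_lists: "pres_cong X R u v \<Longrightarrow> u \<in> lists X \<and> v \<in> lists X"
  by (induction rule: pres_cong.induct) auto

lemma pres_class_eq: "pres_cong X R u v \<Longrightarrow> pres_class X R u = pres_class X R v"
  unfolding pres_class_def by (blast intro: pres_cong.pc_sym pres_cong.pc_trans)

lemma pres_class_mult:
  assumes "u \<in> lists X" "v \<in> lists X"
  shows "pres_class X R u \<otimes>\<^bsub>presented_monoid X R\<^esub> pres_class X R v = pres_class X R (u @ v)"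
proof -
  have "pres_class X R (u' @ v') = pres_class X R (u @ v)"
    if "u' \<in> pres_class X R u" "v' \<in> pres_class X R v" for u' v'
    using that pres_class_eq[OF pres_cong.pc_append] unfolding pres_class_def by blast
  moreover have "u \<in> pres_class X R u" "v \<in> pres_class X R v"
    using assms by (auto simp: pres_class_def intro: pres_cong.pc_refl)
  ultimately have "(\<Union>u'\<in>pres_class X R u. \<Union>v'\<in>pres_class X R v. pres_class X R (u' @ v'))
      = pres_class X R (u @ v)" by blast
  then show ?thesis by (simp add: presented_monoid_def)
qed

lemma presented_monoid_is_monoid: "monoid (presented_monoid X R)"
proof
  let ?M = "presented_monoid X R"
  have c: "carrier ?M = pres_class X R ` lists X" and o: "\<one>\<^bsub>?M\<^esub> = pres_class X R []"
    by (simp_all add: presented_monoid_def)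
  show "\<one>\<^bsub>?M\<^esub> \<in> carrier ?M" unfolding c o by simp
  fix x assume "x \<in> carrier ?M"
  then obtain u where u: "u \<in> lists X" "x = pres_class X R u" unfolding c by blast
  show "\<one>\<^bsub>?M\<^esub> \<otimes>\<^bsub>?M\<^esub> x = x" "x \<otimes>\<^bsub>?M\<^esub> \<one>\<^bsub>?M\<^esub> = x"
    using u by (simp_all add: o pres_class_mult)
  fix y assume "y \<in> carrier ?M"
  then obtain v where v: "v \<in> lists X" "y = pres_class X R v" unfolding c by blast
  show "x \<otimes>\<^bsub>?M\<^esub> y \<in> carrier ?M" 
    using u v pres_class_mult[OF u(1) v(1), of R] unfolding c by auto
  fix z assume "z \<in> carrier ?M"
  then obtain w where w: "w \<in> lists X" "z = pres_class X R w" unfolding c by blast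
  have "u @ v \<in> lists X" "v @ w \<in> lists X" using u v w by auto
  then show "x \<otimes>\<^bsub>?M\<^esub> y \<otimes>\<^bsub>?M\<^esub> z = x \<otimes>\<^bsub>?M\<^esub> (y \<otimes>\<^bsub>?M\<^esub> z)"
    using u v w by (simp add: pres_class_mult)
qed

lemma monoid_ring_mult:
  assumes "finite S" "finite T" "supp f \<subseteq> S" "supp g \<subseteq> T"
  shows "(f \<otimes>\<^bsub>monoid_ring M\<^esub> g) m
           = (\<Sum>x\<in>S. \<Sum>y\<in>T. if x \<otimes>\<^bsub>M\<^esub> y = m then f x * g y else 0)"
proof -
  have "(\<Sum>x\<in>S. \<Sum>y\<in>T. if x \<otimes>\<^bsub>M\<^esub> y = m then f x * g y else 0)
      = (\<Sum>(x,y)\<in>S\<times>T. if x \<otimes>\<^bsub>M\<^esub> y = m then f x * g y else 0)"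
    by (rule sum.cartesian_product)
  also have "\<dots> = (\<Sum>(x, y) \<in> {(x, y) \<in> supp f \<times> supp g. x \<otimes>\<^bsub>M\<^esub> y = m}. f x * g y)"
    using assms by (intro sum.mono_neutral_cong_right) (auto simp: supp_def split: if_splits)
  finally show ?thesis by (simp add: monoid_ring_def)
qed

lemma supp_add: "supp (\<lambda>m. f m + g m) \<subseteq> supp f \<union> supp g"
  by (auto simp: supp_def)

lemma sum_supp_eq: "finite S \<Longrightarrow> supp f \<subseteq> S \<Longrightarrow> sum f (supp f) = sum f S"
  by (rule sum.mono_neutral_left) (auto simp: supp_def)

lemma monoid_ring_mult_props:
  assumes M: "monoid M" and f: "f \<in> carrier (monoid_ring M)" and g: "g \<in> carrier (monoid_ring M)"
  shows "f \<otimes>\<^bsub>monoid_ring M\<^esub> g \<in> carrier (monoid_ring M)"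
    and "sum (f \<otimes>\<^bsub>monoid_ring M\<^esub> g) (supp (f \<otimes>\<^bsub>monoid_ring M\<^esub> g)) = sum f (supp f) * sum g (supp g)"
    and "supp (f \<otimes>\<^bsub>monoid_ring M\<^esub> g) \<subseteq> (\<lambda>(x,y). x \<otimes>\<^bsub>M\<^esub> y) ` (supp f \<times> supp g)"
proof -
  let ?p = "f \<otimes>\<^bsub>monoid_ring M\<^esub> g" and ?I = "(\<lambda>(x,y). x \<otimes>\<^bsub>M\<^esub> y) ` (supp f \<times> supp g)"
  have fin: "finite (supp f)" "finite (supp g)" and sub: "supp f \<subseteq> carrier M" "supp g \<subseteq> carrier M"
    using f g by (auto simp: monoid_ring_def)
  have e: "?p m = (\<Sum>x\<in>supp f. \<Sum>y\<in>supp g. if x \<otimes>\<^bsub>M\<^esub> y = m then f x * g y else 0)" for m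
    by (rule monoid_ring_mult) (use fin in auto)
  show s: "supp ?p \<subseteq> ?I"
  proof
    fix m assume "m \<in> supp ?p"
    then have "(\<Sum>x\<in>supp f. \<Sum>y\<in>supp g. if x \<otimes>\<^bsub>M\<^esub> y = m then f x * g y else 0) \<noteq> 0"
      using e by (simp add: supp_def)
    then obtain x y where "x \<in> supp f" "y \<in> supp g" "(if x \<otimes>\<^bsub>M\<^esub> y = m then f x * g y else 0) \<noteq> 0"
      by (elim sum.not_neutral_contains_not_neutral)
    then show "m \<in> ?I" by (auto split: if_splits)
  qed
  have fI: "finite ?I" using fin by simp
  have "?I \<subseteq> carrier M" using sub by (auto intro: monoid.m_closed[OF M])
  then have "supp ?p \<subseteq> carrier M" and "finite (supp ?p)"
    using s fI by (meson order_trans, meson finite_subset)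
  then show "?p \<in> carrier (monoid_ring M)" by (simp add: monoid_ring_def[of M])
  have "sum ?p (supp ?p) = sum ?p ?I" using s fI by (rule sum_supp_eq[rotated])
  also have "\<dots> = (\<Sum>x\<in>supp f. \<Sum>y\<in>supp g. \<Sum>m\<in>?I. if x \<otimes>\<^bsub>M\<^esub> y = m then f x * g y else 0)"
    unfolding e by (subst sum.swap, rule sum.cong[OF refl], rule sum.swap)
  also have "\<dots> = (\<Sum>x\<in>supp f. \<Sum>y\<in>supp g. f x * g y)"
    using fI by (intro sum.cong refl) (auto simp: sum.delta)
  finally show "sum ?p (supp ?p) = sum f (supp f) * sum g (supp g)"
    by (simp add: sum_product)
qed

lemma monoid_ring_is_ring:
  assumes M: "monoid M"
  shows "ring (monoid_ring M)"
proof (rule ringI)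
  interpret monoid M by (rule M)
  let ?R = "monoid_ring M"
  have car: "f \<in> carrier ?R \<longleftrightarrow> finite (supp f) \<and> supp f \<subseteq> carrier M" for f
    by (simp add: monoid_ring_def)
  have addd: "(f \<oplus>\<^bsub>?R\<^esub> g) = (\<lambda>m. f m + g m)" for f g by (simp add: monoid_ring_def)
  have zero: "\<zero>\<^bsub>?R\<^esub> = (\<lambda>m. 0)" by (simp add: monoid_ring_def)
  note sadd = supp_add
  have addc: "f \<oplus>\<^bsub>?R\<^esub> g \<in> carrier ?R" if "f \<in> carrier ?R" "g \<in> carrier ?R" for f g
    using that sadd[of f g] unfolding addd car
    by (meson Un_least finite_UnI finite_subset order_trans)
  show "abelian_group ?R"
  proof (rule abelian_groupI)
    fix f assume f: "f \<in> carrier ?R"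
    have "supp (\<lambda>m. - f m) = supp f" by (auto simp: supp_def)
    then show "\<exists>y\<in>carrier ?R. y \<oplus>\<^bsub>?R\<^esub> f = \<zero>\<^bsub>?R\<^esub>"
      using f by (intro bexI[of _ "\<lambda>m. - f m"]) (auto simp: addd zero car)
  qed (use addc in \<open>auto simp: zero car supp_def\<close>, simp_all add: addd zero add_ac)
  have sd: "supp (delta \<one>\<^bsub>M\<^esub>) = {\<one>\<^bsub>M\<^esub>}" by (auto simp: supp_def delta_def)
  have one: "\<one>\<^bsub>?R\<^esub> = delta \<one>\<^bsub>M\<^esub>" by (simp add: monoid_ring_def)
  show "monoid ?R"
  proof
    show "\<one>\<^bsub>?R\<^esub> \<in> carrier ?R" by (simp add: car one sd)
    fix f assume f: "f \<in> carrier ?R"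
    then have fin: "finite (supp f)" and sub: "supp f \<subseteq> carrier M" by (auto simp: car)
    have fm: "(\<Sum>y\<in>supp f. if y = m then f y else 0) = f m" for m
      using fin by (auto simp: sum.delta supp_def)
    show "\<one>\<^bsub>?R\<^esub> \<otimes>\<^bsub>?R\<^esub> f = f"
    proof
      fix m
      have "(\<one>\<^bsub>?R\<^esub> \<otimes>\<^bsub>?R\<^esub> f) m = (\<Sum>y\<in>supp f. if \<one>\<^bsub>M\<^esub> \<otimes>\<^bsub>M\<^esub> y = m then f y else 0)"
        unfolding one using fin
        by (subst monoid_ring_mult[of "{\<one>\<^bsub>M\<^esub>}" "supp f"]) (simp_all add: sd, simp_all add: delta_def cong: if_cong)
      also have "\<dots> = f m" using sub by (subst fm[symmetric]) (intro sum.cong, auto)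
      finally show "(\<one>\<^bsub>?R\<^esub> \<otimes>\<^bsub>?R\<^esub> f) m = f m" .
    qed
    show "f \<otimes>\<^bsub>?R\<^esub> \<one>\<^bsub>?R\<^esub> = f"
    proof
      fix m
      have "(f \<otimes>\<^bsub>?R\<^esub> \<one>\<^bsub>?R\<^esub>) m = (\<Sum>y\<in>supp f. if y \<otimes>\<^bsub>M\<^esub> \<one>\<^bsub>M\<^esub> = m then f y else 0)"
        unfolding one using fin
        by (subst monoid_ring_mult[of "supp f" "{\<one>\<^bsub>M\<^esub>}"]) (simp_all add: sd, simp_all add: delta_def cong: if_cong)
      also have "\<dots> = f m" using sub by (subst fm[symmetric]) (intro sum.cong, auto)
      finally show "(f \<otimes>\<^bsub>?R\<^esub> \<one>\<^bsub>?R\<^esub>) m = f m" .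
    qed
    fix g assume g: "g \<in> carrier ?R"
    show fg: "f \<otimes>\<^bsub>?R\<^esub> g \<in> carrier ?R" by (rule monoid_ring_mult_props[OF M f g])
    fix h assume h: "h \<in> carrier ?R"
    have fing: "finite (supp g)" "supp g \<subseteq> carrier M" and finh: "finite (supp h)" "supp h \<subseteq> carrier M"
      using g h by (auto simp: car)
    let ?S = "(\<lambda>(x,y). x \<otimes>\<^bsub>M\<^esub> y) ` (supp f \<times> supp g)"
    let ?T = "(\<lambda>(x,y). x \<otimes>\<^bsub>M\<^esub> y) ` (supp g \<times> supp h)"
    show "f \<otimes>\<^bsub>?R\<^esub> g \<otimes>\<^bsub>?R\<^esub> h = f \<otimes>\<^bsub>?R\<^esub> (g \<otimes>\<^bsub>?R\<^esub> h)"
    proof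
      fix m
      have "(f \<otimes>\<^bsub>?R\<^esub> g \<otimes>\<^bsub>?R\<^esub> h) m
          = (\<Sum>s\<in>?S. \<Sum>z\<in>supp h. if s \<otimes>\<^bsub>M\<^esub> z = m then (f \<otimes>\<^bsub>?R\<^esub> g) s * h z else 0)"
        by (rule monoid_ring_mult) (use fin fing finh monoid_ring_mult_props(3)[OF M f g] in auto)
      also have "\<dots> = (\<Sum>s\<in>?S. \<Sum>z\<in>supp h. \<Sum>x\<in>supp f. \<Sum>y\<in>supp g.
           if x \<otimes>\<^bsub>M\<^esub> y = s then (if s \<otimes>\<^bsub>M\<^esub> z = m then f x * g y * h z else 0) else 0)"
        using fin fing
        by (intro sum.cong refl, subst monoid_ring_mult[of "supp f" "supp g"])
           (auto simp: sum_distrib_right intro!: sum.cong sum.neutral)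
      also have "\<dots> = (\<Sum>z\<in>supp h. \<Sum>x\<in>supp f. \<Sum>y\<in>supp g. \<Sum>s\<in>?S.
           if x \<otimes>\<^bsub>M\<^esub> y = s then (if s \<otimes>\<^bsub>M\<^esub> z = m then f x * g y * h z else 0) else 0)"
        by (subst sum.swap, rule sum.cong[OF refl], subst sum.swap, rule sum.cong[OF refl], rule sum.swap)
      also have "\<dots> = (\<Sum>z\<in>supp h. \<Sum>x\<in>supp f. \<Sum>y\<in>supp g.
           if x \<otimes>\<^bsub>M\<^esub> y \<otimes>\<^bsub>M\<^esub> z = m then f x * g y * h z else 0)"
        using fin fing by (intro sum.cong refl, subst sum.delta') auto
      also have "\<dots> = (\<Sum>x\<in>supp f. \<Sum>y\<in>supp g. \<Sum>z\<in>supp h.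
           if x \<otimes>\<^bsub>M\<^esub> y \<otimes>\<^bsub>M\<^esub> z = m then f x * g y * h z else 0)"
        by (subst sum.swap, rule sum.cong[OF refl], rule sum.swap)
      also have "\<dots> = (\<Sum>x\<in>supp f. \<Sum>y\<in>supp g. \<Sum>z\<in>supp h.
           if x \<otimes>\<^bsub>M\<^esub> (y \<otimes>\<^bsub>M\<^esub> z) = m then f x * (g y * h z) else 0)"
        using sub fing finh
        by (intro sum.cong refl) (simp add: m_assoc subset_iff mult.assoc)
      also have "\<dots> = (\<Sum>x\<in>supp f. \<Sum>y\<in>supp g. \<Sum>z\<in>supp h. \<Sum>t\<in>?T.
           if y \<otimes>\<^bsub>M\<^esub> z = t then (if x \<otimes>\<^bsub>M\<^esub> t = m then f x * (g y * h z) else 0) else 0)"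
        using finh fing by (intro sum.cong refl, subst sum.delta') auto
      also have "\<dots> = (\<Sum>x\<in>supp f. \<Sum>t\<in>?T. \<Sum>y\<in>supp g. \<Sum>z\<in>supp h. 
           if y \<otimes>\<^bsub>M\<^esub> z = t then (if x \<otimes>\<^bsub>M\<^esub> t = m then f x * (g y * h z) else 0) else 0)"
        by (rule sum.cong[OF refl], subst (2) sum.swap, rule sum.cong[OF refl], rule sum.swap)
      also have "\<dots> = (\<Sum>x\<in>supp f. \<Sum>t\<in>?T. if x \<otimes>\<^bsub>M\<^esub> t = m then f x * (g \<otimes>\<^bsub>?R\<^esub> h) t else 0)"
        using finh fing
        by (intro sum.cong refl, subst monoid_ring_mult[of "supp g" "supp h"])
           (auto simp: sum_distrib_left intro!: sum.cong sum.neutral)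
      also have "\<dots> = (f \<otimes>\<^bsub>?R\<^esub> (g \<otimes>\<^bsub>?R\<^esub> h)) m"
        by (rule monoid_ring_mult[symmetric])
           (use fin fing finh monoid_ring_mult_props(3)[OF M g h] in auto)
      finally show "(f \<otimes>\<^bsub>?R\<^esub> g \<otimes>\<^bsub>?R\<^esub> h) m = (f \<otimes>\<^bsub>?R\<^esub> (g \<otimes>\<^bsub>?R\<^esub> h)) m" .
    qed
  qed
  fix f g h assume f: "f \<in> carrier ?R" and g: "g \<in> carrier ?R" and h: "h \<in> carrier ?R"
  have fin: "finite (supp f)" "finite (supp g)" "finite (supp h)" using f g h by (auto simp: car)
  have U: "finite (supp f \<union> supp g)" "supp f \<subseteq> supp f \<union> supp g" "supp g \<subseteq> supp f \<union> supp g"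
    using fin by auto
  show "(f \<oplus>\<^bsub>?R\<^esub> g) \<otimes>\<^bsub>?R\<^esub> h = f \<otimes>\<^bsub>?R\<^esub> h \<oplus>\<^bsub>?R\<^esub> g \<otimes>\<^bsub>?R\<^esub> h"
  proof
    fix m
    note mm = monoid_ring_mult[OF U(1) fin(3) _ order_refl, of _ M m]
    show "((f \<oplus>\<^bsub>?R\<^esub> g) \<otimes>\<^bsub>?R\<^esub> h) m = (f \<otimes>\<^bsub>?R\<^esub> h \<oplus>\<^bsub>?R\<^esub> g \<otimes>\<^bsub>?R\<^esub> h) m"
      unfolding addd mm[OF sadd] mm[OF U(2)] mm[OF U(3)] sum.distrib[symmetric]
      by (intro sum.cong refl) (simp add: distrib_right)
  qed
  show "h \<otimes>\<^bsub>?R\<^esub> (f \<oplus>\<^bsub>?R\<^esub> g) = h \<otimes>\<^bsub>?R\<^esub> f \<oplus>\<^bsub>?R\<^esub> h \<otimes>\<^bsub>?R\<^esub> g"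
  proof
    fix m
    note mm = monoid_ring_mult[OF fin(3) U(1) order_refl, of _ M m]
    show "(h \<otimes>\<^bsub>?R\<^esub> (f \<oplus>\<^bsub>?R\<^esub> g)) m = (h \<otimes>\<^bsub>?R\<^esub> f \<oplus>\<^bsub>?R\<^esub> h \<otimes>\<^bsub>?R\<^esub> g) m"
      unfolding addd mm[OF sadd] mm[OF U(2)] mm[OF U(3)] sum.distrib[symmetric]
      by (intro sum.cong refl) (simp add: distrib_left)
  qed
qed

lemma trivial_int_module_trivial:
  assumes M: "monoid M"
  shows "trivial_lmodule M trivial_int_module"
proof -
  let ?R = "monoid_ring M" and ?Z = "trivial_int_module :: ('a \<Rightarrow> int, int) module"
  have sd: "supp (delta m) = {m}" for m :: 'a by (auto simp: supp_def delta_def)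
  have sm: "a \<odot>\<^bsub>?Z\<^esub> x = sum a (supp a) * x" and ad: "(x \<oplus>\<^bsub>?Z\<^esub> y) = x + y"
    and z: "\<zero>\<^bsub>?Z\<^esub> = 0" and c: "carrier ?Z = UNIV" for a x y
    by (simp_all add: trivial_int_module_def)
  have "abelian_group ?Z"
    by (rule abelian_groupI) (auto simp: ad z c intro: exI[of _ "- x" for x])
  moreover have "(a \<oplus>\<^bsub>?R\<^esub> b) \<odot>\<^bsub>?Z\<^esub> x = (a \<odot>\<^bsub>?Z\<^esub> x) \<oplus>\<^bsub>?Z\<^esub> (b \<odot>\<^bsub>?Z\<^esub> x)"
    if "a \<in> carrier ?R" "b \<in> carrier ?R" for a b x
  proof -
    have fin: "finite (supp a \<union> supp b)" using that by (auto simp: monoid_ring_def)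
    have "supp (\<lambda>m. a m + b m) \<subseteq> supp a \<union> supp b" by (auto simp: supp_def)
    then have "sum (\<lambda>m. a m + b m) (supp (\<lambda>m. a m + b m)) = sum a (supp a) + sum b (supp b)"
      using fin sum_supp_eq[OF fin, of "\<lambda>m. a m + b m"] sum_supp_eq[OF fin, of a]
        sum_supp_eq[OF fin, of b] by (simp add: sum.distrib)
    then show ?thesis by (simp add: sm ad monoid_ring_def algebra_simps)
  qed
  moreover have "\<one>\<^bsub>?R\<^esub> \<odot>\<^bsub>?Z\<^esub> x = x" for x
    by (simp add: sm monoid_ring_def sd) (simp add: delta_def)
  ultimately have "left_module ?R ?Z"
    using monoid_ring_is_ring[OF M] monoid_ring_mult_props(2)[OF M]
    by (intro left_module.intro left_module_axioms.intro)
       (simp_all add: c, simp_all add: sm ad algebra_simps)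
  then show ?thesis by (simp add: trivial_lmodule_def sm sd) (simp add: delta_def)
qed

lemma free_regular_star_monoid_is_monoid: "monoid (free_regular_star_monoid A)"
  unfolding free_regular_star_monoid_def by (rule presented_monoid_is_monoid)

end

theory Submission
  imports Defs "HOL-Library.Poly_Mapping" "HOL-Library.Nat_Bijection"
begin

text \<open>
  Write \<open>F\<close> for the free regular \<open>\<star>\<close>-monoid on \<open>A\<close>. The trivial module \<open>\<int>\<close> has an explicit projective
  resolution of length two over \<open>\<int>F\<close>, and a parity argument shows that its last term carries a
  cohomology class with trivial coefficients.

  \<^bold>\<open>Normal forms.\<close> Rewriting \<open>z z\<^sup>\<star> z \<rightarrow> z\<close> for all nonempty words \<open>z\<close> leads every word to a unique
  irreducible word. This is shown by letting the letters act on irreducible words from the right: append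
  the letter and, if a factor \<open>z z\<^sup>\<star> z\<close> appears at the end, replace it by \<open>z\<close>. The point is that this
  action satisfies \<open>w w\<^sup>\<star> w = w\<close> for every word \<open>w\<close> (\<open>run_rule\<close>). The words \<open>z\<close> that occur in such a
  step are \<open>primitive\<close>: irreducible and neither of the form \<open>s s\<^sup>\<star> y\<close> nor \<open>y s s\<^sup>\<star>\<close>. Such a \<open>z\<close> has no
  inner point about which its shorter side is reflected, and this rigidity replaces any analysis of
  critical pairs.

  \<^bold>\<open>The resolution.\<close> Take the right Cayley graph of \<open>F\<close>: the vertices are the irreducible words, and there
  is an edge \<open>(u, x)\<close> from \<open>u\<close> to \<open>ux\<close> for every letter \<open>x\<close>. The monoid \<open>F\<close> acts on it from the left, and
  the chain groups \<open>Q0\<close>, \<open>Q1\<close> of vertices and edges are free modules. The edges for which the word \<open>ux\<close> is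
  irreducible form a spanning tree. Every other edge has \<open>ux = y z z\<^sup>\<star> z\<close> with \<open>z\<close> primitive, and it
  completes the loop that leaves the vertex \<open>yz\<close> along \<open>z\<^sup>\<star>\<close> and returns along \<open>z\<close>; all other edges of this
  loop lie in the tree. So these loops form a \<open>\<int>\<close>-basis of the first homology. Conversely, a primitive
  word \<open>w\<close> gives such a loop at each vertex \<open>u\<close> with \<open>u w\<^sup>\<star> w = u\<close>, that is, at each element of the left
  ideal \<open>F w\<^sup>\<star> w\<close> generated by an idempotent, and the loops of \<open>w\<close> are those of \<open>w\<^sup>\<star>\<close> with another base
  point. Hence the first homology is the direct sum of the projective modules \<open>\<int>F w\<^sup>\<star> w\<close>, one for each
  pair \<open>{w, w\<^sup>\<star>}\<close> of primitive words. This is \<open>Q2\<close>. Contracting along the tree gives a \<open>\<int>\<close>-linear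
  homotopy that proves exactness (\<open>homotopy0\<close>, \<open>homotopy1\<close>, \<open>homotopy2\<close>).

  \<^bold>\<open>Cohomology.\<close> Length two gives vanishing above degree two. For \<open>H\<^sup>2\<close>, take integer coefficients: a linear map
  \<open>k\<close> on \<open>Q1\<close> only depends on the letters of edges, so on the loop of \<open>w\<close> its coboundary is
  the sum of \<open>k x + k x\<^sup>\<star>\<close> over the letters \<open>x\<close> of \<open>w\<close>. For \<open>w = aa\<close> this is even, so the
  cochain with value \<open>1\<close> on every loop is not a coboundary (\<open>not_coboundary\<close>). Both facts are carried over
  to an arbitrary projective resolution by the usual comparison maps and homotopies
  (\<open>resolution_comparison\<close>).
\<close>

section \<open>Words without a factor \<open>z z\<^sup>\<star> z\<close>\<close>

notation word_star ("_\<^sup>\<star>" [1000] 1000)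

lemma letter_star_letter_star [simp]: "letter_star (letter_star x) = x"
  by (cases x) auto

lemma word_star_simps [simp]:
  "[]\<^sup>\<star> = []" "(u @ v)\<^sup>\<star> = v\<^sup>\<star> @ u\<^sup>\<star>" "(w\<^sup>\<star>)\<^sup>\<star> = w" "length (w\<^sup>\<star>) = length w"
  "w\<^sup>\<star> = [] \<longleftrightarrow> w = []" "(x # w)\<^sup>\<star> = w\<^sup>\<star> @ [letter_star x]"
  by (simp_all add: word_star_def rev_map[symmetric] o_def)

lemma word_star_eq_iff: "u\<^sup>\<star> = v \<longleftrightarrow> u = v\<^sup>\<star>"
  by (metis word_star_simps(3))

definition reducible :: "('a + 'a) list \<Rightarrow> bool" where
  "reducible t \<longleftrightarrow> (\<exists>p z q. z \<noteq> [] \<and> t = p @ z @ z\<^sup>\<star> @ z @ q)"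

lemma reducibleI: "z \<noteq> [] \<Longrightarrow> reducible (p @ z @ z\<^sup>\<star> @ z @ q)"
  unfolding reducible_def by blast

lemma reducible_append: "reducible t \<Longrightarrow> reducible (p @ t @ q)"
  unfolding reducible_def by (metis append.assoc)

lemma reducible_append2: "reducible t \<Longrightarrow> reducible (t @ q)"
  using reducible_append[of t "[]" q] by simp

lemma reducible_star_imp: "reducible t \<Longrightarrow> reducible (t\<^sup>\<star>)"
proof -
  assume "reducible t"
  then obtain p z q where "z \<noteq> []" "t = p @ z @ z\<^sup>\<star> @ z @ q" unfolding reducible_def by blast
  then have "t\<^sup>\<star> = q\<^sup>\<star> @ z\<^sup>\<star> @ (z\<^sup>\<star>)\<^sup>\<star> @ z\<^sup>\<star> @ p\<^sup>\<star>" by simp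
  then show ?thesis using \<open>z \<noteq> []\<close> reducibleI[of "z\<^sup>\<star>"] by (metis word_star_simps(5))
qed

lemma reducible_star [simp]: "reducible (t\<^sup>\<star>) = reducible t"
  using reducible_star_imp[of t] reducible_star_imp[of "t\<^sup>\<star>"] by auto

lemma irreducible_Nil [simp]: "\<not> reducible []"
  by (simp add: reducible_def)

text \<open>The words \<open>z\<close> for which \<open>z z\<^sup>\<star> z\<close> is a minimal reducible word: a prefix \<open>s s\<^sup>\<star>\<close> of \<open>z\<close> would produce
  \<open>s s\<^sup>\<star> s\<close> inside \<open>z\<^sup>\<star> z\<close>, and a suffix \<open>s s\<^sup>\<star>\<close> would produce it inside \<open>z z\<^sup>\<star>\<close>.\<close>

definition primitive :: "('a + 'a) list \<Rightarrow> bool" where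
  "primitive w \<longleftrightarrow> w \<noteq> [] \<and> \<not> reducible w \<and>
     (\<forall>s y. s \<noteq> [] \<longrightarrow> w \<noteq> s @ s\<^sup>\<star> @ y \<and> w \<noteq> y @ s @ s\<^sup>\<star>)"

lemma primitiveD:
  assumes "primitive w"
  shows "w \<noteq> []" "\<not> reducible w" "s \<noteq> [] \<Longrightarrow> w \<noteq> s @ s\<^sup>\<star> @ y" "s \<noteq> [] \<Longrightarrow> w \<noteq> y @ s @ s\<^sup>\<star>"
  using assms unfolding primitive_def by auto

lemma primitive_star: "primitive w \<Longrightarrow> primitive (w\<^sup>\<star>)"
  unfolding primitive_def
  by (simp add: word_star_eq_iff)

text \<open>A cut of a primitive word into \<open>a\<close> and \<open>b\<close> is never a full centre of reflection: neither side is the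
  mirror image of the adjacent part of the other side.\<close>

lemma primitive_no_centre:
  assumes "primitive (a @ b)" "a \<noteq> []" "b \<noteq> []"
  shows "a \<noteq> c @ b\<^sup>\<star>" "b \<noteq> a\<^sup>\<star> @ c"
  using primitiveD(3)[OF assms(1), of a c] primitiveD(4)[OF assms(1), of "b\<^sup>\<star>" c] assms by auto

text \<open>There is no middle letter, since no letter equals its own star.\<close>

lemma word_star_fixed:
  "w\<^sup>\<star> = w \<Longrightarrow> \<exists>s. w = s @ s\<^sup>\<star>"
proof (induction w rule: length_induct)
  case (1 w)
  have ne: "letter_star x \<noteq> x" for x :: "'a + 'a" by (cases x) auto
  show ?case
  proof (cases w)
    case Nil
    then show ?thesis by (intro exI[of _ "[]"]) simp
  next
    case (Cons x v)
    show ?thesis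
    proof (cases v rule: rev_cases)
      case Nil
      then show ?thesis using 1(2) Cons ne[of x] by simp
    next
      case (snoc v' y)
      have y: "x = letter_star y" and v': "v'\<^sup>\<star> = v'" using 1(2) Cons snoc by auto
      have "length v' < length w" using Cons snoc by simp
      then obtain s where s: "v' = s @ s\<^sup>\<star>" using 1(1) v' by blast
      have "w = (x # s) @ (x # s)\<^sup>\<star>" using Cons snoc y s by simp
      then show ?thesis by blast
    qed
  qed
qed

lemma primitive_ne_star:
  assumes "primitive w" shows "w\<^sup>\<star> \<noteq> w"
proof
  assume "w\<^sup>\<star> = w"
  then obtain s where s: "w = s @ s\<^sup>\<star> @ []" using word_star_fixed[of w] by auto
  then have "s \<noteq> []" using primitiveD(1)[OF assms] by auto
  then show False using primitiveD(3)[OF assms] s by blast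
qed

lemma append_eq_suffix:
  assumes "a @ b = c @ d" "length b \<le> length d"
  obtains e where "d = e @ b" "a = c @ e"
  using assms by (auto simp: append_eq_append_conv2)

text \<open>When a letter is appended to an irreducible word, a factor \<open>s s\<^sup>\<star> s\<close> can only occur at the very end. Inside
  \<open>z z\<^sup>\<star> z\<close>, a prefix or suffix \<open>s s\<^sup>\<star>\<close> of \<open>z\<close> would create one further to the left.\<close>

lemma reduction_primitive:
  assumes u: "\<not> reducible u" and eq: "u @ [x] = y @ z @ z\<^sup>\<star> @ z" and z: "z \<noteq> []"
  shows "primitive z"
proof -
  obtain z1 x' where z1: "z = z1 @ [x']" using z by (metis rev_exhaust)
  then have u': "u = y @ z @ z\<^sup>\<star> @ z1" using eq by simp
  have "\<not> reducible z" using u u' reducible_append by blast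
  moreover have "z \<noteq> s @ s\<^sup>\<star> @ y'" if "s \<noteq> []" for s y'
  proof
    assume zs: "z = s @ s\<^sup>\<star> @ y'"
    then have "butlast z = s @ butlast (s\<^sup>\<star> @ y')" using that by (simp add: butlast_append)
    then obtain r where "z1 = s @ r" using z1 by simp
    then have "u = (y @ z @ y'\<^sup>\<star>) @ s @ s\<^sup>\<star> @ s @ r" using u' zs by simp
    then show False using u reducibleI[OF that] by metis
  qed
  moreover have "z \<noteq> y' @ s @ s\<^sup>\<star>" if "s \<noteq> []" for s y'
  proof
    assume zs: "z = y' @ s @ s\<^sup>\<star>"
    then have "u = (y @ y') @ s @ s\<^sup>\<star> @ s @ (s\<^sup>\<star> @ y'\<^sup>\<star> @ z1)" using u' by simp
    then show False using u reducibleI[OF that] by metis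
  qed
  ultimately show ?thesis using z unfolding primitive_def by blast
qed

text \<open>A reduction at the end of \<open>a @ p\<close> either happens with a third factor \<open>z\<close> reaching back over all of \<open>p\<close>,
  or one of its two centres of reflection lies inside \<open>p\<close>. The latter is impossible: the centre closest to
  the start of \<open>p\<close> would show that \<open>p\<close> begins with some \<open>s s\<^sup>\<star>\<close>, or \<open>z z\<^sup>\<star> z\<close> would lie inside \<open>p\<close>.\<close>

lemma reduction_covers_prefix:
  assumes w: "primitive (p @ q)" and eq: "a @ p = y @ z @ z\<^sup>\<star> @ z" and z: "z \<noteq> []"
  shows "length p \<le> length z"
proof (rule ccontr)
  assume nle: "\<not> length p \<le> length z"
  have "(y @ z @ z\<^sup>\<star>) @ z = a @ p" using eq by simp
  then obtain p1 where p1: "p = p1 @ z" "y @ z @ z\<^sup>\<star> = a @ p1"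
    using append_eq_suffix[of "y @ z @ z\<^sup>\<star>" z a p] nle by (metis nle_le)
  have p1n: "p1 \<noteq> []" using nle p1(1) by auto
  \<comment> \<open>Here \<open>p1\<close> is the part of \<open>p\<close> before the centre of \<open>z\<^sup>\<star> z\<close>; if it is short, \<open>p\<close> begins with \<open>p1 p1\<^sup>\<star>\<close>.\<close>
  have beg: False if "z\<^sup>\<star> = c @ p1" for c
  proof -
    have "z = p1\<^sup>\<star> @ c\<^sup>\<star>" using that by (simp add: word_star_eq_iff)
    then have "p @ q = p1 @ p1\<^sup>\<star> @ (c\<^sup>\<star> @ q)" using p1(1) by simp
    then show False using primitiveD(3)[OF w p1n] by blast
  qed
  have eq1: "a @ p1 = (y @ z) @ z\<^sup>\<star>" using p1(2) by simp
  have nle1: "\<not> length p1 \<le> length (z\<^sup>\<star>)"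
    using append_eq_suffix[OF eq1] beg by metis
  \<comment> \<open>Otherwise the centre of \<open>z z\<^sup>\<star>\<close> lies in \<open>p\<close> as well, after a prefix \<open>p2\<close>.\<close>
  then obtain p2 where p2: "p1 = p2 @ z\<^sup>\<star>" "y @ z = a @ p2"
    using append_eq_suffix[OF eq1[symmetric]] by (metis nle_le)
  have p2n: "p2 \<noteq> []" using nle1 p2(1) by auto
  have eq2: "a @ p2 = y @ z" using p2(2) by simp
  show False
  proof (cases "length p2 \<le> length z")
    case True
    then obtain c where "z = c @ p2" using append_eq_suffix[OF eq2] by metis
    then have "p @ q = p2 @ p2\<^sup>\<star> @ (c\<^sup>\<star> @ z @ q)" using p1(1) p2(1) by simp
    then show False using primitiveD(3)[OF w p2n] by blast
  next
    case False
    then obtain p3 where "p2 = p3 @ z" using append_eq_suffix[OF eq2[symmetric]] by (metis nle_le)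
    then have "p @ q = p3 @ z @ z\<^sup>\<star> @ z @ q" using p1(1) p2(1) by simp
    then show False using primitiveD(2)[OF w] reducibleI[OF z] by metis
  qed
qed

text \<open>Each of the two candidates is primitive, so each covers the other.\<close>

lemma reduction_unique:
  assumes u: "\<not> reducible u" and z: "u @ [x] = y @ z @ z\<^sup>\<star> @ z" "z \<noteq> []"
    and z': "u @ [x] = y' @ z' @ z'\<^sup>\<star> @ z'" "z' \<noteq> []"
  shows "y = y'" "z = z'"
proof -
  have "primitive z" "primitive z'"
    using reduction_primitive[OF u] z z' by blast+
  then have "length z = length z'"
    using reduction_covers_prefix[of z "[]" "y @ z @ z\<^sup>\<star>" y' z']
      reduction_covers_prefix[of z' "[]" "y' @ z' @ z'\<^sup>\<star>" y z] z z' by auto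
  moreover have "(y @ z @ z\<^sup>\<star>) @ z = (y' @ z' @ z'\<^sup>\<star>) @ z'" using z z' by simp
  ultimately have "z = z'" and e: "y @ z @ z\<^sup>\<star> = y' @ z' @ z'\<^sup>\<star>"
    by (metis append_eq_append_conv)+
  then show "z = z'" "y = y'" by auto
qed

lemma reduction_exists:
  assumes u: "\<not> reducible u" and r: "reducible (u @ [x])"
  obtains y z where "z \<noteq> []" "u @ [x] = y @ z @ z\<^sup>\<star> @ z"
proof -
  obtain p z q where pzq: "z \<noteq> []" "u @ [x] = p @ z @ z\<^sup>\<star> @ z @ q"
    using r unfolding reducible_def by blast
  have "q = []"
  proof (rule ccontr)
    assume "q \<noteq> []"
    then obtain q1 x' where "q = q1 @ [x']" by (metis rev_exhaust)
    then have "u = p @ z @ z\<^sup>\<star> @ z @ q1" using pzq(2) by simp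
    then show False using u reducibleI[OF pzq(1)] by metis
  qed
  then show thesis using that pzq by simp
qed

section \<open>The right action of letters on irreducible words\<close>

definition step :: "('a + 'a) list \<Rightarrow> 'a + 'a \<Rightarrow> ('a + 'a) list" where
  "step u x = (if reducible (u @ [x])
     then SOME t. \<exists>y z. z \<noteq> [] \<and> u @ [x] = y @ z @ z\<^sup>\<star> @ z \<and> t = y @ z else u @ [x])"

definition run :: "('a + 'a) list \<Rightarrow> ('a + 'a) list \<Rightarrow> ('a + 'a) list" where
  "run = foldl step"

lemma run_simps [simp]: "run u [] = u" "run u (x # v) = run (step u x) v"
  by (simp_all add: run_def)

lemma run_append [simp]: "run u (v @ w) = run (run u v) w"
  by (simp add: run_def)

lemma step_append: "\<not> reducible (u @ [x]) \<Longrightarrow> step u x = u @ [x]"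
  by (simp add: step_def)

lemma step_reduce:
  assumes u: "\<not> reducible u" and z: "u @ [x] = y @ z @ z\<^sup>\<star> @ z" "z \<noteq> []"
  shows "step u x = y @ z"
proof -
  have "reducible (u @ [x])" using reducibleI[OF z(2), of y "[]"] z(1) by simp
  moreover have "(SOME t. \<exists>y z. z \<noteq> [] \<and> u @ [x] = y @ z @ z\<^sup>\<star> @ z \<and> t = y @ z) = y @ z"
    using reduction_unique[OF u z] z by (intro some_equality) blast+
  ultimately show ?thesis by (simp add: step_def)
qed

lemma irreducible_step:
  assumes u: "\<not> reducible u" shows "\<not> reducible (step u x)"
proof (cases "reducible (u @ [x])")
  case True
  then obtain y z where z: "z \<noteq> []" "u @ [x] = y @ z @ z\<^sup>\<star> @ z" using reduction_exists[OF u] by blast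
  obtain z1 x' where z1: "z = z1 @ [x']" using z by (metis rev_exhaust)
  have "u = (y @ z) @ z\<^sup>\<star> @ z1" using z z1 by simp
  then show ?thesis using u reducible_append2 step_reduce[OF u z(2,1)] by metis
qed (simp add: step_append)

lemma irreducible_run: "\<not> reducible u \<Longrightarrow> \<not> reducible (run u v)"
  by (induction v arbitrary: u) (auto simp: irreducible_step)

lemma run_irreducible: "\<not> reducible (u @ v) \<Longrightarrow> run u v = u @ v"
proof (induction v arbitrary: u)
  case (Cons x v)
  then have "\<not> reducible (u @ [x])" using reducible_append2[of "u @ [x]" v] by auto
  then show ?case using Cons by (simp add: step_append)
qed simp

text \<open>By \<open>reduction_covers_prefix\<close>, every reduction that occurs while the letters of \<open>w\<close> are appended keeps
  the prefix of \<open>w\<close> read so far as a suffix.\<close>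

lemma run_primitive:
  assumes w: "primitive w" and u: "\<not> reducible u"
  obtains u' where "run u w = u' @ w"
proof -
  have "\<exists>u'. run u p = u' @ p" if "w = p @ q" for p q
    using that
  proof (induction p arbitrary: q rule: rev_induct)
    case (snoc x p)
    then obtain u' where u': "run u p = u' @ p" by auto
    let ?v = "run u p"
    have v: "\<not> reducible ?v" by (rule irreducible_run[OF u])
    show ?case
    proof (cases "reducible (?v @ [x])")
      case True
      then obtain y z where z: "z \<noteq> []" "?v @ [x] = y @ z @ z\<^sup>\<star> @ z"
        using reduction_exists[OF v] by blast
      have eq: "u' @ (p @ [x]) = y @ z @ z\<^sup>\<star> @ z" using z(2) u' by simp
      have "length (p @ [x]) \<le> length z"
        using reduction_covers_prefix[OF _ eq z(1)] w snoc(2) by metis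
      then obtain e where "z = e @ p @ [x]" using append_eq_suffix[of u' "p @ [x]" "y @ z @ z\<^sup>\<star>" z] eq by auto
      then have "run u (p @ [x]) = (y @ e) @ (p @ [x])" using step_reduce[OF v z(2,1)] by simp
      then show ?thesis by blast
    next
      case False
      then show ?thesis using u' by (simp add: step_append)
    qed
  qed simp
  from this[of w "[]"] show thesis using that by auto
qed

lemma shortest_reducible_prefix:
  assumes "\<not> reducible u" "reducible (u @ v)"
  obtains v1 x v2 where "v = v1 @ x # v2" "\<not> reducible (u @ v1)" "reducible (u @ v1 @ [x])"
  using assms
proof (induction v arbitrary: thesis rule: rev_induct)
  case (snoc x v)
  show ?case
  proof (cases "reducible (u @ v)")
    case True
    then show ?thesis using snoc.IH[of thesis] snoc.prems by fastforce
  next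
    case False
    then show ?thesis using snoc.prems(1)[of v x "[]"] snoc.prems by simp
  qed
qed simp

text \<open>If \<open>b\<close> is preceded by its mirror image, then a reduction whose third factor \<open>z\<close> were longer than \<open>b\<close>
  would have the centre before \<open>b\<close> as a full centre of reflection of \<open>z\<close>.\<close>

lemma reduction_across_centre:
  assumes b: "b \<noteq> []" and z: "primitive z" and eq: "c @ b\<^sup>\<star> @ b = y @ z @ z\<^sup>\<star> @ z"
  shows "length z \<le> length b"
proof (rule ccontr)
  assume n: "\<not> length z \<le> length b"
  have e: "(c @ b\<^sup>\<star>) @ b = (y @ z @ z\<^sup>\<star>) @ z" using eq by simp
  then obtain a where a: "z = a @ b" "c @ b\<^sup>\<star> = (y @ z @ z\<^sup>\<star>) @ a"
    using append_eq_suffix[OF e] n by (metis nle_le)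
  have an: "a \<noteq> []" using n a(1) by auto
  have pz: "primitive (a @ b)" using z a(1) by simp
  show False
  proof (cases "length (b\<^sup>\<star>) \<le> length a")
    case True
    then obtain f where "a = f @ b\<^sup>\<star>" using append_eq_suffix[OF a(2)] by metis
    then show False using primitive_no_centre(1)[OF pz an b] by blast
  next
    case False
    then obtain f where "b\<^sup>\<star> = f @ a" using append_eq_suffix[OF a(2)[symmetric]] by (metis nle_le)
    then have "b = a\<^sup>\<star> @ f\<^sup>\<star>" by (simp add: word_star_eq_iff)
    then show False using primitive_no_centre(2)[OF pz an b] by blast
  qed
qed

text \<open>Walking back along \<open>w\<close> only leaves the irreducible words if \<open>w\<close> was itself walked straight back after
  \<open>w\<^sup>\<star>\<close>. The two length bounds above force the reduction to have \<open>z = b\<close> for the prefix \<open>b\<close> of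
  \<open>w\<^sup>\<star>\<close> at which it first happens, and a proper prefix would give \<open>w\<close> a full centre of reflection.\<close>

lemma fold_back:
  assumes w: "primitive w" and u: "\<not> reducible (u @ w)" and r: "reducible (u @ w @ w\<^sup>\<star>)"
  obtains y where "u = y @ w\<^sup>\<star>"
proof -
  obtain v1 x v2 where v: "w\<^sup>\<star> = v1 @ x # v2" "\<not> reducible ((u @ w) @ v1)" "reducible ((u @ w) @ v1 @ [x])"
    using shortest_reducible_prefix[of "u @ w" "w\<^sup>\<star>"] u r by (metis append.assoc)
  define b where "b = v1 @ [x]"
  have b: "b \<noteq> []" "w\<^sup>\<star> = b @ v2" using v(1) by (simp_all add: b_def)
  then have wb: "w = v2\<^sup>\<star> @ b\<^sup>\<star>" by (simp add: word_star_eq_iff)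
  obtain y z where z: "z \<noteq> []" "((u @ w) @ v1) @ [x] = y @ z @ z\<^sup>\<star> @ z"
    using reduction_exists[OF v(2), of x] v(3) by (metis append.assoc)
  have pz: "primitive z" by (rule reduction_primitive[OF v(2) z(2,1)])
  have eq: "(u @ w) @ b = y @ z @ z\<^sup>\<star> @ z" using z(2) by (simp add: b_def)
  have 1: "length b \<le> length z"
    using reduction_covers_prefix[OF _ eq z(1)] primitive_star[OF w] b(2) by metis
  have 2: "length z \<le> length b"
    by (rule reduction_across_centre[OF b(1) pz, of "u @ v2\<^sup>\<star>" y]) (use eq wb in simp)
  have "(u @ w) @ b = (y @ z @ z\<^sup>\<star>) @ z" using eq by simp
  then have zb: "z = b" and e: "u @ w = y @ z @ z\<^sup>\<star>"
    using 1 2 by (metis append_eq_append_conv le_antisym)+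
  have "v2 = []"
  proof (rule ccontr)
    assume n: "v2 \<noteq> []"
    have pw: "primitive (v2\<^sup>\<star> @ b\<^sup>\<star>)" using w wb by simp
    have e': "u @ v2\<^sup>\<star> = y @ b" using e wb zb by simp
    show False
    proof (cases "length (v2\<^sup>\<star>) \<le> length b")
      case True
      then obtain f where "b = f @ v2\<^sup>\<star>" using append_eq_suffix[OF e'] by metis
      then show False using primitive_no_centre(2)[OF pw, of "f\<^sup>\<star>"] n b(1) by simp
    next
      case False
      then obtain f where "v2\<^sup>\<star> = f @ b" using append_eq_suffix[OF e'[symmetric]] by (metis nle_le)
      then show False using primitive_no_centre(1)[OF pw, of f] n b(1) by simp
    qed
  qed
  then have "w\<^sup>\<star> = b" "w = b\<^sup>\<star>" using b wb by simp_all
  then have "u = y @ w\<^sup>\<star>" using e zb by simp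
  then show thesis by (rule that)
qed

text \<open>Dually, after \<open>u w w\<^sup>\<star>\<close> has been reached without a reduction, none happens before the last letter of the
  next \<open>w\<close>.\<close>

lemma fold_forth:
  assumes w: "primitive w" and u: "\<not> reducible (u @ w @ w\<^sup>\<star>)" and pq: "w = p @ q" "q \<noteq> []"
  shows "\<not> reducible (u @ w @ w\<^sup>\<star> @ p)"
proof
  assume "reducible (u @ w @ w\<^sup>\<star> @ p)"
  then obtain v1 x v2 where v: "p = v1 @ x # v2" "\<not> reducible ((u @ w @ w\<^sup>\<star>) @ v1)" "reducible ((u @ w @ w\<^sup>\<star>) @ v1 @ [x])"
    using shortest_reducible_prefix[of "u @ w @ w\<^sup>\<star>" p] u by (metis append.assoc)
  define b r where "b = v1 @ [x]" and "r = v2 @ q"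
  have b: "b \<noteq> []" "w = b @ r" "r \<noteq> []" using v(1) pq by (simp_all add: b_def r_def)
  obtain y z where z: "z \<noteq> []" "((u @ w @ w\<^sup>\<star>) @ v1) @ [x] = y @ z @ z\<^sup>\<star> @ z"
    using reduction_exists[OF v(2), of x] v(3) by (metis append.assoc)
  have pz: "primitive z" by (rule reduction_primitive[OF v(2) z(2,1)])
  have eq: "(u @ w @ w\<^sup>\<star>) @ b = y @ z @ z\<^sup>\<star> @ z" using z(2) by (simp add: b_def)
  have 1: "length b \<le> length z"
    using reduction_covers_prefix[OF _ eq z(1)] w b(2) by metis
  have 2: "length z \<le> length b"
    by (rule reduction_across_centre[OF b(1) pz, of "u @ w @ r\<^sup>\<star>" y]) (use eq b in simp)
  have "(u @ w @ w\<^sup>\<star>) @ b = (y @ z @ z\<^sup>\<star>) @ z" using eq by simp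
  then have zb: "z = b" and e: "u @ w @ w\<^sup>\<star> = y @ z @ z\<^sup>\<star>"
    using 1 2 by (metis append_eq_append_conv le_antisym)+
  have pw: "primitive (r\<^sup>\<star> @ b\<^sup>\<star>)" using primitive_star[OF w] b by simp
  have e': "(u @ w) @ r\<^sup>\<star> = y @ b" using e b(2) zb by simp
  show False
  proof (cases "length (r\<^sup>\<star>) \<le> length b")
    case True
    then obtain f where "b = f @ r\<^sup>\<star>" using append_eq_suffix[OF e'] by metis
    then show False using primitive_no_centre(2)[OF pw, of "f\<^sup>\<star>"] b by simp
  next
    case False
    then obtain f where "r\<^sup>\<star> = f @ b" using append_eq_suffix[OF e'[symmetric]] by (metis nle_le)
    then show False using primitive_no_centre(1)[OF pw, of f] b by simp
  qed
qed

lemma run_butlast: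
  assumes "z \<noteq> []"
  shows "run u z = step (run u (butlast z)) (last z)"
  by (metis append_butlast_last_id assms run_append run_simps)

lemma run_fold_forth:
  assumes w: "primitive w" and u: "\<not> reducible (u @ w @ w\<^sup>\<star>)"
  shows "run (u @ w @ w\<^sup>\<star>) w = u @ w"
proof -
  have n: "w \<noteq> []" by (rule primitiveD[OF w])
  have irr: "\<not> reducible ((u @ w @ w\<^sup>\<star>) @ butlast w)"
    using fold_forth[OF w u, of "butlast w" "[last w]"] n by simp
  have "run (u @ w @ w\<^sup>\<star>) w = step ((u @ w @ w\<^sup>\<star>) @ butlast w) (last w)"
    using run_butlast[OF n] run_irreducible[OF irr] by metis
  also have "\<dots> = u @ w"
    using step_reduce[OF irr, of "last w" u w] n by simp
  finally show ?thesis .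
qed

text \<open>After reading \<open>w\<close> the word is some \<open>u' w\<close>. Either \<open>w\<^sup>\<star>\<close> leads to the irreducible word \<open>u' w w\<^sup>\<star>\<close>, and the
  next \<open>w\<close> is folded away at its last letter; or \<open>u' w = y w\<^sup>\<star> w\<close>, where \<open>w\<^sup>\<star>\<close> is folded away and leads
  to \<open>y w\<^sup>\<star>\<close>, and \<open>w\<close> can then be appended again.\<close>

lemma run_primitive_rule:
  assumes w: "primitive w" and u: "\<not> reducible u"
  shows "run u (w @ w\<^sup>\<star> @ w) = run u w"
proof -
  obtain u' where u': "run u w = u' @ w" using run_primitive[OF w u] by blast
  have irr: "\<not> reducible (u' @ w)" using irreducible_run[OF u, of w] u' by simp
  show ?thesis
  proof (cases "reducible (u' @ w @ w\<^sup>\<star>)")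
    case False
    then show ?thesis using run_fold_forth[OF w False] run_irreducible[of "u' @ w" "w\<^sup>\<star>"] u' by simp
  next
    case True
    then obtain y where y: "u' = y @ w\<^sup>\<star>" using fold_back[OF w irr] by blast
    then have "run (u' @ w) (w\<^sup>\<star>) = y @ w\<^sup>\<star>"
      using run_fold_forth[OF primitive_star[OF w], of y] irr by simp
    moreover have "run (y @ w\<^sup>\<star>) w = y @ w\<^sup>\<star> @ w" using run_irreducible[of "y @ w\<^sup>\<star>" w] irr y by simp
    ultimately show ?thesis using u' y by simp
  qed
qed

lemma nonprimitive_cases:
  assumes "w \<noteq> []"
  obtains (prim) "primitive w" | (left) s y where "s \<noteq> []" "w = s @ s\<^sup>\<star> @ y"
    | (right) s y where "s \<noteq> []" "w = y @ s @ s\<^sup>\<star>"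
    | (red) p z q where "primitive z" "w = p @ z @ z\<^sup>\<star> @ z @ q"
proof (cases "reducible w")
  case True
  then obtain v1 x v2 where v: "w = v1 @ x # v2" "\<not> reducible v1" "reducible (v1 @ [x])"
    using shortest_reducible_prefix[of "[]" w] by auto
  then obtain y z where z: "z \<noteq> []" "v1 @ [x] = y @ z @ z\<^sup>\<star> @ z" using reduction_exists by blast
  have "w = (v1 @ [x]) @ v2" using v(1) by simp
  then have "w = y @ z @ z\<^sup>\<star> @ z @ v2" using z(2) by simp
  then show thesis using red reduction_primitive[OF v(2) z(2,1)] by blast
next
  case False
  then show thesis using assms prim left right unfolding primitive_def by blast
qed

text \<open>Induction on the length reduces the relation to primitive \<open>w\<close>. For \<open>w = y s s\<^sup>\<star>\<close>, the word
  \<open>w w\<^sup>\<star> w = y s s\<^sup>\<star> s s\<^sup>\<star> y\<^sup>\<star> y s s\<^sup>\<star>\<close> turns into \<open>(ys)(ys)\<^sup>\<star>(ys) s\<^sup>\<star>\<close> by the relation for \<open>s\<close>, and then into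
  \<open>w\<close> by the relation for \<open>ys\<close>; the case \<open>w = s s\<^sup>\<star> y\<close> is symmetric. If \<open>w\<close> contains \<open>z z\<^sup>\<star> z\<close>, then both
  \<open>w\<close> and \<open>w\<^sup>\<star>\<close> act like shorter words.\<close>

lemma run_rule:
  assumes "\<not> reducible u"
  shows "run u (w @ w\<^sup>\<star> @ w) = run u w"
  using assms
proof (induction w arbitrary: u rule: length_induct)
  case (1 w)
  have IH: "run u (v @ v\<^sup>\<star> @ v) = run u v" if "length v < length w" "\<not> reducible u" for u v :: "('a + 'a) list"
    using 1(1) that by simp
  note irr = irreducible_run[OF 1(2)]
  show ?case
  proof (cases "w = []")
    case False
    then show ?thesis
    proof (cases rule: nonprimitive_cases)
      case prim
      then show ?thesis by (rule run_primitive_rule[OF _ 1(2)])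
    next
      case (left s y)
      let ?v = "s\<^sup>\<star> @ y"
      have "run u (w @ w\<^sup>\<star> @ w) = run (run (run u (s @ s\<^sup>\<star> @ y @ y\<^sup>\<star>)) (s @ s\<^sup>\<star> @ s)) (s\<^sup>\<star> @ y)"
        by (simp add: left)
      also have "\<dots> = run (run (run u (s @ s\<^sup>\<star> @ y @ y\<^sup>\<star>)) s) (s\<^sup>\<star> @ y)"
        by (subst IH) (auto simp: left irreducible_run 1(2))
      also have "\<dots> = run (run u s) (?v @ ?v\<^sup>\<star> @ ?v)" by simp
      also have "\<dots> = run (run u s) ?v"
        by (rule IH) (auto simp: left irreducible_run 1(2))
      finally show ?thesis by (simp add: left)
    next
      case (right s y)
      let ?v = "y @ s"
      have "run u (w @ w\<^sup>\<star> @ w) = run (run (run u y) (s @ s\<^sup>\<star> @ s)) (s\<^sup>\<star> @ y\<^sup>\<star> @ y @ s @ s\<^sup>\<star>)"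
        by (simp add: right)
      also have "\<dots> = run (run (run u y) s) (s\<^sup>\<star> @ y\<^sup>\<star> @ y @ s @ s\<^sup>\<star>)"
        by (subst IH) (auto simp: right irreducible_run 1(2))
      also have "\<dots> = run (run u (?v @ ?v\<^sup>\<star> @ ?v)) (s\<^sup>\<star>)" by simp
      also have "\<dots> = run (run u ?v) (s\<^sup>\<star>)"
        by (subst IH) (use right 1(2) in auto)
      finally show ?thesis by (simp add: right)
    next
      case (red p z q)
      let ?v = "p @ z @ q"
      have w: "run u w = run u ?v" if "\<not> reducible u" for u
      proof -
        have "run u w = run (run (run u p) (z @ z\<^sup>\<star> @ z)) q" by (simp add: red)
        also have "\<dots> = run u ?v"
          by (subst run_primitive_rule[OF red(1)]) (use irreducible_run[OF that] in auto)
        finally show ?thesis .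
      qed
      have ws: "run u (w\<^sup>\<star>) = run u (?v\<^sup>\<star>)" if "\<not> reducible u" for u
      proof -
        have "run u (w\<^sup>\<star>) = run (run (run u (q\<^sup>\<star>)) (z\<^sup>\<star> @ (z\<^sup>\<star>)\<^sup>\<star> @ z\<^sup>\<star>)) (p\<^sup>\<star>)" by (simp add: red)
        also have "\<dots> = run u (?v\<^sup>\<star>)"
          by (subst run_primitive_rule[OF primitive_star[OF red(1)]]) (use irreducible_run[OF that] in auto)
        finally show ?thesis .
      qed
      have "run u (w @ w\<^sup>\<star> @ w) = run u (?v @ ?v\<^sup>\<star> @ ?v)"
        using w[of u] w[OF irreducible_run] ws[OF irreducible_run] 1(2) irreducible_run by (metis run_append)
      also have "\<dots> = run u ?v" by (rule IH) (use red(2) primitiveD(1)[OF red(1)] 1(2) in auto)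
      finally show ?thesis using w[OF 1(2)] by simp
    qed
  qed simp
qed

section \<open>Linear maps between left modules\<close>

lemma lmod_homD:
  assumes "f \<in> lmod_hom R P Q"
  shows "x \<in> carrier P \<Longrightarrow> f x \<in> carrier Q"
    and "\<lbrakk>x \<in> carrier P; y \<in> carrier P\<rbrakk> \<Longrightarrow> f (x \<oplus>\<^bsub>P\<^esub> y) = f x \<oplus>\<^bsub>Q\<^esub> f y"
    and "\<lbrakk>a \<in> carrier R; x \<in> carrier P\<rbrakk> \<Longrightarrow> f (a \<odot>\<^bsub>P\<^esub> x) = a \<odot>\<^bsub>Q\<^esub> f x"
  using assms unfolding lmod_hom_def by auto

lemma lmod_homI:
  assumes "\<And>x. x \<in> carrier P \<Longrightarrow> f x \<in> carrier Q"
    and "\<And>x y. \<lbrakk>x \<in> carrier P; y \<in> carrier P\<rbrakk> \<Longrightarrow> f (x \<oplus>\<^bsub>P\<^esub> y) = f x \<oplus>\<^bsub>Q\<^esub> f y"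
    and "\<And>a x. \<lbrakk>a \<in> carrier R; x \<in> carrier P\<rbrakk> \<Longrightarrow> f (a \<odot>\<^bsub>P\<^esub> x) = a \<odot>\<^bsub>Q\<^esub> f x"
  shows "f \<in> lmod_hom R P Q"
  using assms unfolding lmod_hom_def by auto

lemma lmod_hom_comp:
  assumes f: "f \<in> lmod_hom R P Q" and g: "g \<in> lmod_hom R Q S"
  shows "(\<lambda>x. g (f x)) \<in> lmod_hom R P S"
  by (rule lmod_homI) (simp_all add: lmod_homD[OF f] lmod_homD[OF g])

lemma lmod_hom_id: "(\<lambda>x. x) \<in> lmod_hom R P P"
  by (rule lmod_homI) simp_all

lemma additive_minus:
  assumes P: "abelian_group P" and Q: "abelian_group Q"
    and f: "\<And>x. x \<in> carrier P \<Longrightarrow> f x \<in> carrier Q"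
      "\<And>x y. \<lbrakk>x \<in> carrier P; y \<in> carrier P\<rbrakk> \<Longrightarrow> f (x \<oplus>\<^bsub>P\<^esub> y) = f x \<oplus>\<^bsub>Q\<^esub> f y"
  shows "f \<zero>\<^bsub>P\<^esub> = \<zero>\<^bsub>Q\<^esub>" "\<lbrakk>x \<in> carrier P; y \<in> carrier P\<rbrakk> \<Longrightarrow> f (x \<ominus>\<^bsub>P\<^esub> y) = f x \<ominus>\<^bsub>Q\<^esub> f y"
proof -
  interpret P: abelian_group P by (rule P)
  interpret Q: abelian_group Q by (rule Q)
  have "f \<zero>\<^bsub>P\<^esub> \<oplus>\<^bsub>Q\<^esub> f \<zero>\<^bsub>P\<^esub> = f \<zero>\<^bsub>P\<^esub>"
    using f(2)[of "\<zero>\<^bsub>P\<^esub>" "\<zero>\<^bsub>P\<^esub>"] by simp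
  then show z: "f \<zero>\<^bsub>P\<^esub> = \<zero>\<^bsub>Q\<^esub>" using f(1)[of "\<zero>\<^bsub>P\<^esub>"] by (metis P.zero_closed Q.add.l_cancel_one)
  assume xy: "x \<in> carrier P" "y \<in> carrier P"
  have "f (\<ominus>\<^bsub>P\<^esub> y) \<oplus>\<^bsub>Q\<^esub> f y = \<zero>\<^bsub>Q\<^esub>"
    using f(2)[of "\<ominus>\<^bsub>P\<^esub> y" y] xy z by (simp add: P.l_neg)
  then have "f (\<ominus>\<^bsub>P\<^esub> y) = \<ominus>\<^bsub>Q\<^esub> f y"
    using f(1) xy by (simp add: Q.minus_equality)
  then show "f (x \<ominus>\<^bsub>P\<^esub> y) = f x \<ominus>\<^bsub>Q\<^esub> f y"
    using f(2)[of x "\<ominus>\<^bsub>P\<^esub> y"] xy by (simp add: a_minus_def)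
qed

lemma left_module_abelian: "left_module R P \<Longrightarrow> abelian_group P"
  unfolding left_module_def by blast

lemma lmod_hom_minus:
  assumes P: "left_module R P" and Q: "left_module R Q" and f: "f \<in> lmod_hom R P Q"
  shows "f \<zero>\<^bsub>P\<^esub> = \<zero>\<^bsub>Q\<^esub>"
    and "\<lbrakk>x \<in> carrier P; y \<in> carrier P\<rbrakk> \<Longrightarrow> f (x \<ominus>\<^bsub>P\<^esub> y) = f x \<ominus>\<^bsub>Q\<^esub> f y"
  using additive_minus[OF left_module_abelian[OF P] left_module_abelian[OF Q], of f]
    lmod_homD[OF f] abelian_groupE(2)[OF left_module_abelian[OF P]] by blast+

lemma smult_minus:
  assumes P: "left_module R P" and a: "a \<in> carrier R"
  shows "a \<odot>\<^bsub>P\<^esub> \<zero>\<^bsub>P\<^esub> = \<zero>\<^bsub>P\<^esub>"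
    and "\<lbrakk>x \<in> carrier P; y \<in> carrier P\<rbrakk> \<Longrightarrow> a \<odot>\<^bsub>P\<^esub> (x \<ominus>\<^bsub>P\<^esub> y) = a \<odot>\<^bsub>P\<^esub> x \<ominus>\<^bsub>P\<^esub> a \<odot>\<^bsub>P\<^esub> y"
proof -
  interpret left_module R P by (rule P)
  note A = left_module_abelian[OF P]
  show "a \<odot>\<^bsub>P\<^esub> \<zero>\<^bsub>P\<^esub> = \<zero>\<^bsub>P\<^esub>"
    by (rule additive_minus(1)[OF A A]) (simp_all add: a smult_closed smult_r_distr)
  show "a \<odot>\<^bsub>P\<^esub> (x \<ominus>\<^bsub>P\<^esub> y) = a \<odot>\<^bsub>P\<^esub> x \<ominus>\<^bsub>P\<^esub> a \<odot>\<^bsub>P\<^esub> y" if "x \<in> carrier P" "y \<in> carrier P"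
    by (rule additive_minus(2)[OF A A]) (simp_all add: a that smult_closed smult_r_distr)
qed

lemma lmod_hom_diff:
  assumes Q: "left_module R Q" and f: "f \<in> lmod_hom R P Q" and g: "g \<in> lmod_hom R P Q"
  shows "(\<lambda>x. f x \<ominus>\<^bsub>Q\<^esub> g x) \<in> lmod_hom R P Q"
proof (rule lmod_homI)
  interpret left_module R Q by (rule Q)
  fix x assume x: "x \<in> carrier P"
  show "f x \<ominus>\<^bsub>Q\<^esub> g x \<in> carrier Q" using x lmod_homD(1)[OF f] lmod_homD(1)[OF g] by simp
  show "f (a \<odot>\<^bsub>P\<^esub> x) \<ominus>\<^bsub>Q\<^esub> g (a \<odot>\<^bsub>P\<^esub> x) = a \<odot>\<^bsub>Q\<^esub> (f x \<ominus>\<^bsub>Q\<^esub> g x)" if "a \<in> carrier R" for a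
    using x that smult_minus(2)[OF Q that] by (simp add: lmod_homD[OF f] lmod_homD[OF g])
  fix y assume y: "y \<in> carrier P"
  show "f (x \<oplus>\<^bsub>P\<^esub> y) \<ominus>\<^bsub>Q\<^esub> g (x \<oplus>\<^bsub>P\<^esub> y) = f x \<ominus>\<^bsub>Q\<^esub> g x \<oplus>\<^bsub>Q\<^esub> (f y \<ominus>\<^bsub>Q\<^esub> g y)"
    using x y by (simp add: lmod_homD[OF f] lmod_homD[OF g] a_minus_def minus_add M.add.m_ac)
qed


section \<open>Linearity over a monoid ring\<close>

lemma monoid_ring_simps:
  "f \<in> carrier (monoid_ring M) \<longleftrightarrow> finite (supp f) \<and> supp f \<subseteq> carrier M"
  "\<zero>\<^bsub>monoid_ring M\<^esub> = (\<lambda>m. 0)" "f \<oplus>\<^bsub>monoid_ring M\<^esub> g = (\<lambda>m. f m + g m)"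
  "\<one>\<^bsub>monoid_ring M\<^esub> = delta \<one>\<^bsub>M\<^esub>"
  by (simp_all add: monoid_ring_def)

lemma supp_delta [simp]: "supp (delta m) = {m}"
  by (auto simp: supp_def delta_def)

lemma delta_carrier [simp]: "delta m \<in> carrier (monoid_ring M) \<longleftrightarrow> m \<in> carrier M"
  by (simp add: monoid_ring_simps)

lemma delta_mult:
  assumes "monoid M" "m \<in> carrier M" "n \<in> carrier M"
  shows "delta m \<otimes>\<^bsub>monoid_ring M\<^esub> delta n = delta (m \<otimes>\<^bsub>M\<^esub> n)"
proof
  fix k
  show "(delta m \<otimes>\<^bsub>monoid_ring M\<^esub> delta n) k = delta (m \<otimes>\<^bsub>M\<^esub> n) k"
    by (subst monoid_ring_mult[of "{m}" "{n}"]) (simp_all, simp add: delta_def)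
qed

lemma monoid_ring_minus:
  assumes M: "monoid M" and "f \<in> carrier (monoid_ring M)" "g \<in> carrier (monoid_ring M)"
  shows "f \<ominus>\<^bsub>monoid_ring M\<^esub> g = (\<lambda>m. f m - g m)"
proof -
  interpret ring "monoid_ring M" by (rule monoid_ring_is_ring[OF M])
  have "supp (\<lambda>m. - g m) = supp g" by (auto simp: supp_def)
  then have "(\<lambda>m. - g m) \<in> carrier (monoid_ring M)" using assms(3) by (simp add: monoid_ring_simps)
  moreover have "(\<lambda>m. - g m) \<oplus>\<^bsub>monoid_ring M\<^esub> g = \<zero>\<^bsub>monoid_ring M\<^esub>" by (simp add: monoid_ring_simps)
  ultimately have "\<ominus>\<^bsub>monoid_ring M\<^esub> g = (\<lambda>m. - g m)" using assms(3) by (metis minus_equality)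
  then show ?thesis by (simp add: a_minus_def monoid_ring_simps)
qed

text \<open>The monoid ring is generated by the monoid as an additive group, so identities that are additive in the
  scalar need only be checked on monoid elements.\<close>

lemma monoid_ring_induct [consumes 2, case_names zero delta minus]:
  assumes M: "monoid M" and f: "f \<in> carrier (monoid_ring M)"
    and "Q \<zero>\<^bsub>monoid_ring M\<^esub>" and "\<And>m. m \<in> carrier M \<Longrightarrow> Q (delta m)"
    and step: "\<And>f g. \<lbrakk>f \<in> carrier (monoid_ring M); g \<in> carrier (monoid_ring M); Q f; Q g\<rbrakk>
           \<Longrightarrow> Q (f \<ominus>\<^bsub>monoid_ring M\<^esub> g)"
  shows "Q f"
proof -
  interpret ring "monoid_ring M" by (rule monoid_ring_is_ring[OF M])
  let ?c = "Poly_Mapping.Abs_poly_mapping f"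
  have fin: "finite {m. f m \<noteq> 0}" and sub: "{m. f m \<noteq> 0} \<subseteq> carrier M"
    using f by (auto simp: monoid_ring_simps supp_def)
  have keys: "Poly_Mapping.keys ?c = {m. f m \<noteq> 0}"
    using fin by (simp add: Poly_Mapping.keys.rep_eq)
  have "Poly_Mapping.keys ?c \<subseteq> carrier M" using sub keys by simp
  then have "Poly_Mapping.lookup ?c \<in> carrier (monoid_ring M) \<and> Q (Poly_Mapping.lookup ?c)"
  proof (induction rule: frag_induction)
    case zero
    then show ?case using assms(3) by (simp add: monoid_ring_simps supp_def Poly_Mapping.zero_poly_mapping.rep_eq)
  next
    case (one m)
    have "Poly_Mapping.lookup (frag_of m) = delta m" by (auto simp: delta_def)
    then show ?case using assms(4) one by (metis delta_carrier)
  next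
    case (diff a b)
    then have "Poly_Mapping.lookup (a - b) = Poly_Mapping.lookup a \<ominus>\<^bsub>monoid_ring M\<^esub> Poly_Mapping.lookup b"
      by (simp add: monoid_ring_minus[OF M] Poly_Mapping.lookup_minus fun_eq_iff)
    then show ?case using diff step by (metis minus_closed)
  qed
  moreover have "Poly_Mapping.lookup ?c = f" using fin by simp
  ultimately show ?thesis by simp
qed

lemma smult_minus_left:
  assumes P: "left_module R P" and x: "x \<in> carrier P"
  shows "\<zero>\<^bsub>R\<^esub> \<odot>\<^bsub>P\<^esub> x = \<zero>\<^bsub>P\<^esub>"
    and "\<lbrakk>a \<in> carrier R; b \<in> carrier R\<rbrakk> \<Longrightarrow> (a \<ominus>\<^bsub>R\<^esub> b) \<odot>\<^bsub>P\<^esub> x = a \<odot>\<^bsub>P\<^esub> x \<ominus>\<^bsub>P\<^esub> b \<odot>\<^bsub>P\<^esub> x"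
proof -
  interpret left_module R P by (rule P)
  note A = R.abelian_group_axioms left_module_abelian[OF P]
  show "\<zero>\<^bsub>R\<^esub> \<odot>\<^bsub>P\<^esub> x = \<zero>\<^bsub>P\<^esub>"
    by (rule additive_minus(1)[OF A]) (simp_all add: x smult_closed smult_l_distr)
  show "(a \<ominus>\<^bsub>R\<^esub> b) \<odot>\<^bsub>P\<^esub> x = a \<odot>\<^bsub>P\<^esub> x \<ominus>\<^bsub>P\<^esub> b \<odot>\<^bsub>P\<^esub> x" if "a \<in> carrier R" "b \<in> carrier R"
    by (rule additive_minus(2)[OF A]) (simp_all add: x that smult_closed smult_l_distr)
qed

lemma lmod_hom_monoid_ringI:
  assumes M: "monoid M" and P: "left_module (monoid_ring M) P" and Q: "left_module (monoid_ring M) Q"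
    and f: "\<And>x. x \<in> carrier P \<Longrightarrow> f x \<in> carrier Q"
      "\<And>x y. \<lbrakk>x \<in> carrier P; y \<in> carrier P\<rbrakk> \<Longrightarrow> f (x \<oplus>\<^bsub>P\<^esub> y) = f x \<oplus>\<^bsub>Q\<^esub> f y"
      "\<And>m x. \<lbrakk>m \<in> carrier M; x \<in> carrier P\<rbrakk> \<Longrightarrow> f (delta m \<odot>\<^bsub>P\<^esub> x) = delta m \<odot>\<^bsub>Q\<^esub> f x"
  shows "f \<in> lmod_hom (monoid_ring M) P Q"
proof (rule lmod_homI)
  interpret P: left_module "monoid_ring M" P by (rule P)
  interpret Q: left_module "monoid_ring M" Q by (rule Q)
  fix a x assume a: "a \<in> carrier (monoid_ring M)" and x: "x \<in> carrier P"
  note f_minus = additive_minus[OF left_module_abelian[OF P] left_module_abelian[OF Q], of f, OF f(1,2)]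
  from M a show "f (a \<odot>\<^bsub>P\<^esub> x) = a \<odot>\<^bsub>Q\<^esub> f x"
  proof (induction rule: monoid_ring_induct)
    case zero
    then show ?case using x f(1) f_minus(1)
      by (simp add: smult_minus_left(1)[OF P] smult_minus_left(1)[OF Q])
  next
    case (minus a b)
    then show ?case using x f(1) f_minus(2)
      by (simp add: smult_minus_left(2)[OF P] smult_minus_left(2)[OF Q] P.smult_closed)
  qed (use f(3) x in auto)
qed (use f in auto)


section \<open>Permutation modules\<close>

text \<open>The free abelian group on a left \<open>M\<close>-set \<open>S\<close>, with the action extended bilinearly.\<close>

definition frag_module :: "'s set \<Rightarrow> ('m \<Rightarrow> 's \<Rightarrow> 's) \<Rightarrow> ('m \<Rightarrow> int, 's \<Rightarrow>\<^sub>0 int) module" where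
  "frag_module S act =
     \<lparr>carrier = {c. Poly_Mapping.keys c \<subseteq> S}, mult = undefined, one = undefined, zero = 0, add = (+),
      smult = (\<lambda>f c. frag_extend (\<lambda>m. frag_extend (\<lambda>s. frag_of (act m s)) c) (Poly_Mapping.Abs_poly_mapping f))\<rparr>"

locale monoid_action = monoid M for M (structure) +
  fixes S :: "'s set" and act :: "'a \<Rightarrow> 's \<Rightarrow> 's"
  assumes act_closed: "\<lbrakk>m \<in> carrier M; s \<in> S\<rbrakk> \<Longrightarrow> act m s \<in> S"
    and act_one: "s \<in> S \<Longrightarrow> act \<one>\<^bsub>M\<^esub> s = s"
    and act_mult: "\<lbrakk>m \<in> carrier M; n \<in> carrier M; s \<in> S\<rbrakk> \<Longrightarrow> act (m \<otimes>\<^bsub>M\<^esub> n) s = act m (act n s)"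
begin

abbreviation "Z \<equiv> frag_module S act"

lemma frag_module_simps:
  "c \<in> carrier Z \<longleftrightarrow> Poly_Mapping.keys c \<subseteq> S" "\<zero>\<^bsub>Z\<^esub> = 0" "c \<oplus>\<^bsub>Z\<^esub> c' = c + c'"
  by (simp_all add: frag_module_def)

lemma frag_of_carrier [simp]: "frag_of s \<in> carrier Z \<longleftrightarrow> s \<in> S"
  by (simp add: frag_module_simps)

lemma frag_module_abelian: "abelian_group Z"
proof (rule abelian_groupI)
  fix c assume "c \<in> carrier Z"
  then show "\<exists>y\<in>carrier Z. y \<oplus>\<^bsub>Z\<^esub> c = \<zero>\<^bsub>Z\<^esub>"
    by (intro bexI[of _ "- c"]) (auto simp: frag_module_simps)
next
  fix c c' assume "c \<in> carrier Z" "c' \<in> carrier Z"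
  then show "c \<oplus>\<^bsub>Z\<^esub> c' \<in> carrier Z"
    unfolding frag_module_simps using keys_add[of c c'] by blast
qed (simp_all add: frag_module_simps add_ac)

lemma frag_module_minus: 
  assumes "c \<in> carrier Z" "c' \<in> carrier Z" shows "c \<ominus>\<^bsub>Z\<^esub> c' = c - c'"
proof -
  interpret abelian_group Z by (rule frag_module_abelian)
  have "\<ominus>\<^bsub>Z\<^esub> c' = - c'"
    by (rule minus_equality) (use assms in \<open>auto simp: frag_module_simps\<close>)
  then show ?thesis by (simp add: a_minus_def frag_module_simps)
qed

lemma frag_module_delta:
  "delta m \<odot>\<^bsub>Z\<^esub> c = frag_extend (\<lambda>s. frag_of (act m s)) c"
proof -
  have fin: "finite {x. delta m x \<noteq> 0}" by (simp add: delta_def)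
  have "Poly_Mapping.Abs_poly_mapping (delta m) = frag_of m"
    using Poly_Mapping.lookup_Abs_poly_mapping[OF fin] by (intro poly_mapping_eqI) (simp, simp add: delta_def)
  then show ?thesis by (simp add: frag_module_def)
qed

lemma frag_module_delta_of [simp]: "delta m \<odot>\<^bsub>Z\<^esub> frag_of s = frag_of (act m s)"
  by (simp add: frag_module_delta)

lemma frag_module_induct [consumes 1, case_names zero one minus]:
  assumes "c \<in> carrier Z" "Q 0" "\<And>s. s \<in> S \<Longrightarrow> Q (frag_of s)"
    "\<And>c c'. \<lbrakk>c \<in> carrier Z; c' \<in> carrier Z; Q c; Q c'\<rbrakk> \<Longrightarrow> Q (c - c')"
  shows "Q c"
proof -
  have "c \<in> carrier Z \<and> Q c"
    using assms(1) unfolding frag_module_simps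
  proof (induction rule: frag_induction)
    case (diff a b)
    then have "Poly_Mapping.keys (a - b) \<subseteq> S" using keys_diff[of a b] by blast
    then show ?case using diff assms(4) by (simp add: frag_module_simps)
  qed (use assms in auto)
  then show ?thesis ..
qed

lemma frag_module_left_module: "left_module (monoid_ring M) Z"
proof -
  let ?R = "monoid_ring M"
  have M: "monoid M" by unfold_locales
  interpret R: ring ?R by (rule monoid_ring_is_ring[OF M])
  interpret Z: abelian_group Z by (rule frag_module_abelian)
  have Abs: "Poly_Mapping.Abs_poly_mapping (\<lambda>m. a m + b m) = Poly_Mapping.Abs_poly_mapping a + Poly_Mapping.Abs_poly_mapping b"
    if "finite (supp a)" "finite (supp b)" for a b :: "'a \<Rightarrow> int"
  proof (rule poly_mapping_eqI)
    fix k
    have "finite {m. a m + b m \<noteq> 0}"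
      by (rule finite_subset[of _ "supp a \<union> supp b"]) (use that in \<open>auto simp: supp_def\<close>)
    then show "Poly_Mapping.lookup (Poly_Mapping.Abs_poly_mapping (\<lambda>m. a m + b m)) k
        = Poly_Mapping.lookup (Poly_Mapping.Abs_poly_mapping a + Poly_Mapping.Abs_poly_mapping b) k"
      using that by (simp add: lookup_add supp_def)
  qed
  have l: "(a \<oplus>\<^bsub>?R\<^esub> b) \<odot>\<^bsub>Z\<^esub> c = a \<odot>\<^bsub>Z\<^esub> c \<oplus>\<^bsub>Z\<^esub> b \<odot>\<^bsub>Z\<^esub> c" if "a \<in> carrier ?R" "b \<in> carrier ?R" for a b c
    using that by (simp add: monoid_ring_simps frag_module_def Abs frag_extend_add)
  have r: "a \<odot>\<^bsub>Z\<^esub> (c \<oplus>\<^bsub>Z\<^esub> c') = a \<odot>\<^bsub>Z\<^esub> c \<oplus>\<^bsub>Z\<^esub> a \<odot>\<^bsub>Z\<^esub> c'" for a c c'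
    by (simp add: frag_module_def frag_extend_add) (simp add: frag_extend_def frag_cmul_distrib2 sum.distrib)
  have cl: "a \<odot>\<^bsub>Z\<^esub> c \<in> carrier Z" if a: "a \<in> carrier ?R" and c: "c \<in> carrier Z" for a c
  proof -
    have "Poly_Mapping.keys (Poly_Mapping.Abs_poly_mapping a) \<subseteq> carrier M"
      using a by (auto simp: monoid_ring_simps supp_def Poly_Mapping.keys.rep_eq)
    moreover have "Poly_Mapping.keys (frag_extend (\<lambda>s. frag_of (act m s)) c) \<subseteq> S" if "m \<in> carrier M" for m
      using keys_frag_extend[of "\<lambda>s. frag_of (act m s)" c] c act_closed[OF that]
      by (auto simp: frag_module_simps)
    moreover have "Poly_Mapping.keys (a \<odot>\<^bsub>Z\<^esub> c) \<subseteq> (\<Union>m \<in> Poly_Mapping.keys (Poly_Mapping.Abs_poly_mapping a).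
        Poly_Mapping.keys (frag_extend (\<lambda>s. frag_of (act m s)) c))"
      using keys_frag_extend[of "\<lambda>m. frag_extend (\<lambda>s. frag_of (act m s)) c" "Poly_Mapping.Abs_poly_mapping a"]
      by (simp add: frag_module_def)
    ultimately show ?thesis unfolding frag_module_simps by blast
  qed
  have lm: "\<zero>\<^bsub>?R\<^esub> \<odot>\<^bsub>Z\<^esub> c = 0" "(a \<ominus>\<^bsub>?R\<^esub> b) \<odot>\<^bsub>Z\<^esub> c = a \<odot>\<^bsub>Z\<^esub> c - b \<odot>\<^bsub>Z\<^esub> c"
    if "a \<in> carrier ?R" "b \<in> carrier ?R" "c \<in> carrier Z" for a b c
    using additive_minus[OF R.abelian_group_axioms frag_module_abelian, of "\<lambda>a. a \<odot>\<^bsub>Z\<^esub> c"]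
      that cl l frag_module_minus by (auto simp: frag_module_simps(2))
  have rm: "a \<odot>\<^bsub>Z\<^esub> 0 = 0" "a \<odot>\<^bsub>Z\<^esub> (c - c') = a \<odot>\<^bsub>Z\<^esub> c - a \<odot>\<^bsub>Z\<^esub> c'"
    if "a \<in> carrier ?R" "c \<in> carrier Z" "c' \<in> carrier Z" for a c c'
    using additive_minus[OF frag_module_abelian frag_module_abelian, of "\<lambda>c. a \<odot>\<^bsub>Z\<^esub> c"]
      that cl r frag_module_minus by (auto simp: frag_module_simps(2))
  have one: "\<one>\<^bsub>?R\<^esub> \<odot>\<^bsub>Z\<^esub> c = c" if "c \<in> carrier Z" for c
    using that
  proof (induction rule: frag_module_induct)
    case zero
    then show ?case using rm(1)[OF R.one_closed Z.zero_closed Z.zero_closed] by simp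
  next
    case (minus c c')
    then show ?case using rm(2)[OF R.one_closed, of c c'] by simp
  qed (simp add: monoid_ring_simps act_one)
  have assoc: "(a \<otimes>\<^bsub>?R\<^esub> b) \<odot>\<^bsub>Z\<^esub> c = a \<odot>\<^bsub>Z\<^esub> (b \<odot>\<^bsub>Z\<^esub> c)"
    if a: "a \<in> carrier ?R" and b: "b \<in> carrier ?R" and c: "c \<in> carrier Z" for a b c
    using M a
  proof (induction rule: monoid_ring_induct)
    case zero
    then show ?case using b c cl by (simp add: lm(1))
  next
    case (minus f g)
    have "(f \<ominus>\<^bsub>?R\<^esub> g) \<otimes>\<^bsub>?R\<^esub> b = f \<otimes>\<^bsub>?R\<^esub> b \<ominus>\<^bsub>?R\<^esub> g \<otimes>\<^bsub>?R\<^esub> b"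
      using minus b by (simp add: R.l_distr R.l_minus a_minus_def)
    then show ?case using minus b c cl by (simp add: lm(2))
  next
    case (delta m)
    have dm: "delta m \<in> carrier ?R" using delta by simp
    from M b show ?case
    proof (induction rule: monoid_ring_induct)
      case zero
      then show ?case using rm(1)[OF dm c c] lm(1)[OF dm dm c] dm by simp
    next
      case (minus f g)
      have "delta m \<otimes>\<^bsub>?R\<^esub> (f \<ominus>\<^bsub>?R\<^esub> g) = delta m \<otimes>\<^bsub>?R\<^esub> f \<ominus>\<^bsub>?R\<^esub> delta m \<otimes>\<^bsub>?R\<^esub> g"
        using minus dm by (simp add: R.r_distr R.r_minus a_minus_def)
      then show ?case using minus c cl dm by (simp add: lm(2) rm(2))
    next
      case (delta n)
      have dn: "delta n \<in> carrier ?R" and dmn: "delta (m \<otimes> n) \<in> carrier ?R"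
        using delta \<open>m \<in> carrier M\<close> by simp_all
      from c show ?case unfolding delta_mult[OF M \<open>m \<in> carrier M\<close> delta]
      proof (induction rule: frag_module_induct)
        case zero
        then show ?case
          using rm(1)[OF dm Z.zero_closed Z.zero_closed] rm(1)[OF dn Z.zero_closed Z.zero_closed]
            rm(1)[OF dmn Z.zero_closed Z.zero_closed] by simp
      next
        case (minus c c')
        then show ?case using cl dm dn dmn by (simp add: rm(2))
      qed (use act_mult \<open>m \<in> carrier M\<close> delta in simp)
    qed
  qed
  show ?thesis
    by (intro left_module.intro left_module_axioms.intro R.ring_axioms frag_module_abelian)
      (use l r cl one assoc in auto)
qed

lemma lmod_hom_frag_eqI:
  assumes V: "left_module (monoid_ring M) V"
    and f: "f \<in> lmod_hom (monoid_ring M) Z V" and g: "g \<in> lmod_hom (monoid_ring M) Z V"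
    and eq: "\<And>s. s \<in> S \<Longrightarrow> f (frag_of s) = g (frag_of s)" and c: "c \<in> carrier Z"
  shows "f c = g c"
  using c
proof (induction rule: frag_module_induct)
  case zero
  then show ?case 
    using lmod_hom_minus(1)[OF frag_module_left_module V f] lmod_hom_minus(1)[OF frag_module_left_module V g]
    by (simp add: frag_module_simps)
next
  case (minus c c')
  then show ?case 
    using lmod_hom_minus(2)[OF frag_module_left_module V f] lmod_hom_minus(2)[OF frag_module_left_module V g]
      frag_module_minus by metis
qed (rule eq)

text \<open>The linear map out of \<open>\<int>S\<close> that is determined by an equivariant map \<open>v\<close> on \<open>S\<close>.\<close>

definition extend :: "('a \<Rightarrow> int, 'v) module \<Rightarrow> ('s \<Rightarrow> 'v) \<Rightarrow> ('s \<Rightarrow>\<^sub>0 int) \<Rightarrow> 'v" where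
  "extend V v c = finsum V (\<lambda>s. [Poly_Mapping.lookup c s] \<cdot>\<^bsub>V\<^esub> v s) (Poly_Mapping.keys c)"

lemma extend_hom:
  assumes V: "left_module (monoid_ring M) V" and v: "\<And>s. s \<in> S \<Longrightarrow> v s \<in> carrier V"
    and eqv: "\<And>m s. \<lbrakk>m \<in> carrier M; s \<in> S\<rbrakk> \<Longrightarrow> v (act m s) = delta m \<odot>\<^bsub>V\<^esub> v s"
  shows "extend V v \<in> lmod_hom (monoid_ring M) Z V"
    and "\<And>s. s \<in> S \<Longrightarrow> extend V v (frag_of s) = v s"
proof -
  have M: "monoid M" by unfold_locales
  interpret V: abelian_group V by (rule left_module_abelian[OF V])
  let ?l = Poly_Mapping.lookup and ?t = "\<lambda>(c :: 's \<Rightarrow>\<^sub>0 int) s. [Poly_Mapping.lookup c s] \<cdot>\<^bsub>V\<^esub> v s"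
  have cl: "?t c s \<in> carrier V" if "s \<in> S" for c s
    using v[OF that] by (rule V.add.int_pow_closed)
  show of: "extend V v (frag_of s) = v s" if "s \<in> S" for s
    using v[OF that] V.add.int_pow_1[OF v[OF that]] by (simp add: extend_def V.finsum_insert V.finsum_empty Pi_def)
  have big: "extend V v c = finsum V (?t c) T" if "finite T" "Poly_Mapping.keys c \<subseteq> T" "T \<subseteq> S" for c T
    unfolding extend_def
    by (rule V.add.finprod_mono_neutral_cong_left)
      (use that cl in \<open>auto simp: in_keys_iff subset_iff add_pow_def\<close>)
  have ecl: "extend V v c \<in> carrier V" if "c \<in> carrier Z" for c
    unfolding extend_def using that cl by (intro V.finsum_closed) (auto simp: frag_module_simps)
  have add: "extend V v (c + c') = extend V v c \<oplus>\<^bsub>V\<^esub> extend V v c'" if "c \<in> carrier Z" "c' \<in> carrier Z" for c c'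
  proof -
    let ?T = "Poly_Mapping.keys c \<union> Poly_Mapping.keys c'"
    have T: "finite ?T" "?T \<subseteq> S" using that by (auto simp: frag_module_simps)
    have "extend V v (c + c') = finsum V (?t (c + c')) ?T"
      by (rule big) (use T keys_add[of c c'] in auto)
    also have "\<dots> = finsum V (\<lambda>s. ?t c s \<oplus>\<^bsub>V\<^esub> ?t c' s) ?T"
      by (rule V.finsum_cong') 
        (use T cl v in \<open>auto simp: lookup_add V.add.int_pow_mult subset_iff\<close>)
    also have "\<dots> = finsum V (?t c) ?T \<oplus>\<^bsub>V\<^esub> finsum V (?t c') ?T"
      by (rule V.finsum_addf) (use T cl in auto)
    also have "\<dots> = extend V v c \<oplus>\<^bsub>V\<^esub> extend V v c'"
      using big[of ?T c] big[of ?T c'] T by simp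
    finally show ?thesis .
  qed
  have minus: "extend V v 0 = \<zero>\<^bsub>V\<^esub>" "extend V v (c - c') = extend V v c \<ominus>\<^bsub>V\<^esub> extend V v c'"
    if "c \<in> carrier Z" "c' \<in> carrier Z" for c c'
    using additive_minus[OF frag_module_abelian left_module_abelian[OF V], of "extend V v"]
      ecl add that by (auto simp: frag_module_simps(2,3) frag_module_minus)
  interpret Z: left_module "monoid_ring M" Z by (rule frag_module_left_module)
  show "extend V v \<in> lmod_hom (monoid_ring M) Z V"
  proof (rule lmod_hom_monoid_ringI[OF M frag_module_left_module V])
    fix m c assume m: "m \<in> carrier M" and c: "c \<in> carrier Z"
    then have dm: "delta m \<in> carrier (monoid_ring M)" by simp
    from c show "extend V v (delta m \<odot>\<^bsub>Z\<^esub> c) = delta m \<odot>\<^bsub>V\<^esub> extend V v c"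
    proof (induction rule: frag_module_induct)
      case zero
      then show ?case using smult_minus(1)[OF frag_module_left_module dm] smult_minus(1)[OF V dm]
        minus(1)[OF c c] by (simp add: frag_module_simps(2))
    next
      case (one s)
      then show ?case using m act_closed eqv of by simp
    next
      case (minus c c')
      then show ?case
        using smult_minus(2)[OF frag_module_left_module dm, of c c'] smult_minus(2)[OF V dm ecl ecl, of c c']
          \<open>\<And>c c'. \<lbrakk>c \<in> carrier Z; c' \<in> carrier Z\<rbrakk> \<Longrightarrow> extend V v (c - c') = extend V v c \<ominus>\<^bsub>V\<^esub> extend V v c'\<close>
          Z.smult_closed[OF dm] by (simp add: frag_module_minus)
    qed
  qed (use ecl add in \<open>auto simp: frag_module_simps(3)\<close>)
qed

end

text \<open>An \<open>M\<close>-set that is a disjoint union of sets isomorphic to left ideals \<open>M p\<close> with \<open>p\<close> idempotent: \<open>base s\<close>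
  is the generator \<open>p\<close> of the component of \<open>s\<close>, and \<open>el s\<close> is \<open>s\<close> as an element of \<open>M\<close>. The equation
  \<open>act (el s) (base s) = s\<close> for \<open>s\<close> in a component \<open>M p\<close> says that \<open>m p = m\<close>.\<close>

locale projective_action = monoid_action M S act
  for M (structure) and S :: "'s set" and act :: "'a \<Rightarrow> 's \<Rightarrow> 's" +
  fixes el :: "'s \<Rightarrow> 'a" and base :: "'s \<Rightarrow> 's"
  assumes el_closed: "s \<in> S \<Longrightarrow> el s \<in> carrier M" and base_closed: "s \<in> S \<Longrightarrow> base s \<in> S"
    and el_act: "\<lbrakk>m \<in> carrier M; s \<in> S\<rbrakk> \<Longrightarrow> el (act m s) = m \<otimes>\<^bsub>M\<^esub> el s"
    and base_act: "\<lbrakk>m \<in> carrier M; s \<in> S\<rbrakk> \<Longrightarrow> base (act m s) = base s"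
    and act_base: "s \<in> S \<Longrightarrow> act (el s) (base s) = s"
begin

text \<open>A lift may be chosen arbitrarily at the generators and is then moved around by \<open>el\<close>. The result is
  equivariant because \<open>el\<close> is.\<close>

lemma frag_module_lift:
  fixes X :: "('a \<Rightarrow> int, 'x) module" and Y :: "('a \<Rightarrow> int, 'y) module"
  assumes X: "left_module (monoid_ring M) X" and Y: "left_module (monoid_ring M) Y"
    and g: "g \<in> lmod_hom (monoid_ring M) X Y" and f: "f \<in> lmod_hom (monoid_ring M) Z Y"
    and sub: "f ` carrier Z \<subseteq> g ` carrier X"
  shows "\<exists>h \<in> lmod_hom (monoid_ring M) Z X. \<forall>c\<in>carrier Z. g (h c) = f c"
proof -
  have M: "monoid M" by unfold_locales
  interpret X: left_module "monoid_ring M" X by (rule X)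
  have "\<exists>x\<in>carrier X. g x = f (frag_of s)" if "s \<in> S" for s
  proof -
    have "frag_of s \<in> carrier Z" using that by simp
    then have "f (frag_of s) \<in> g ` carrier X" using sub by blast
    then show ?thesis by auto
  qed
  then obtain l where l: "\<And>s. s \<in> S \<Longrightarrow> l s \<in> carrier X" "\<And>s. s \<in> S \<Longrightarrow> g (l s) = f (frag_of s)"
    by metis
  \<comment> \<open>At \<open>s = m\<close> in \<open>M p\<close> this is \<open>m \<cdot> l p = m \<cdot> (p \<cdot> l p)\<close>, so \<open>l p\<close> may be any preimage.\<close>
  define v where "v s = delta (el s) \<odot>\<^bsub>X\<^esub> l (base s)" for s
  have v: "v s \<in> carrier X" if "s \<in> S" for s
    unfolding v_def using that by (intro X.smult_closed l base_closed) (simp add: el_closed)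
  have eqv: "v (act m s) = delta m \<odot>\<^bsub>X\<^esub> v s" if "m \<in> carrier M" "s \<in> S" for m s
    using that X.smult_assoc[of "delta m" "delta (el s)" "l (base s)"]
    by (simp add: v_def el_act base_act delta_mult[OF M] el_closed l base_closed)
  have gv: "g (v s) = f (frag_of s)" if "s \<in> S" for s
    using that lmod_homD(3)[OF g, of "delta (el s)" "l (base s)"] lmod_homD(3)[OF f, of "delta (el s)" "frag_of (base s)"]
    by (simp add: v_def el_closed base_closed l act_base)
  show ?thesis
  proof (intro bexI ballI)
    show h: "extend X v \<in> lmod_hom (monoid_ring M) Z X" by (rule extend_hom(1)[OF X v eqv])
    fix c assume "c \<in> carrier Z"
    then show "g (extend X v c) = f c"
      using lmod_hom_frag_eqI[OF Y lmod_hom_comp[OF h g] f] extend_hom(2)[OF X v eqv] gv by simp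
  qed
qed

end

section \<open>Lifting along surjections between modules of any type\<close>

text \<open>Moves a module to another type along an injection. This supplies modules of prescribed element types.\<close>

definition transport :: "('v \<Rightarrow> 'w) \<Rightarrow> ('r, 'v) module \<Rightarrow> ('r, 'w) module" where
  "transport \<kappa> V = (let \<iota> = inv_into (carrier V) \<kappa> in
     \<lparr>carrier = \<kappa> ` carrier V, mult = undefined, one = undefined, zero = \<kappa> \<zero>\<^bsub>V\<^esub>,
      add = (\<lambda>x y. \<kappa> (\<iota> x \<oplus>\<^bsub>V\<^esub> \<iota> y)), smult = (\<lambda>a x. \<kappa> (a \<odot>\<^bsub>V\<^esub> \<iota> x))\<rparr>)"

lemma transport_left_module:
  assumes V: "left_module R V" and inj: "inj_on \<kappa> (carrier V)"
  shows "left_module R (transport \<kappa> V)"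
    and "\<kappa> \<in> lmod_hom R V (transport \<kappa> V)"
    and "inv_into (carrier V) \<kappa> \<in> lmod_hom R (transport \<kappa> V) V"
proof -
  interpret V: left_module R V by (rule V)
  note [simp] = inv_into_f_f[OF inj]
  let ?T = "transport \<kappa> V"
  have simps: "carrier ?T = \<kappa> ` carrier V" "\<zero>\<^bsub>?T\<^esub> = \<kappa> \<zero>\<^bsub>V\<^esub>"
    "\<And>x y. \<lbrakk>x \<in> carrier V; y \<in> carrier V\<rbrakk> \<Longrightarrow> \<kappa> x \<oplus>\<^bsub>?T\<^esub> \<kappa> y = \<kappa> (x \<oplus>\<^bsub>V\<^esub> y)"
    "\<And>a x. x \<in> carrier V \<Longrightarrow> a \<odot>\<^bsub>?T\<^esub> \<kappa> x = \<kappa> (a \<odot>\<^bsub>V\<^esub> x)"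
    by (simp_all add: transport_def Let_def)
  have "abelian_group ?T"
  proof (rule abelian_groupI)
    fix x assume "x \<in> carrier ?T"
    then obtain v where v: "x = \<kappa> v" "v \<in> carrier V" by (auto simp: simps)
    then show "\<exists>y\<in>carrier ?T. y \<oplus>\<^bsub>?T\<^esub> x = \<zero>\<^bsub>?T\<^esub>"
      by (intro bexI[of _ "\<kappa> (\<ominus>\<^bsub>V\<^esub> v)"]) (auto simp: simps V.M.l_neg)
  qed (auto simp: simps V.M.a_ac)
  then show "left_module R ?T"
    by (intro left_module.intro left_module_axioms.intro V.R.ring_axioms)
      (auto simp: simps V.smult_closed V.smult_l_distr V.smult_r_distr V.smult_assoc V.smult_one)
  show "\<kappa> \<in> lmod_hom R V ?T"
    by (rule lmod_homI) (auto simp: simps)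
  show "inv_into (carrier V) \<kappa> \<in> lmod_hom R ?T V"
    by (rule lmod_homI) (auto simp: simps V.smult_closed)
qed

text \<open>The definition of projectivity only tests surjections between modules of two fixed element types. These
  accommodate the free module on the set \<open>carrier P\<close>, once its elements are read as functions
  \<open>carrier P \<rightarrow> \<int>M\<close>. So \<open>P\<close> is a retract of this free module, which lifts against everything.\<close>

lemma projective_lift:
  fixes P :: "('m \<Rightarrow> int, 'p) module" and X :: "('m \<Rightarrow> int, 'x) module" and Y :: "('m \<Rightarrow> int, 'y) module"
  assumes M: "monoid M" and P: "projective_lmodule (monoid_ring M) P"
    and X: "left_module (monoid_ring M) X" and Y: "left_module (monoid_ring M) Y"
    and g: "g \<in> lmod_hom (monoid_ring M) X Y" and f: "f \<in> lmod_hom (monoid_ring M) P Y"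
    and sub: "f ` carrier P \<subseteq> g ` carrier X"
  shows "\<exists>h \<in> lmod_hom (monoid_ring M) P X. \<forall>x\<in>carrier P. g (h x) = f x"
proof -
  interpret M: monoid M by (rule M)
  define act where "act = (\<lambda>m (n, x :: 'p). (m \<otimes>\<^bsub>M\<^esub> n, x))"
  interpret F: projective_action M "carrier M \<times> carrier P" act fst "\<lambda>(n, x). (\<one>\<^bsub>M\<^esub>, x)"
    by unfold_locales (auto simp: act_def M.m_assoc)
  have PM: "left_module (monoid_ring M) P" using P by (simp add: projective_lmodule_def)
  interpret P: left_module "monoid_ring M" P by (rule PM)
  define \<kappa> :: "('m \<times> 'p \<Rightarrow>\<^sub>0 int) \<Rightarrow> 'p \<Rightarrow> 'm \<Rightarrow> int"
    where "\<kappa> = (\<lambda>c x m. Poly_Mapping.lookup c (m, x))"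
  have "inj \<kappa>"
    by (rule injI, rule poly_mapping_eqI) (auto simp: \<kappa>_def fun_eq_iff)
  then have inj: "inj_on \<kappa> (carrier F.Z)" by (rule inj_on_subset) simp
  note tr = transport_left_module[OF F.frag_module_left_module inj]
  let ?T = "transport \<kappa> F.Z" and ?\<iota> = "inv_into (carrier F.Z) \<kappa>"
  define v where "v = (\<lambda>(m, x). delta m \<odot>\<^bsub>P\<^esub> x)"
  have v: "v s \<in> carrier P" if "s \<in> carrier M \<times> carrier P" for s
    using that by (auto simp: v_def intro!: P.smult_closed)
  have eqv: "v (act m s) = delta m \<odot>\<^bsub>P\<^esub> v s" if "m \<in> carrier M" "s \<in> carrier M \<times> carrier P" for m s
    using that P.smult_assoc[of "delta m" "delta (fst s)" "snd s"]
    by (auto simp: v_def act_def delta_mult[OF M])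
  note ext = F.extend_hom[OF PM v eqv]
  have h0: "(\<lambda>c. F.extend P v (?\<iota> c)) \<in> lmod_hom (monoid_ring M) ?T P"
    by (rule lmod_hom_comp[OF tr(3) ext(1)])
  have surj: "(\<lambda>c. F.extend P v (?\<iota> c)) ` carrier ?T = carrier P"
  proof
    show "(\<lambda>c. F.extend P v (?\<iota> c)) ` carrier ?T \<subseteq> carrier P"
      using lmod_homD(1)[OF h0] by blast
    show "carrier P \<subseteq> (\<lambda>c. F.extend P v (?\<iota> c)) ` carrier ?T"
    proof
      fix x assume x: "x \<in> carrier P"
      let ?c = "frag_of (\<one>\<^bsub>M\<^esub>, x)"
      have c: "?c \<in> carrier F.Z" using x by simp
      have "F.extend P v (?\<iota> (\<kappa> ?c)) = x"
        using ext(2)[of "(\<one>\<^bsub>M\<^esub>, x)"] x inv_into_f_f[OF inj c] P.smult_one[OF x]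
        by (simp add: v_def monoid_ring_simps)
      moreover have "\<kappa> ?c \<in> carrier ?T" by (rule lmod_homD(1)[OF tr(2) c])
      ultimately show "x \<in> (\<lambda>c. F.extend P v (?\<iota> c)) ` carrier ?T" by (metis image_eqI)
    qed
  qed
  obtain s where s: "s \<in> lmod_hom (monoid_ring M) P ?T" "\<And>x. x \<in> carrier P \<Longrightarrow> F.extend P v (?\<iota> (s x)) = x"
    using P tr(1) PM h0 surj lmod_hom_id[of "monoid_ring M" P] unfolding projective_lmodule_def by blast
  have "(\<lambda>c. f (F.extend P v c)) ` carrier F.Z \<subseteq> g ` carrier X"
    using sub lmod_homD(1)[OF ext(1)] by blast
  then obtain h where h: "h \<in> lmod_hom (monoid_ring M) F.Z X"
      "\<And>c. c \<in> carrier F.Z \<Longrightarrow> g (h c) = f (F.extend P v c)"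
    using F.frag_module_lift[OF X Y g lmod_hom_comp[OF ext(1) f]] by blast
  show ?thesis
  proof (intro bexI ballI)
    show "(\<lambda>x. h (?\<iota> (s x))) \<in> lmod_hom (monoid_ring M) P X"
      by (rule lmod_hom_comp[OF s(1) lmod_hom_comp[OF tr(3) h(1)]])
    fix x assume x: "x \<in> carrier P"
    have "?\<iota> (s x) \<in> carrier F.Z" using lmod_homD(1)[OF tr(3)] lmod_homD(1)[OF s(1)] x by blast
    then show "g (h (?\<iota> (s x))) = f x" using h(2) s(2)[OF x] by simp
  qed
qed

section \<open>Comparison of resolutions\<close>

lemma (in abelian_group) minus_simps:
  assumes "x \<in> carrier G"
  shows "x \<ominus> \<zero> = x" "x \<ominus> x = \<zero>" "y \<in> carrier G \<Longrightarrow> x \<ominus> (x \<ominus> y) = y"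
    "y \<in> carrier G \<Longrightarrow> (x \<ominus> y) \<oplus> y = x"
proof -
  show "x \<ominus> \<zero> = x" "x \<ominus> x = \<zero>" using assms by (simp_all add: a_minus_def r_neg)
  assume y: "y \<in> carrier G"
  have "x \<ominus> (x \<ominus> y) = x \<oplus> (\<ominus> x \<oplus> y)"
    using assms y by (simp add: a_minus_def minus_add)
  then show "x \<ominus> (x \<ominus> y) = y" using assms y by (simp add: a_assoc[symmetric] r_neg)
  show "(x \<ominus> y) \<oplus> y = x" using assms y by (simp add: a_minus_def a_assoc l_neg)
qed

lemma lmod_hom_add:
  assumes Q: "left_module R Q" and f: "f \<in> lmod_hom R P Q" and g: "g \<in> lmod_hom R P Q"
  shows "(\<lambda>x. f x \<oplus>\<^bsub>Q\<^esub> g x) \<in> lmod_hom R P Q"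
proof (rule lmod_homI)
  interpret left_module R Q by (rule Q)
  fix x assume x: "x \<in> carrier P"
  show "f x \<oplus>\<^bsub>Q\<^esub> g x \<in> carrier Q" using x lmod_homD(1)[OF f] lmod_homD(1)[OF g] by simp
  show "f (a \<odot>\<^bsub>P\<^esub> x) \<oplus>\<^bsub>Q\<^esub> g (a \<odot>\<^bsub>P\<^esub> x) = a \<odot>\<^bsub>Q\<^esub> (f x \<oplus>\<^bsub>Q\<^esub> g x)" if "a \<in> carrier R" for a
    using x that smult_r_distr[OF that] by (simp add: lmod_homD[OF f] lmod_homD[OF g])
  fix y assume y: "y \<in> carrier P"
  show "f (x \<oplus>\<^bsub>P\<^esub> y) \<oplus>\<^bsub>Q\<^esub> g (x \<oplus>\<^bsub>P\<^esub> y) = f x \<oplus>\<^bsub>Q\<^esub> g x \<oplus>\<^bsub>Q\<^esub> (f y \<oplus>\<^bsub>Q\<^esub> g y)"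
    using x y by (simp add: lmod_homD[OF f] lmod_homD[OF g] M.add.m_ac)
qed

text \<open>Projectivity quantifies over modules of all types, which a predicate cannot do. Naming \<open>X\<close> and \<open>Y\<close> allows it to be
  assumed for exactly the surjections that the comparison of two resolutions meets.\<close>

definition lifts_against :: "('r, 'c) ring_scheme \<Rightarrow> ('r, 'p) module \<Rightarrow> ('r, 'x) module \<Rightarrow> ('r, 'y) module \<Rightarrow> bool" where
  "lifts_against R P X Y \<longleftrightarrow>
     (\<forall>g \<in> lmod_hom R X Y. \<forall>f \<in> lmod_hom R P Y. f ` carrier P \<subseteq> g ` carrier X \<longrightarrow>
        (\<exists>h \<in> lmod_hom R P X. \<forall>x \<in> carrier P. g (h x) = f x))"

text \<open>The form in which lifting is combined with exactness: \<open>k\<close> is the differential after \<open>g\<close>, and \<open>z\<close> its zero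
  value.\<close>

lemma lift_to_kernel:
  assumes "lifts_against R P X Y" "g \<in> lmod_hom R X Y" "f \<in> lmod_hom R P Y"
    and "\<And>x. x \<in> carrier P \<Longrightarrow> k (f x) = z"
    and "\<And>y. \<lbrakk>y \<in> carrier Y; k y = z\<rbrakk> \<Longrightarrow> y \<in> g ` carrier X"
  obtains h where "h \<in> lmod_hom R P X" "\<And>x. x \<in> carrier P \<Longrightarrow> g (h x) = f x"
proof -
  have "f ` carrier P \<subseteq> g ` carrier X"
    using assms(4,5) lmod_homD(1)[OF assms(3)] by blast
  from assms(1)[unfolded lifts_against_def, rule_format, OF assms(2,3) this]
  show thesis using that by blast
qed

text \<open>The part \<open>X2 \<rightarrow> X1 \<rightarrow> X0 \<rightarrow> N \<rightarrow> 0\<close> of a resolution, with a separate element type in each degree.\<close>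

locale resolution_start =
  fixes R :: "('r, 'c) ring_scheme" and N :: "('r, 'n) module"
    and X0 :: "('r, 'x0) module" and X1 :: "('r, 'x1) module"
    and X2 :: "('r, 'x2) module" and e :: "'x0 \<Rightarrow> 'n" and d0 :: "'x1 \<Rightarrow> 'x0" and d1 :: "'x2 \<Rightarrow> 'x1"
  assumes N: "left_module R N" and X: "left_module R X0" "left_module R X1" "left_module R X2"
    and hom: "e \<in> lmod_hom R X0 N" "d0 \<in> lmod_hom R X1 X0" "d1 \<in> lmod_hom R X2 X1"
    and exact: "e ` carrier X0 = carrier N" "{x \<in> carrier X0. e x = \<zero>\<^bsub>N\<^esub>} = d0 ` carrier X1"
      "{x \<in> carrier X1. d0 x = \<zero>\<^bsub>X0\<^esub>} = d1 ` carrier X2"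

begin

lemma closed [simp]:
  "x \<in> carrier X0 \<Longrightarrow> e x \<in> carrier N" "y \<in> carrier X1 \<Longrightarrow> d0 y \<in> carrier X0"
  "z \<in> carrier X2 \<Longrightarrow> d1 z \<in> carrier X1"
  using hom by (simp_all add: lmod_homD)

lemma complex [simp]:
  "y \<in> carrier X1 \<Longrightarrow> e (d0 y) = \<zero>\<^bsub>N\<^esub>" "z \<in> carrier X2 \<Longrightarrow> d0 (d1 z) = \<zero>\<^bsub>X0\<^esub>"
  using exact by blast+

lemma hom_minus [simp]:
  "\<lbrakk>x \<in> carrier X0; x' \<in> carrier X0\<rbrakk> \<Longrightarrow> e (x \<ominus>\<^bsub>X0\<^esub> x') = e x \<ominus>\<^bsub>N\<^esub> e x'"
  "\<lbrakk>y \<in> carrier X1; y' \<in> carrier X1\<rbrakk> \<Longrightarrow> d0 (y \<ominus>\<^bsub>X1\<^esub> y') = d0 y \<ominus>\<^bsub>X0\<^esub> d0 y'"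
  "\<lbrakk>z \<in> carrier X2; z' \<in> carrier X2\<rbrakk> \<Longrightarrow> d1 (z \<ominus>\<^bsub>X2\<^esub> z') = d1 z \<ominus>\<^bsub>X1\<^esub> d1 z'"
  using lmod_hom_minus(2)[OF X(1) N hom(1)] lmod_hom_minus(2)[OF X(2,1) hom(2)]
    lmod_hom_minus(2)[OF X(3,2) hom(3)] by auto

sublocale N: abelian_group N + X0: abelian_group X0 + X1: abelian_group X1 + X2: abelian_group X2
  using N X by (auto intro: left_module_abelian)

lemma chain_map:
  assumes Y: "resolution_start R N Y0 Y1 Y2 e' d0' d1'"
    and lifts: "lifts_against R Y0 X0 N" "lifts_against R Y1 X1 X0" "lifts_against R Y2 X2 X1"
  obtains f0 f1 f2 where "f0 \<in> lmod_hom R Y0 X0" "f1 \<in> lmod_hom R Y1 X1" "f2 \<in> lmod_hom R Y2 X2"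
    "\<And>y. y \<in> carrier Y0 \<Longrightarrow> e (f0 y) = e' y" "\<And>y. y \<in> carrier Y1 \<Longrightarrow> d0 (f1 y) = f0 (d0' y)"
    "\<And>y. y \<in> carrier Y2 \<Longrightarrow> d1 (f2 y) = f1 (d1' y)"
proof -
  interpret Y: resolution_start R N Y0 Y1 Y2 e' d0' d1' by (rule Y)
  \<comment> \<open>In degree zero every element of \<open>N\<close> is hit, so the kernel condition is made vacuous.\<close>
  obtain f0 where f0: "f0 \<in> lmod_hom R Y0 X0" "\<And>y. y \<in> carrier Y0 \<Longrightarrow> e (f0 y) = e' y"
    by (rule lift_to_kernel[OF lifts(1) hom(1) Y.hom(1), of "\<lambda>_. ()" "()"]) (use exact(1) in auto)
  have c0: "f0 (d0' y) \<in> carrier X0" if "y \<in> carrier Y1" for y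
    using that lmod_homD(1)[OF f0(1)] by simp
  obtain f1 where f1: "f1 \<in> lmod_hom R Y1 X1" "\<And>y. y \<in> carrier Y1 \<Longrightarrow> d0 (f1 y) = f0 (d0' y)"
    by (rule lift_to_kernel[OF lifts(2) hom(2) lmod_hom_comp[OF Y.hom(2) f0(1)], of e "\<zero>\<^bsub>N\<^esub>"])
      (use exact(2) c0 f0(2) in auto)
  obtain f2 where f2: "f2 \<in> lmod_hom R Y2 X2" "\<And>y. y \<in> carrier Y2 \<Longrightarrow> d1 (f2 y) = f1 (d1' y)"
    by (rule lift_to_kernel[OF lifts(3) hom(3) lmod_hom_comp[OF Y.hom(3) f1(1)], of d0 "\<zero>\<^bsub>X0\<^esub>"])
      (use exact(3) f1(2) lmod_hom_minus(1)[OF Y.X(1) X(1) f0(1)] in auto)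
  show thesis by (rule that[OF f0(1) f1(1) f2(1) f0(2) f1(2) f2(2)])
qed

text \<open>A chain endomorphism over the identity of \<open>N\<close> is homotopic to the identity. The homotopy in degree zero is
  composed with \<open>d0\<close>, so it disappears on the image of \<open>d1\<close>, which is all that is recorded here.\<close>

lemma homotopy:
  assumes lifts: "lifts_against R X0 X1 X0" "lifts_against R X1 X2 X1"
    and f: "f0 \<in> lmod_hom R X0 X0" "f1 \<in> lmod_hom R X1 X1"
      "\<And>x. x \<in> carrier X0 \<Longrightarrow> e (f0 x) = e x" "\<And>x. x \<in> carrier X1 \<Longrightarrow> d0 (f1 x) = f0 (d0 x)"
  obtains h where "h \<in> lmod_hom R X1 X2"
    "\<And>x. x \<in> carrier X2 \<Longrightarrow> d1 (h (d1 x)) = d1 x \<ominus>\<^bsub>X1\<^esub> f1 (d1 x)"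
proof -
  note [simp] = lmod_homD(1)[OF f(1)] lmod_homD(1)[OF f(2)]
  obtain h0 where h0: "h0 \<in> lmod_hom R X0 X1" "\<And>x. x \<in> carrier X0 \<Longrightarrow> d0 (h0 x) = x \<ominus>\<^bsub>X0\<^esub> f0 x"
    by (rule lift_to_kernel[OF lifts(1) hom(2) lmod_hom_diff[OF X(1) lmod_hom_id f(1)], of e "\<zero>\<^bsub>N\<^esub>"])
      (use exact(2) f(3) in \<open>auto simp: N.minus_simps\<close>)
  note [simp] = lmod_homD(1)[OF h0(1)]
  obtain h where h: "h \<in> lmod_hom R X1 X2"
      "\<And>x. x \<in> carrier X1 \<Longrightarrow> d1 (h x) = (x \<ominus>\<^bsub>X1\<^esub> f1 x) \<ominus>\<^bsub>X1\<^esub> h0 (d0 x)"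
    by (rule lift_to_kernel[OF lifts(2) hom(3)
          lmod_hom_diff[OF X(2) lmod_hom_diff[OF X(2) lmod_hom_id f(2)] lmod_hom_comp[OF hom(2) h0(1)]], of d0 "\<zero>\<^bsub>X0\<^esub>"])
      (use exact(3) f(4) h0(2) in \<open>auto simp: X0.minus_simps\<close>)
  show thesis
  proof (rule that[OF h(1)])
    fix x assume x: "x \<in> carrier X2"
    then show "d1 (h (d1 x)) = d1 x \<ominus>\<^bsub>X1\<^esub> f1 (d1 x)"
      using h(2)[of "d1 x"] lmod_hom_minus(1)[OF X(1,2) h0(1)] X1.minus_simps(1) by simp
  qed
qed

end

text \<open>A resolution \<open>P\<close> next to a resolution \<open>Q\<close> that stops in degree two.\<close>

locale resolution_comparison =
  P: resolution_start R N P0 P1 P2 e d0 d1 + Q: resolution_start R N Q0 Q1 Q2 \<epsilon> \<delta>0 \<delta>1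
  for R :: "('r, 'c) ring_scheme" and N :: "('r, 'n) module"
    and P0 P1 P2 :: "('r, 'p) module" and e :: "'p \<Rightarrow> 'n" and d0 d1 :: "'p \<Rightarrow> 'p"
    and Q0 :: "('r, 'q0) module" and Q1 :: "('r, 'q1) module" and Q2 :: "('r, 'q2) module"
    and \<epsilon> :: "'q0 \<Rightarrow> 'n" and \<delta>0 :: "'q1 \<Rightarrow> 'q0" and \<delta>1 :: "'q2 \<Rightarrow> 'q1" +
  fixes P3 :: "('r, 'p) module" and d2 :: "'p \<Rightarrow> 'p"
  assumes P3: "left_module R P3" and d2: "d2 \<in> lmod_hom R P3 P2"
    and exact2: "{x \<in> carrier P2. d1 x = \<zero>\<^bsub>P1\<^esub>} = d2 ` carrier P3"
    and inj: "inj_on \<delta>1 (carrier Q2)"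
    and lifts_PQ: "lifts_against R P0 Q0 N" "lifts_against R P1 Q1 Q0" "lifts_against R P2 Q2 Q1"
    and lifts_QP: "lifts_against R Q0 P0 N" "lifts_against R Q1 P1 P0" "lifts_against R Q2 P2 P1"
    and lifts_PP: "lifts_against R P0 P1 P0" "lifts_against R P1 P2 P1" "lifts_against R P2 P3 P2"
    and lifts_QQ: "lifts_against R Q0 Q1 Q0" "lifts_against R Q1 Q2 Q1"
begin

lemma d2_closed [simp]: "x \<in> carrier P3 \<Longrightarrow> d2 x \<in> carrier P2"
  and d1_d2 [simp]: "x \<in> carrier P3 \<Longrightarrow> d1 (d2 x) = \<zero>\<^bsub>P1\<^esub>"
  using lmod_homD(1)[OF d2] exact2 by blast+

text \<open>The maps between the two resolutions in degree two that compute cohomology there. Since \<open>Q\<close> is zero in degree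
  three, the composite of \<open>\<phi>\<close> and \<open>\<psi>2\<close> is homotopic to the identity of \<open>Q2\<close> by \<open>h\<close> alone, and the identity
  of \<open>P2\<close> differs from maps that vanish on boundaries only by \<open>d2 \<circ> \<tau>\<close>. The last equation says that \<open>P3\<close>
  splits over its image.\<close>

lemma comparison:
  obtains \<phi> \<psi>1 \<psi>2 \<tau> h where "\<phi> \<in> lmod_hom R P2 Q2" "\<psi>1 \<in> lmod_hom R Q1 P1" "\<psi>2 \<in> lmod_hom R Q2 P2"
    "\<tau> \<in> lmod_hom R P2 P3" "h \<in> lmod_hom R Q1 Q2"
    "\<And>x. x \<in> carrier P3 \<Longrightarrow> \<phi> (d2 x) = \<zero>\<^bsub>Q2\<^esub>"
    "\<And>c. c \<in> carrier Q2 \<Longrightarrow> d1 (\<psi>2 c) = \<psi>1 (\<delta>1 c)"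
    "\<And>c. c \<in> carrier Q2 \<Longrightarrow> h (\<delta>1 c) = c \<ominus>\<^bsub>Q2\<^esub> \<phi> (\<psi>2 c)"
    "\<And>x. x \<in> carrier P3 \<Longrightarrow> d2 (\<tau> (d2 x)) = d2 x"
proof -
  obtain \<phi>0 \<phi>1 \<phi>2 where \<phi>: "\<phi>0 \<in> lmod_hom R P0 Q0" "\<phi>1 \<in> lmod_hom R P1 Q1" "\<phi>2 \<in> lmod_hom R P2 Q2"
    and \<phi>e: "\<And>y. y \<in> carrier P0 \<Longrightarrow> \<epsilon> (\<phi>0 y) = e y" "\<And>y. y \<in> carrier P1 \<Longrightarrow> \<delta>0 (\<phi>1 y) = \<phi>0 (d0 y)"
      "\<And>y. y \<in> carrier P2 \<Longrightarrow> \<delta>1 (\<phi>2 y) = \<phi>1 (d1 y)"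
    by (rule Q.chain_map[OF P.resolution_start_axioms lifts_PQ]) (rule that)
  obtain \<psi>0 \<psi>1 \<psi>2 where \<psi>: "\<psi>0 \<in> lmod_hom R Q0 P0" "\<psi>1 \<in> lmod_hom R Q1 P1" "\<psi>2 \<in> lmod_hom R Q2 P2"
    and \<psi>e: "\<And>y. y \<in> carrier Q0 \<Longrightarrow> e (\<psi>0 y) = \<epsilon> y" "\<And>y. y \<in> carrier Q1 \<Longrightarrow> d0 (\<psi>1 y) = \<psi>0 (\<delta>0 y)"
      "\<And>y. y \<in> carrier Q2 \<Longrightarrow> d1 (\<psi>2 y) = \<psi>1 (\<delta>1 y)"
    by (rule P.chain_map[OF Q.resolution_start_axioms lifts_QP]) (rule that)
  note [simp] = lmod_homD(1)[OF \<phi>(1)] lmod_homD(1)[OF \<phi>(2)] lmod_homD(1)[OF \<phi>(3)]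
    lmod_homD(1)[OF \<psi>(1)] lmod_homD(1)[OF \<psi>(2)] lmod_homD(1)[OF \<psi>(3)]
  obtain h where h: "h \<in> lmod_hom R P1 P2"
      "\<And>x. x \<in> carrier P2 \<Longrightarrow> d1 (h (d1 x)) = d1 x \<ominus>\<^bsub>P1\<^esub> \<psi>1 (\<phi>1 (d1 x))"
    by (rule P.homotopy[OF lifts_PP(1,2) lmod_hom_comp[OF \<phi>(1) \<psi>(1)] lmod_hom_comp[OF \<phi>(2) \<psi>(2)]])
      (use \<phi>e \<psi>e in simp_all)
  obtain k where k: "k \<in> lmod_hom R Q1 Q2"
      "\<And>x. x \<in> carrier Q2 \<Longrightarrow> \<delta>1 (k (\<delta>1 x)) = \<delta>1 x \<ominus>\<^bsub>Q1\<^esub> \<phi>1 (\<psi>1 (\<delta>1 x))"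
    by (rule Q.homotopy[OF lifts_QQ lmod_hom_comp[OF \<psi>(1) \<phi>(1)] lmod_hom_comp[OF \<psi>(2) \<phi>(2)]])
      (use \<phi>e \<psi>e in simp_all)
  note [simp] = lmod_homD(1)[OF h(1)] lmod_homD(1)[OF k(1)]
  \<comment> \<open>Both of the next identities hold after applying the injective map \<open>\<delta>1\<close>.\<close>
  have k': "k (\<delta>1 c) = c \<ominus>\<^bsub>Q2\<^esub> \<phi>2 (\<psi>2 c)" if "c \<in> carrier Q2" for c
    by (rule inj_onD[OF inj]) (use that k(2) \<phi>e(3) \<psi>e(3) in simp_all)
  have \<phi>d: "\<phi>2 (d2 x) = \<zero>\<^bsub>Q2\<^esub>" if "x \<in> carrier P3" for x
    by (rule inj_onD[OF inj]) (use that \<phi>e(3) lmod_hom_minus(1)[OF P.X(2) Q.X(2) \<phi>(2)]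
      lmod_hom_minus(1)[OF Q.X(3,2) Q.hom(3)] in simp_all)
  \<comment> \<open>This is the next component of the homotopy between the composite of \<open>\<phi>\<close> and \<open>\<psi>\<close> and the identity of \<open>P\<close>.\<close>
  obtain \<tau> where \<tau>: "\<tau> \<in> lmod_hom R P2 P3"
      "\<And>x. x \<in> carrier P2 \<Longrightarrow> d2 (\<tau> x) = (x \<ominus>\<^bsub>P2\<^esub> \<psi>2 (\<phi>2 x)) \<ominus>\<^bsub>P2\<^esub> h (d1 x)"
    by (rule lift_to_kernel[OF lifts_PP(3) d2
          lmod_hom_diff[OF P.X(3) lmod_hom_diff[OF P.X(3) lmod_hom_id lmod_hom_comp[OF \<phi>(3) \<psi>(3)]]
            lmod_hom_comp[OF P.hom(3) h(1)]], of d1 "\<zero>\<^bsub>P1\<^esub>"])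
      (use exact2 h(2) \<phi>e(3) \<psi>e(3) in \<open>auto simp: P.X1.minus_simps\<close>)
  have "d2 (\<tau> (d2 x)) = d2 x" if "x \<in> carrier P3" for x
    using that \<tau>(2)[of "d2 x"] \<phi>d[OF that] lmod_hom_minus(1)[OF P.X(2,3) h(1)]
      lmod_hom_minus(1)[OF Q.X(3) P.X(3) \<psi>(3)] by (simp add: P.X2.minus_simps)
  then show thesis using that[OF \<phi>(3) \<psi>(2,3) \<tau>(1) k(1) \<phi>d \<psi>e(3) k'] by blast
qed

text \<open>The cocycle is \<open>g \<circ> \<phi>\<close>. If it were the coboundary of \<open>k\<close>, then pulling back along \<open>\<psi>2\<close> and correcting by the
  homotopy \<open>h\<close> would make \<open>g\<close> the coboundary of \<open>g \<circ> h + k \<circ> \<psi>1\<close>.\<close>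

lemma nontrivial_cocycle:
  assumes B: "left_module R B" and g: "g \<in> lmod_hom R Q2 B"
    and ncob: "\<And>k. k \<in> lmod_hom R Q1 B \<Longrightarrow> \<exists>c\<in>carrier Q2. g c \<noteq> k (\<delta>1 c)"
  obtains f where "f \<in> lmod_hom R P2 B" "\<And>x. x \<in> carrier P3 \<Longrightarrow> f (d2 x) = \<zero>\<^bsub>B\<^esub>"
    "\<And>k. k \<in> lmod_hom R P1 B \<Longrightarrow> \<exists>x\<in>carrier P2. f x \<noteq> k (d1 x)"
proof -
  interpret B: abelian_group B by (rule left_module_abelian[OF B])
  obtain \<phi> \<psi>1 \<psi>2 \<tau> h where \<phi>: "\<phi> \<in> lmod_hom R P2 Q2" and \<psi>: "\<psi>1 \<in> lmod_hom R Q1 P1" "\<psi>2 \<in> lmod_hom R Q2 P2"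
    and "\<tau> \<in> lmod_hom R P2 P3" and h: "h \<in> lmod_hom R Q1 Q2"
    and \<phi>d: "\<And>x. x \<in> carrier P3 \<Longrightarrow> \<phi> (d2 x) = \<zero>\<^bsub>Q2\<^esub>"
    and \<psi>d: "\<And>c. c \<in> carrier Q2 \<Longrightarrow> d1 (\<psi>2 c) = \<psi>1 (\<delta>1 c)"
    and hd: "\<And>c. c \<in> carrier Q2 \<Longrightarrow> h (\<delta>1 c) = c \<ominus>\<^bsub>Q2\<^esub> \<phi> (\<psi>2 c)"
    and "\<And>x. x \<in> carrier P3 \<Longrightarrow> d2 (\<tau> (d2 x)) = d2 x"
    by (rule comparison) (rule that)
  note [simp] = lmod_homD(1)[OF \<phi>] lmod_homD(1)[OF \<psi>(1)] lmod_homD(1)[OF \<psi>(2)] lmod_homD(1)[OF g] lmod_homD(1)[OF h]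
  show thesis
  proof (rule that)
    show "(\<lambda>x. g (\<phi> x)) \<in> lmod_hom R P2 B" by (rule lmod_hom_comp[OF \<phi> g])
    show "g (\<phi> (d2 x)) = \<zero>\<^bsub>B\<^esub>" if "x \<in> carrier P3" for x
      using \<phi>d[OF that] lmod_hom_minus(1)[OF Q.X(3) B g] by simp
    fix k assume k: "k \<in> lmod_hom R P1 B"
    show "\<exists>x\<in>carrier P2. g (\<phi> x) \<noteq> k (d1 x)"
    proof (rule ccontr)
      assume "\<not> ?thesis"
      then have eq: "g (\<phi> x) = k (d1 x)" if "x \<in> carrier P2" for x using that by blast
      let ?k = "\<lambda>c. g (h c) \<oplus>\<^bsub>B\<^esub> k (\<psi>1 c)"
      have "?k \<in> lmod_hom R Q1 B"
        by (rule lmod_hom_add[OF B lmod_hom_comp[OF h g] lmod_hom_comp[OF \<psi>(1) k]])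
      then obtain c where c: "c \<in> carrier Q2" "g c \<noteq> ?k (\<delta>1 c)" using ncob by blast
      have "?k (\<delta>1 c) = (g c \<ominus>\<^bsub>B\<^esub> g (\<phi> (\<psi>2 c))) \<oplus>\<^bsub>B\<^esub> g (\<phi> (\<psi>2 c))"
        using c(1) eq[of "\<psi>2 c"] \<psi>d hd lmod_hom_minus(2)[OF Q.X(3) B g] by simp
      also have "\<dots> = g c" using c(1) by (simp add: B.minus_simps)
      finally show False using c(2) by simp
    qed
  qed
qed

end

section \<open>Ext groups\<close>

lemma projective_resolutionD:
  assumes "projective_resolution R N P d e"
  shows "left_module R N" "projective_lmodule R (P n)" "left_module R (P n)" "d n \<in> lmod_hom R (P (Suc n)) (P n)"
    "e \<in> lmod_hom R (P 0) N" "e ` carrier (P 0) = carrier N"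
    "{x \<in> carrier (P 0). e x = \<zero>\<^bsub>N\<^esub>} = d 0 ` carrier (P (Suc 0))"
    "{x \<in> carrier (P (Suc n)). d n x = \<zero>\<^bsub>P n\<^esub>} = d (Suc n) ` carrier (P (Suc (Suc n)))"
proof -
  note res = assms[unfolded projective_resolution_def a_kernel_def']
  show P: "projective_lmodule R (P n)" using res by simp
  then show "left_module R (P n)" by (simp add: projective_lmodule_def)
qed (use assms[unfolded projective_resolution_def a_kernel_def'] in simp_all)

lemma Hom_group_comm_group:
  assumes P: "left_module R P" and B: "left_module R B"
  shows "comm_group (Hom_group R P B)"
proof -
  interpret B: left_module R B by (rule B)
  interpret P: left_module R P by (rule P)
  have c: "f x \<in> carrier B" if "f \<in> carrier (Hom_group R P B)" "x \<in> carrier P" for f x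
    using that lmod_homD(1)[of f R P B x] by (simp add: Hom_group_def)
  have ext: "(\<lambda>x\<in>carrier P. f x) \<in> lmod_hom R P B" if "f \<in> lmod_hom R P B" for f
    by (rule lmod_homI) (use lmod_homD[OF that] P.smult_closed in auto)
  have zero: "(\<lambda>x. \<zero>\<^bsub>B\<^esub>) \<in> lmod_hom R P B"
    by (rule lmod_homI) (use smult_minus(1)[OF B] in auto)
  show ?thesis
  proof (rule comm_groupI)
    fix f g assume f: "f \<in> carrier (Hom_group R P B)" and g: "g \<in> carrier (Hom_group R P B)"
    show "f \<otimes>\<^bsub>Hom_group R P B\<^esub> g \<in> carrier (Hom_group R P B)"
      using f g ext[OF lmod_hom_add[OF B]] by (auto simp: Hom_group_def)
    show "f \<otimes>\<^bsub>Hom_group R P B\<^esub> g = g \<otimes>\<^bsub>Hom_group R P B\<^esub> f"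
      using c[OF f] c[OF g] by (auto simp: Hom_group_def B.M.a_comm intro!: restrict_ext)
    fix h assume h: "h \<in> carrier (Hom_group R P B)"
    show "f \<otimes>\<^bsub>Hom_group R P B\<^esub> g \<otimes>\<^bsub>Hom_group R P B\<^esub> h = f \<otimes>\<^bsub>Hom_group R P B\<^esub> (g \<otimes>\<^bsub>Hom_group R P B\<^esub> h)"
      using c[OF f] c[OF g] c[OF h] by (auto simp: Hom_group_def B.M.a_assoc intro!: restrict_ext)
  next
    show "\<one>\<^bsub>Hom_group R P B\<^esub> \<in> carrier (Hom_group R P B)"
      using ext[OF zero] by (auto simp: Hom_group_def)
  next
    fix f assume f: "f \<in> carrier (Hom_group R P B)"
    show "\<one>\<^bsub>Hom_group R P B\<^esub> \<otimes>\<^bsub>Hom_group R P B\<^esub> f = f"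
      using f c[OF f] by (auto simp: Hom_group_def extensional_def restrict_def)
    have "(\<lambda>x\<in>carrier P. \<zero>\<^bsub>B\<^esub> \<ominus>\<^bsub>B\<^esub> f x) \<in> carrier (Hom_group R P B)"
      using f ext[OF lmod_hom_diff[OF B zero]] by (auto simp: Hom_group_def)
    moreover have "(\<lambda>x\<in>carrier P. \<zero>\<^bsub>B\<^esub> \<ominus>\<^bsub>B\<^esub> f x) \<otimes>\<^bsub>Hom_group R P B\<^esub> f = \<one>\<^bsub>Hom_group R P B\<^esub>"
      using c[OF f] by (auto simp: Hom_group_def B.M.minus_simps intro!: restrict_ext)
    ultimately show "\<exists>g\<in>carrier (Hom_group R P B). g \<otimes>\<^bsub>Hom_group R P B\<^esub> f = \<one>\<^bsub>Hom_group R P B\<^esub>" by blast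
  qed
qed

lemma cocycles_iff:
  "f \<in> cocycles R P d B q \<longleftrightarrow> f \<in> lmod_hom R (P q) B \<and> f \<in> extensional (carrier (P q)) \<and>
     (\<forall>x \<in> carrier (P (Suc q)). f (d q x) = \<zero>\<^bsub>B\<^esub>)"
  unfolding cocycles_def kernel_def Hom_group_def coboundary_map_def
  by (auto simp: fun_eq_iff restrict_def)

text \<open>Members of the Hom group are restricted to the carrier; this introduction rule takes any linear map \<open>k\<close>.\<close>

lemma coboundariesI:
  assumes "k \<in> lmod_hom R (P q) B" "f \<in> extensional (carrier (P (Suc q)))"
    and P: "left_module R (P q)" and dq: "d q \<in> lmod_hom R (P (Suc q)) (P q)"
    and "\<And>x. x \<in> carrier (P (Suc q)) \<Longrightarrow> f x = k (d q x)"
  shows "f \<in> coboundaries R P d B (Suc q)"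
proof -
  interpret P: left_module R "P q" by (rule P)
  have "restrict k (carrier (P q)) \<in> lmod_hom R (P q) B"
    by (rule lmod_homI) (use lmod_homD[OF assms(1)] P.smult_closed in auto)
  moreover have "f = coboundary_map P d q (restrict k (carrier (P q)))"
    using assms(2,5) lmod_homD(1)[OF dq] by (auto simp: coboundary_map_def extensional_def restrict_def)
  ultimately show ?thesis by (auto simp: Hom_group_def)
qed

lemma cocycles_subgroup:
  assumes res: "projective_resolution R N P d e" and B: "left_module R B"
  shows "subgroup (cocycles R P d B q) (Hom_group R (P q) B)"
proof -
  note res = projective_resolutionD[OF res]
  interpret G: comm_group "Hom_group R (P q) B" by (rule Hom_group_comm_group[OF res(3) B])
  interpret H: comm_group "Hom_group R (P (Suc q)) B" by (rule Hom_group_comm_group[OF res(3) B])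
  interpret PS: left_module R "P (Suc q)" by (rule res(3))
  have "coboundary_map P d q \<in> hom (Hom_group R (P q) B) (Hom_group R (P (Suc q)) B)"
  proof (rule homI)
    fix f assume "f \<in> carrier (Hom_group R (P q) B)"
    then have f: "(\<lambda>x. f (d q x)) \<in> lmod_hom R (P (Suc q)) B"
      by (auto simp: Hom_group_def intro: lmod_hom_comp[OF res(4)])
    have "coboundary_map P d q f \<in> lmod_hom R (P (Suc q)) B" unfolding coboundary_map_def
      by (rule lmod_homI) (use lmod_homD[OF f] PS.smult_closed in auto)
    then show "coboundary_map P d q f \<in> carrier (Hom_group R (P (Suc q)) B)"
      by (simp add: Hom_group_def coboundary_map_def)
  qed (use lmod_homD(1)[OF res(4)] in \<open>auto simp: Hom_group_def coboundary_map_def restrict_def\<close>)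
  then interpret group_hom "Hom_group R (P q) B" "Hom_group R (P (Suc q)) B" "coboundary_map P d q"
    by unfold_locales
  show ?thesis unfolding cocycles_def by (rule subgroup_kernel)
qed

lemma Ext_group_trivialI:
  assumes res: "projective_resolution R N P d e" and B: "left_module R B"
    and eq: "coboundaries R P d B q = cocycles R P d B q"
  shows "trivial_group (Ext_group R P d B q)"
proof -
  interpret G: comm_group "Hom_group R (P q) B"
    by (rule Hom_group_comm_group[OF projective_resolutionD(3)[OF res] B])
  let ?K = "(Hom_group R (P q) B)\<lparr>carrier := cocycles R P d B q\<rparr>"
  interpret K: group ?K
    by (rule G.subgroup_imp_group[OF cocycles_subgroup[OF res B]])
  have n: "normal (carrier ?K) ?K" by (rule K.normal_self)
  then interpret normal "carrier ?K" ?K .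
  have "carrier (?K Mod carrier ?K) \<subseteq> {carrier ?K}"
    unfolding carrier_FactGroup using K.coset_join2[OF _ K.subgroup_self] by auto
  then have "trivial_group (?K Mod carrier ?K)"
    using group.trivial_group_subset[OF factorgroup_is_group] by simp
  then show ?thesis unfolding Ext_group_def eq by simp
qed

text \<open>In the quotient, \<open>f\<close> lies in its own coset since the zero map is a coboundary. If the quotient were trivial, then \<open>f\<close>
  would be a coboundary.\<close>

lemma Ext_group_nontrivial:
  assumes res: "projective_resolution R N P d e" and B: "left_module R B"
    and f: "f \<in> lmod_hom R (P (Suc q)) B" "\<And>x. x \<in> carrier (P (Suc (Suc q))) \<Longrightarrow> f (d (Suc q) x) = \<zero>\<^bsub>B\<^esub>"
    and ncob: "\<And>k. k \<in> lmod_hom R (P q) B \<Longrightarrow> \<exists>x\<in>carrier (P (Suc q)). f x \<noteq> k (d q x)"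
  shows "\<not> trivial_group (Ext_group R P d B (Suc q))"
proof
  assume tr: "trivial_group (Ext_group R P d B (Suc q))"
  note res' = projective_resolutionD[OF res]
  interpret G: comm_group "Hom_group R (P (Suc q)) B" by (rule Hom_group_comm_group[OF res'(3) B])
  interpret G0: comm_group "Hom_group R (P q) B" by (rule Hom_group_comm_group[OF res'(3) B])
  interpret PS: left_module R "P (Suc q)" by (rule res'(3))
  let ?f = "restrict f (carrier (P (Suc q)))" and ?H = "coboundaries R P d B (Suc q)"
  let ?K = "(Hom_group R (P (Suc q)) B)\<lparr>carrier := cocycles R P d B (Suc q)\<rparr>"
  have fh: "?f \<in> lmod_hom R (P (Suc q)) B"
    by (rule lmod_homI) (use lmod_homD[OF f(1)] PS.smult_closed in auto)
  then have fc: "?f \<in> cocycles R P d B (Suc q)"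
    using f(2) lmod_homD(1)[OF res'(4)] by (auto simp: cocycles_iff)
  have "\<one>\<^bsub>Hom_group R (P (Suc q)) B\<^esub> = coboundary_map P d q \<one>\<^bsub>Hom_group R (P q) B\<^esub>"
    using lmod_homD(1)[OF res'(4)] by (auto simp: Hom_group_def coboundary_map_def restrict_def)
  then have one: "\<one>\<^bsub>Hom_group R (P (Suc q)) B\<^esub> \<in> ?H" using G0.one_closed by simp
  have fG: "?f \<in> carrier (Hom_group R (P (Suc q)) B)" using fh by (simp add: Hom_group_def)
  have "?f = \<one>\<^bsub>?K\<^esub> \<otimes>\<^bsub>?K\<^esub> ?f" using G.l_one[OF fG] by simp
  then have "?f \<in> ?H #>\<^bsub>?K\<^esub> ?f" using one unfolding r_coset_def by (auto simp del: coboundaries.simps)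
  moreover have "?H #>\<^bsub>?K\<^esub> ?f = ?H"
    using tr fc unfolding trivial_group_def Ext_group_def carrier_FactGroup by (auto simp del: coboundaries.simps)
  ultimately have "?f \<in> ?H" by simp
  then obtain k where "k \<in> lmod_hom R (P q) B" "?f = coboundary_map P d q k"
    by (auto simp: Hom_group_def)
  then show False using ncob[of k] by (auto simp: coboundary_map_def restrict_def fun_eq_iff) metis
qed

text \<open>A splitting of \<open>P\<close> in one degree propagates upwards: if \<open>d \<circ> \<tau> \<circ> d = d\<close>, then \<open>1 - \<tau> \<circ> d\<close> maps into cycles, and a
  lift \<open>\<sigma>\<close> of it along the next differential again satisfies \<open>d \<circ> \<sigma> \<circ> d = d\<close>. The equation
  \<open>1 = d \<circ> \<sigma> + \<tau> \<circ> d\<close> turns every cocycle \<open>f\<close> into the coboundary of \<open>f \<circ> \<tau>\<close>.\<close>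

lemma Ext_group_vanishes_above:
  assumes M: "monoid M" and res: "projective_resolution (monoid_ring M) N P d e" 
    and \<tau>0: "\<tau>0 \<in> lmod_hom (monoid_ring M) (P (Suc n)) (P (Suc (Suc n)))"
      "\<And>x. x \<in> carrier (P (Suc (Suc n))) \<Longrightarrow> d (Suc n) (\<tau>0 (d (Suc n) x)) = d (Suc n) x"
    and B: "left_module (monoid_ring M) B" and q: "q > Suc n"
  shows "trivial_group (Ext_group (monoid_ring M) P d B q)"
proof -
  let ?R = "monoid_ring M"
  note res' = projective_resolutionD[OF res]
  interpret B: abelian_group B by (rule left_module_abelian[OF B])
  have splitting_step: "\<exists>\<sigma> \<in> lmod_hom ?R (P (Suc (Suc m))) (P (Suc (Suc (Suc m)))). \<forall>x\<in>carrier (P (Suc (Suc m))).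
      d (Suc (Suc m)) (\<sigma> x) = x \<ominus>\<^bsub>P (Suc (Suc m))\<^esub> \<tau> (d (Suc m) x)"
    if \<tau>: "\<tau> \<in> lmod_hom ?R (P (Suc m)) (P (Suc (Suc m)))"
      "\<And>x. x \<in> carrier (P (Suc (Suc m))) \<Longrightarrow> d (Suc m) (\<tau> (d (Suc m) x)) = d (Suc m) x" for m \<tau>
  proof (rule projective_lift[OF M res'(2) res'(3) res'(3) res'(4)])
    interpret PS: abelian_group "P (Suc m)" by (rule left_module_abelian[OF res'(3)])
    interpret PSS: abelian_group "P (Suc (Suc m))" by (rule left_module_abelian[OF res'(3)])
    show f: "(\<lambda>x. x \<ominus>\<^bsub>P (Suc (Suc m))\<^esub> \<tau> (d (Suc m) x)) \<in> lmod_hom ?R (P (Suc (Suc m))) (P (Suc (Suc m)))"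
      by (rule lmod_hom_diff[OF res'(3) lmod_hom_id lmod_hom_comp[OF res'(4) \<tau>(1)]])
    have "d (Suc m) (x \<ominus>\<^bsub>P (Suc (Suc m))\<^esub> \<tau> (d (Suc m) x)) = \<zero>\<^bsub>P (Suc m)\<^esub>" if "x \<in> carrier (P (Suc (Suc m)))" for x
      using that lmod_hom_minus(2)[OF res'(3) res'(3) res'(4)] lmod_homD(1)[OF res'(4)] lmod_homD(1)[OF \<tau>(1)] \<tau>(2)
      by (simp add: PS.minus_simps)
    then show "(\<lambda>x. x \<ominus>\<^bsub>P (Suc (Suc m))\<^esub> \<tau> (d (Suc m) x)) ` carrier (P (Suc (Suc m)))
        \<subseteq> d (Suc (Suc m)) ` carrier (P (Suc (Suc (Suc m))))"
      unfolding res'(8)[symmetric] using lmod_homD(1)[OF f] by blast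
  qed
  have ex: "\<exists>\<tau> \<in> lmod_hom ?R (P (Suc m)) (P (Suc (Suc m))). \<forall>x\<in>carrier (P (Suc (Suc m))).
      d (Suc m) (\<tau> (d (Suc m) x)) = d (Suc m) x" if "m \<ge> n" for m
    using that
  proof (induction m rule: dec_induct)
    case base
    show ?case by (intro bexI[OF _ \<tau>0(1)] ballI \<tau>0(2))
  next
    case (step m)
    then obtain \<tau> where \<tau>: "\<tau> \<in> lmod_hom ?R (P (Suc m)) (P (Suc (Suc m)))"
      "\<And>x. x \<in> carrier (P (Suc (Suc m))) \<Longrightarrow> d (Suc m) (\<tau> (d (Suc m) x)) = d (Suc m) x" by blast
    then obtain \<sigma> where \<sigma>: "\<sigma> \<in> lmod_hom ?R (P (Suc (Suc m))) (P (Suc (Suc (Suc m))))"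
      "\<And>x. x\<in>carrier (P (Suc (Suc m))) \<Longrightarrow> d (Suc (Suc m)) (\<sigma> x) = x \<ominus>\<^bsub>P (Suc (Suc m))\<^esub> \<tau> (d (Suc m) x)"
      using splitting_step[OF \<tau>] by blast
    interpret PSS: abelian_group "P (Suc (Suc m))" by (rule left_module_abelian[OF res'(3)])
    have "d (Suc (Suc m)) (\<sigma> (d (Suc (Suc m)) x)) = d (Suc (Suc m)) x" if "x \<in> carrier (P (Suc (Suc (Suc m))))" for x
    proof -
      have c: "d (Suc (Suc m)) x \<in> carrier (P (Suc (Suc m)))" using lmod_homD(1)[OF res'(4)] that by blast
      have "d (Suc m) (d (Suc (Suc m)) x) = \<zero>\<^bsub>P (Suc m)\<^esub>" using res'(8)[of "Suc m"] that by blast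
      then show ?thesis using \<sigma>(2)[OF c] c lmod_hom_minus(1)[OF res'(3) res'(3) \<tau>(1)]
        by (simp add: PSS.minus_simps)
    qed
    then show ?case by (intro bexI[OF _ \<sigma>(1)] ballI)
  qed
  define m where "m = q - 2"
  have m: "q = Suc (Suc m)" "m \<ge> n" using q by (simp_all add: m_def)
  obtain \<tau> where \<tau>: "\<tau> \<in> lmod_hom ?R (P (Suc m)) (P (Suc (Suc m)))"
      "\<And>x. x \<in> carrier (P (Suc (Suc m))) \<Longrightarrow> d (Suc m) (\<tau> (d (Suc m) x)) = d (Suc m) x" using ex[OF m(2)] by blast
  then obtain \<sigma> where \<sigma>: "\<sigma> \<in> lmod_hom ?R (P (Suc (Suc m))) (P (Suc (Suc (Suc m))))"
    "\<And>x. x\<in>carrier (P (Suc (Suc m))) \<Longrightarrow> d (Suc (Suc m)) (\<sigma> x) = x \<ominus>\<^bsub>P (Suc (Suc m))\<^esub> \<tau> (d (Suc m) x)"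
    using splitting_step[OF \<tau>] by blast
  show ?thesis
  proof (rule Ext_group_trivialI[OF res B], intro equalityI subsetI)
    fix f assume "f \<in> coboundaries ?R P d B q"
    then obtain k where k: "k \<in> lmod_hom ?R (P (Suc m)) B" "f = coboundary_map P d (Suc m) k"
      by (auto simp: m Hom_group_def)
    interpret PSS: left_module ?R "P (Suc (Suc m))" by (rule res'(3))
    have "f \<in> lmod_hom ?R (P (Suc (Suc m))) B" unfolding k(2) coboundary_map_def
      by (rule lmod_homI) (use lmod_homD[OF lmod_hom_comp[OF res'(4) k(1)]] PSS.smult_closed in auto)
    moreover have "f (d (Suc (Suc m)) x) = \<zero>\<^bsub>B\<^esub>" if "x \<in> carrier (P (Suc (Suc (Suc m))))" for x
    proof -
      have "d (Suc m) (d (Suc (Suc m)) x) = \<zero>\<^bsub>P (Suc m)\<^esub>" using res'(8)[of "Suc m"] that by blast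
      then show ?thesis using that lmod_homD(1)[OF res'(4)] lmod_hom_minus(1)[OF res'(3) B k(1)]
        by (simp add: k(2) coboundary_map_def)
    qed
    ultimately show "f \<in> cocycles ?R P d B q" unfolding cocycles_iff m(1) by (simp add: k(2) coboundary_map_def)
  next
    fix f assume "f \<in> cocycles ?R P d B q"
    then have f: "f \<in> lmod_hom ?R (P (Suc (Suc m))) B" "f \<in> extensional (carrier (P (Suc (Suc m))))"
      "\<And>x. x \<in> carrier (P (Suc (Suc (Suc m)))) \<Longrightarrow> f (d (Suc (Suc m)) x) = \<zero>\<^bsub>B\<^esub>"
      by (auto simp: cocycles_iff m)
    interpret PSS: abelian_group "P (Suc (Suc m))" by (rule left_module_abelian[OF res'(3)])
    show "f \<in> coboundaries ?R P d B q" unfolding m(1)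
    proof (rule coboundariesI[where k = "\<lambda>x. f (\<tau> x)"])
      show "(\<lambda>x. f (\<tau> x)) \<in> lmod_hom ?R (P (Suc m)) B" by (rule lmod_hom_comp[OF \<tau>(1) f(1)])
      show "d (Suc m) \<in> lmod_hom ?R (P (Suc (Suc m))) (P (Suc m))" by (rule res'(4))
      show "left_module ?R (P (Suc m))" by (rule res'(3))
      fix x assume x: "x \<in> carrier (P (Suc (Suc m)))"
      let ?t = "\<tau> (d (Suc m) x)"
      have t: "?t \<in> carrier (P (Suc (Suc m)))" using x lmod_homD(1)[OF \<tau>(1)] lmod_homD(1)[OF res'(4)] by blast
      have "f (x \<ominus>\<^bsub>P (Suc (Suc m))\<^esub> ?t) = \<zero>\<^bsub>B\<^esub>"
        using f(3)[OF lmod_homD(1)[OF \<sigma>(1) x]] \<sigma>(2)[OF x] by simp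
      then have "f x = f (x \<ominus>\<^bsub>P (Suc (Suc m))\<^esub> ?t) \<oplus>\<^bsub>B\<^esub> f ?t"
        using lmod_homD(2)[OF f(1), of "x \<ominus>\<^bsub>P (Suc (Suc m))\<^esub> ?t" ?t] x t by (simp add: PSS.minus_simps)
      then show "f x = f ?t" using \<open>f (x \<ominus>\<^bsub>P (Suc (Suc m))\<^esub> ?t) = \<zero>\<^bsub>B\<^esub>\<close> lmod_homD(1)[OF f(1) t] by simp
    qed (rule f(2))
  qed
qed

section \<open>The free regular \<open>\<star>\<close>-monoid as a set of normal forms\<close>

text \<open>The product of irreducible words is defined by the right action; that it commutes with the right action is the
  associativity of this product.\<close>

lemma run_step:
  assumes s: "\<not> reducible s" and t: "\<not> reducible t"
  shows "run s (step t x) = step (run s t) x"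
proof (cases "reducible (t @ [x])")
  case True
  then obtain y z where z: "z \<noteq> []" "t @ [x] = y @ z @ z\<^sup>\<star> @ z" using reduction_exists[OF t] by blast
  have "step (run s t) x = run s (t @ [x])" by simp
  also have "\<dots> = run (run s y) (z @ z\<^sup>\<star> @ z)" unfolding z(2) by simp
  also have "\<dots> = run (run s y) z" by (rule run_rule[OF irreducible_run[OF s]])
  finally show ?thesis using step_reduce[OF t z(2,1)] by simp
qed (simp add: step_append)

lemma run_run:
  assumes s: "\<not> reducible s" and t: "\<not> reducible t"
  shows "run s (run t u) = run (run s t) u"
  using t by (induction u arbitrary: t) (simp_all add: run_step[OF s] irreducible_step)

lemma run_Nil: "\<not> reducible u \<Longrightarrow> run [] u = u"
  using run_irreducible[of "[]" u] by simp

abbreviation star_rules :: "'a set \<Rightarrow> (('a + 'a) list \<times> ('a + 'a) list) set" where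
  "star_rules A \<equiv> {(w @ w\<^sup>\<star> @ w, w) | w. w \<in> lists (star_alphabet A)}"

lemma letter_star_alphabet [simp]: "letter_star x \<in> star_alphabet A \<longleftrightarrow> x \<in> star_alphabet A"
  by (cases x) (auto simp: star_alphabet_def)

lemma set_word_star [simp]: "set (w\<^sup>\<star>) = letter_star ` set w"
  by (simp add: word_star_def)

lemma word_star_lists [simp]: "w\<^sup>\<star> \<in> lists (star_alphabet A) \<longleftrightarrow> w \<in> lists (star_alphabet A)"
  by (auto simp: word_star_def)

lemma run_cong:
  assumes "pres_cong X (star_rules A) v v'" "\<not> reducible u"
  shows "run u v = run u v'"
  using assms
proof (induction arbitrary: u rule: pres_cong.induct)
  case (pc_rel v v')
  then show ?case using run_rule by blast
next
  case (pc_append u1 u1' v1 v1')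
  then show ?case using pc_append.IH(1)[OF pc_append.prems]
      pc_append.IH(2)[OF irreducible_run[OF pc_append.prems]] by simp
qed simp_all

lemma step_cong:
  assumes u: "u \<in> lists (star_alphabet A)" "x \<in> star_alphabet A" "\<not> reducible u"
  shows "pres_cong (star_alphabet A) (star_rules A) (u @ [x]) (step u x)"
proof (cases "reducible (u @ [x])")
  case True
  then obtain y z where z: "z \<noteq> []" "u @ [x] = y @ z @ z\<^sup>\<star> @ z" using reduction_exists[OF u(3)] by blast
  have "u @ [x] \<in> lists (star_alphabet A)" using u by simp
  then have l: "y \<in> lists (star_alphabet A)" "z \<in> lists (star_alphabet A)" unfolding z(2) by simp_all
  have "pres_cong (star_alphabet A) (star_rules A) (z @ z\<^sup>\<star> @ z) z"
    by (rule pres_cong.pc_rel) (use l in auto)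
  then have "pres_cong (star_alphabet A) (star_rules A) (y @ z @ z\<^sup>\<star> @ z) (y @ z)"
    by (rule pres_cong.pc_append[OF pres_cong.pc_refl[OF l(1)]])
  then show ?thesis using step_reduce[OF u(3) z(2,1)] z(2) by simp
next
  case False
  then show ?thesis using u by (simp add: step_append pres_cong.pc_refl)
qed

lemma run_congruent:
  assumes "u \<in> lists (star_alphabet A)" "v \<in> lists (star_alphabet A)" "\<not> reducible u"
  shows "pres_cong (star_alphabet A) (star_rules A) (u @ v) (run u v)"
  using assms
proof (induction v arbitrary: u)
  case Nil
  then show ?case by (simp add: pres_cong.pc_refl)
next
  case (Cons x v)
  have s: "pres_cong (star_alphabet A) (star_rules A) (u @ [x]) (step u x)"
    using Cons by (intro step_cong) auto
  have v: "v \<in> lists (star_alphabet A)" using Cons by simp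
  have "pres_cong (star_alphabet A) (star_rules A) ((u @ [x]) @ v) (step u x @ v)"
    by (rule pres_cong.pc_append[OF s pres_cong.pc_refl[OF v]])
  moreover have "pres_cong (star_alphabet A) (star_rules A) (step u x @ v) (run (step u x) v)"
    by (rule Cons.IH) (use pres_cong_lists[OF s] v irreducible_step Cons in auto)
  ultimately show ?case using pres_cong.pc_trans by fastforce
qed

lemmas run_lists = run_congruent[THEN pres_cong_lists, THEN conjunct2]

locale free_star =
  fixes A :: "'a set"
begin

abbreviation "X \<equiv> star_alphabet A"
abbreviation "M \<equiv> free_regular_star_monoid A"
abbreviation "cl \<equiv> pres_class X (star_rules A)"

definition NF :: "('a + 'a) list set" where "NF = {u \<in> lists X. \<not> reducible u}"

text \<open>Left multiplication of \<open>F\<close>, read on normal forms. A class is represented by any of its words, whose normal form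
  \<open>run []\<close> is independent of the choice.\<close>

definition act :: "('a + 'a) list set \<Rightarrow> ('a + 'a) list \<Rightarrow> ('a + 'a) list" where
  "act m u = run (run [] (SOME w. w \<in> m)) u"

lemma monoid_M: "monoid M" by (rule free_regular_star_monoid_is_monoid)

lemma M_simps: "carrier M = cl ` lists X" "\<one>\<^bsub>M\<^esub> = cl []"
  "\<lbrakk>u \<in> lists X; v \<in> lists X\<rbrakk> \<Longrightarrow> cl u \<otimes>\<^bsub>M\<^esub> cl v = cl (u @ v)"
  by (simp_all add: free_regular_star_monoid_def pres_class_mult) (simp_all add: presented_monoid_def)

lemma act_cl:
  assumes "w \<in> lists X" shows "act (cl w) u = run (run [] w) u"
proof -
  have "w \<in> cl w" using assms by (simp add: pres_class_def pres_cong.pc_refl)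
  then have "(SOME v. v \<in> cl w) \<in> cl w" by (rule someI)
  then have "run [] w = run [] (SOME v. v \<in> cl w)" by (intro run_cong) (auto simp: pres_class_def)
  then show ?thesis by (simp add: act_def)
qed

lemma run_NF: "\<lbrakk>u \<in> NF; v \<in> lists X\<rbrakk> \<Longrightarrow> run u v \<in> NF"
  by (simp add: NF_def irreducible_run run_lists)

lemma step_NF: "\<lbrakk>u \<in> NF; x \<in> X\<rbrakk> \<Longrightarrow> step u x \<in> NF"
  using run_NF[of u "[x]"] by simp

lemma NF_lists: "u \<in> NF \<Longrightarrow> u \<in> lists X" and NF_irr: "u \<in> NF \<Longrightarrow> \<not> reducible u"
  and Nil_NF [simp]: "[] \<in> NF"
  by (simp_all add: NF_def)

lemma carrier_cases:
  assumes "m \<in> carrier M" obtains w where "w \<in> NF" "m = cl w"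
proof -
  obtain v where v: "v \<in> lists X" "m = cl v" using assms M_simps by auto
  then have "m = cl (run [] v)" using pres_class_eq[OF run_congruent[of "[]" A v]] by simp
  then show thesis using that run_NF[OF Nil_NF v(1)] by blast
qed

lemma act_NF: "\<lbrakk>w \<in> NF\<rbrakk> \<Longrightarrow> act (cl w) u = run w u"
  by (simp add: act_cl NF_lists run_Nil NF_irr)

lemma act_step: "\<lbrakk>m \<in> carrier M; u \<in> NF\<rbrakk> \<Longrightarrow> act m (step u x) = step (act m u) x"
  by (erule carrier_cases) (simp add: act_NF run_step NF_irr)

lemma act_run: "\<lbrakk>m \<in> carrier M; u \<in> NF\<rbrakk> \<Longrightarrow> act m (run u v) = run (act m u) v"
  by (erule carrier_cases) (simp add: act_NF run_run NF_irr)

lemma cl_run: "\<lbrakk>u \<in> NF; v \<in> NF\<rbrakk> \<Longrightarrow> cl (run u v) = cl u \<otimes>\<^bsub>M\<^esub> cl v"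
  using pres_class_eq[OF run_congruent[of u A v]] by (simp add: M_simps NF_lists NF_irr)

lemma cl_carrier [simp]: "u \<in> NF \<Longrightarrow> cl u \<in> carrier M"
  by (simp add: M_simps NF_lists)

lemma act_in_NF: "\<lbrakk>m \<in> carrier M; u \<in> NF\<rbrakk> \<Longrightarrow> act m u \<in> NF"
  by (erule carrier_cases) (simp add: act_NF run_NF NF_lists)

lemma act_M_one: "u \<in> NF \<Longrightarrow> act \<one>\<^bsub>M\<^esub> u = u"
  using act_NF[of "[]"] by (simp add: M_simps run_Nil NF_irr)

lemma act_M_mult:
  assumes "m \<in> carrier M" "n \<in> carrier M" "u \<in> NF"
  shows "act (m \<otimes>\<^bsub>M\<^esub> n) u = act m (act n u)"
proof -
  obtain v where v: "v \<in> NF" "m = cl v" by (rule carrier_cases[OF assms(1)])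
  obtain w where w: "w \<in> NF" "n = cl w" by (rule carrier_cases[OF assms(2)])
  have "act (m \<otimes>\<^bsub>M\<^esub> n) u = act (cl (run v w)) u" using v w by (simp add: cl_run)
  also have "\<dots> = run (run v w) u" using v w run_NF NF_lists by (simp add: act_NF)
  finally show ?thesis using v w by (simp add: act_NF run_run NF_irr)
qed

lemma cl_act: "\<lbrakk>m \<in> carrier M; u \<in> NF\<rbrakk> \<Longrightarrow> cl (act m u) = m \<otimes>\<^bsub>M\<^esub> cl u"
  by (erule carrier_cases) (simp add: act_NF cl_run)

section \<open>Vertices, edges and loops of the right Cayley graph\<close>

text \<open>Selects one word of each pair \<open>{w, w\<^sup>\<star>}\<close>: the choice operator is applied to a predicate that is symmetric in \<open>w\<close>
  and \<open>w\<^sup>\<star>\<close>.\<close>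

definition chosen :: "('a + 'a) list \<Rightarrow> bool" where
  "chosen w \<longleftrightarrow> (SOME v. v = w \<or> v = w\<^sup>\<star>) = w"

lemma chosen_star: "primitive w \<Longrightarrow> chosen (w\<^sup>\<star>) \<longleftrightarrow> \<not> chosen w"
proof -
  assume w: "primitive w"
  have "(SOME v. v = w \<or> v = w\<^sup>\<star>) = w \<or> (SOME v. v = w \<or> v = w\<^sup>\<star>) = w\<^sup>\<star>" by (rule someI[of _ w]) simp
  moreover have "(\<lambda>v. v = w\<^sup>\<star> \<or> v = w) = (\<lambda>v. v = w \<or> v = w\<^sup>\<star>)" by auto
  ultimately show ?thesis using primitive_ne_star[OF w] by (auto simp: chosen_def)
qed

text \<open>The edge \<open>(u, x)\<close> leads from \<open>u\<close> to \<open>step u x\<close>.\<close>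

definition S1 where "S1 = NF \<times> X"
lemma S1_iff [simp]: "(u, x) \<in> S1 \<longleftrightarrow> u \<in> NF \<and> x \<in> X"
  by (simp add: S1_def)

definition act1 where "act1 m = (\<lambda>(u, x :: 'a + 'a). (act m u, x))"

lemma act1_apply [simp]: "act1 m (u, x) = (act m u, x)"
  by (simp add: act1_def)

text \<open>The pair \<open>(u, w)\<close> stands for the loop at \<open>u\<close> that reads \<open>w\<^sup>\<star>\<close> and then \<open>w\<close>.\<close>

definition S2 where "S2 = {(u, w). u \<in> NF \<and> w \<in> lists X \<and> primitive w \<and> chosen w \<and> run u (w\<^sup>\<star> @ w) = u}"
definition act2 where "act2 m = (\<lambda>(u, w :: ('a + 'a) list). (act m u, w))"

lemma act2_apply [simp]: "act2 m (u, w) = (act m u, w)"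
  by (simp add: act2_def)

sublocale monoid M by (rule monoid_M)

text \<open>Vertices and edges form free \<open>M\<close>-sets. The loops of \<open>w\<close> form a copy of \<open>M p\<close> for the idempotent \<open>p = w\<^sup>\<star> w\<close>, with
  generator the loop at \<open>p\<close>.\<close>

sublocale F0: projective_action M NF act cl "\<lambda>_. []"
  by unfold_locales (simp_all add: act_in_NF act_M_one act_M_mult cl_act, simp add: act_NF)

sublocale F1: projective_action M S1 act1 "\<lambda>(u, x). cl u" "\<lambda>(u, x). ([], x)"
  by unfold_locales (auto simp: S1_def act_in_NF act_M_one act_M_mult cl_act act_NF)

lemma act2_closed: "\<lbrakk>m \<in> carrier M; s \<in> S2\<rbrakk> \<Longrightarrow> act2 m s \<in> S2"
  by (auto simp: S2_def act_in_NF act_run[symmetric] simp del: run_append)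

sublocale F2: projective_action M S2 act2 "\<lambda>(u, w). cl u" "\<lambda>(u, w). (run [] (w\<^sup>\<star> @ w), w)"
proof unfold_locales
  fix s assume s: "s \<in> S2"
  obtain u w where [simp]: "s = (u, w)" by (cases s)
  have u: "u \<in> NF" "w \<in> lists X" "primitive w" "chosen w" "run u (w\<^sup>\<star> @ w) = u"
    using s by (auto simp: S2_def)
  show "(case s of (u, w) \<Rightarrow> cl u) \<in> carrier M" using u by simp
  \<comment> \<open>The loop at \<open>p = w\<^sup>\<star> w\<close> is closed since \<open>w\<^sup>\<star> w w\<^sup>\<star> w = w\<^sup>\<star> w\<close>.\<close>
  have "run [] (w\<^sup>\<star> @ w) \<in> NF" using run_NF[of "[]" "w\<^sup>\<star> @ w"] u by simp
  moreover have "run [] ((w\<^sup>\<star> @ (w\<^sup>\<star>)\<^sup>\<star> @ w\<^sup>\<star>) @ w) = run [] (w\<^sup>\<star> @ w)"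
    using run_rule[of "[]" "w\<^sup>\<star>"] by (metis run_append irreducible_Nil)
  ultimately show "(case s of (u, w) \<Rightarrow> (run [] (w\<^sup>\<star> @ w), w)) \<in> S2" using u by (simp add: S2_def)
  show "act2 (case s of (u, w) \<Rightarrow> cl u) (case s of (u, w) \<Rightarrow> (run [] (w\<^sup>\<star> @ w), w)) = s"
    using u run_run[of u "[]" "w\<^sup>\<star> @ w"] by (simp add: act_NF NF_irr)
qed (use act2_closed in \<open>auto simp: S2_def act_M_one act_M_mult cl_act\<close>)

text \<open>The chain of edges that are met when the word is read from the given vertex.\<close>

fun path :: "('a + 'a) list \<Rightarrow> ('a + 'a) list \<Rightarrow> ('a + 'a) list \<times> ('a + 'a) \<Rightarrow>\<^sub>0 int" where
  "path u [] = 0"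
| "path u (x # v) = frag_of (u, x) + path (step u x) v"

lemma path_append: "path u (v @ w) = path u v + path (run u v) w"
  by (induction v arbitrary: u) (simp_all add: add.assoc)

lemma Z1_module: "left_module (monoid_ring M) F1.Z" by (rule F1.frag_module_left_module)

lemma path_carrier: "\<lbrakk>u \<in> NF; v \<in> lists X\<rbrakk> \<Longrightarrow> path u v \<in> carrier F1.Z"
proof (induction v arbitrary: u)
  case Nil
  then show ?case by (simp add: F1.frag_module_simps)
next
  case (Cons x v)
  have "frag_of (u, x) \<in> carrier F1.Z" using Cons by simp
  moreover have "path (step u x) v \<in> carrier F1.Z" using Cons step_NF by auto
  ultimately show ?case using abelian_groupE(1)[OF F1.frag_module_abelian]
    by (simp add: F1.frag_module_simps(3))
qed

lemma path_act:
  assumes m: "m \<in> carrier M"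
  shows "\<lbrakk>u \<in> NF; v \<in> lists X\<rbrakk> \<Longrightarrow> path (act m u) v = delta m \<odot>\<^bsub>F1.Z\<^esub> path u v"
proof (induction v arbitrary: u)
  case Nil
  have "delta m \<in> carrier (monoid_ring M)" using m by simp
  then show ?case using smult_minus(1)[OF Z1_module, of "delta m"] by (simp add: F1.frag_module_simps(2))
next
  case (Cons x v)
  interpret Z: left_module "monoid_ring M" F1.Z by (rule Z1_module)
  have c: "frag_of (u, x) \<in> carrier F1.Z" "path (step u x) v \<in> carrier F1.Z"
    using Cons step_NF path_carrier by simp_all
  have "delta m \<in> carrier (monoid_ring M)" using m by simp
  from Z.smult_r_distr[OF this c] show ?case
    using Cons.prems Cons.IH[of "step u x"] act_step[OF m, of u] step_NF by (simp add: F1.frag_module_simps(3))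
qed

text \<open>The augmentation and the boundary maps of the Cayley graph with its loops.\<close>

definition \<epsilon> :: "(('a + 'a) list \<Rightarrow>\<^sub>0 int) \<Rightarrow> int" where
  "\<epsilon> = F0.extend trivial_int_module (\<lambda>_. 1)"
definition \<delta>0 where "\<delta>0 = F1.extend F0.Z (\<lambda>(u, x). frag_of (step u x) - frag_of u)"
definition \<delta>1 where "\<delta>1 = F2.extend F1.Z (\<lambda>(u, w). path u (w\<^sup>\<star> @ w))"

lemma int_module: "left_module (monoid_ring M) trivial_int_module"
  using trivial_int_module_trivial[OF monoid_M] by (simp add: trivial_lmodule_def)

lemma int_module_simps: "carrier trivial_int_module = UNIV" "\<zero>\<^bsub>trivial_int_module\<^esub> = 0"
  "x \<oplus>\<^bsub>trivial_int_module\<^esub> y = x + y" "delta m \<odot>\<^bsub>trivial_int_module\<^esub> x = x"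
  by (simp_all add: trivial_int_module_def) (simp add: delta_def)

lemma int_module_minus: "x \<ominus>\<^bsub>trivial_int_module :: (('a + 'a) list set \<Rightarrow> int, int) module\<^esub> y = x - y"
proof -
  interpret abelian_group "trivial_int_module :: ((('a + 'a) list set \<Rightarrow> int), int) module"
    by (rule left_module_abelian[OF int_module])
  have "\<ominus>\<^bsub>trivial_int_module :: (('a + 'a) list set \<Rightarrow> int, int) module\<^esub> y = - y"
    by (rule minus_equality) (simp_all add: int_module_simps)
  then show ?thesis
    by (simp add: a_minus_def int_module_simps)
qed

lemma \<epsilon>_hom: "\<epsilon> \<in> lmod_hom (monoid_ring M) F0.Z trivial_int_module"
  and \<epsilon>_of: "u \<in> NF \<Longrightarrow> \<epsilon> (frag_of u) = 1"
  unfolding \<epsilon>_def using F0.extend_hom[OF int_module, of "\<lambda>_. 1"] by (simp_all add: int_module_simps)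

lemma \<delta>0_hom: "\<delta>0 \<in> lmod_hom (monoid_ring M) F1.Z F0.Z"
  and \<delta>0_of: "\<lbrakk>u \<in> NF; x \<in> X\<rbrakk> \<Longrightarrow> \<delta>0 (frag_of (u, x)) = frag_of (step u x) - frag_of u"
proof -
  let ?v = "\<lambda>(u, x). frag_of (step u x) - frag_of u"
  interpret Z: left_module "monoid_ring M" F0.Z by (rule F0.frag_module_left_module)
  have c: "?v s \<in> carrier F0.Z" if s: "s \<in> S1" for s
  proof -
    obtain u x where [simp]: "s = (u, x)" and u: "u \<in> NF" "x \<in> X" using s by (auto simp: S1_def)
    then have "frag_of (step u x) \<ominus>\<^bsub>F0.Z\<^esub> frag_of u \<in> carrier F0.Z"
      using step_NF by (intro Z.M.minus_closed) simp_all
    then show ?thesis using u step_NF by (simp add: F0.frag_module_minus)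
  qed
  have eqv: "?v (act1 m s) = delta m \<odot>\<^bsub>F0.Z\<^esub> ?v s" if m: "m \<in> carrier M" and s: "s \<in> S1" for m s
  proof -
    obtain u x where [simp]: "s = (u, x)" and u: "u \<in> NF" "x \<in> X" using s by (auto simp: S1_def)
    have "delta m \<in> carrier (monoid_ring M)" using m by simp
    from smult_minus(2)[OF F0.frag_module_left_module this, of "frag_of (step u x)" "frag_of u"]
    show ?thesis using u m step_NF act_step[OF m] act_in_NF by (simp add: F0.frag_module_minus)
  qed
  note E = F1.extend_hom[OF F0.frag_module_left_module c eqv]
  show "\<delta>0 \<in> lmod_hom (monoid_ring M) F1.Z F0.Z" unfolding \<delta>0_def by (rule E(1))
  show "\<delta>0 (frag_of (u, x)) = frag_of (step u x) - frag_of u" if "u \<in> NF" "x \<in> X"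
    unfolding \<delta>0_def using E(2)[of "(u, x)"] that by simp
qed

lemma \<delta>1_hom: "\<delta>1 \<in> lmod_hom (monoid_ring M) F2.Z F1.Z"
  and \<delta>1_of: "(u, w) \<in> S2 \<Longrightarrow> \<delta>1 (frag_of (u, w)) = path u (w\<^sup>\<star> @ w)"
proof -
  let ?v = "\<lambda>(u, w). path u (w\<^sup>\<star> @ w)"
  have c: "?v s \<in> carrier F1.Z" if "s \<in> S2" for s
    using that by (auto simp: S2_def intro!: path_carrier)
  have eqv: "?v (act2 m s) = delta m \<odot>\<^bsub>F1.Z\<^esub> ?v s" if m: "m \<in> carrier M" and s: "s \<in> S2" for m s
    using s by (auto simp: S2_def intro!: path_act[OF m])
  note E = F2.extend_hom[OF Z1_module c eqv]
  show "\<delta>1 \<in> lmod_hom (monoid_ring M) F2.Z F1.Z" unfolding \<delta>1_def by (rule E(1))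
  show "\<delta>1 (frag_of (u, w)) = path u (w\<^sup>\<star> @ w)" if "(u, w) \<in> S2"
    unfolding \<delta>1_def using E(2)[of "(u, w)"] that by simp
qed

lemma hom_0:
  "\<epsilon> 0 = 0" "\<delta>0 0 = 0" "\<delta>1 0 = 0"
  using lmod_hom_minus(1)[OF F0.frag_module_left_module int_module \<epsilon>_hom]
    lmod_hom_minus(1)[OF Z1_module F0.frag_module_left_module \<delta>0_hom]
    lmod_hom_minus(1)[OF F2.frag_module_left_module Z1_module \<delta>1_hom]
  by (simp_all add: F0.frag_module_simps(2) F1.frag_module_simps(2) F2.frag_module_simps(2) int_module_simps)

lemma hom_diff:
  "\<lbrakk>a \<in> carrier F0.Z; a' \<in> carrier F0.Z\<rbrakk> \<Longrightarrow> \<epsilon> (a - a') = \<epsilon> a - \<epsilon> a'"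
  "\<lbrakk>b \<in> carrier F1.Z; b' \<in> carrier F1.Z\<rbrakk> \<Longrightarrow> \<delta>0 (b - b') = \<delta>0 b - \<delta>0 b'"
  "\<lbrakk>c \<in> carrier F2.Z; c' \<in> carrier F2.Z\<rbrakk> \<Longrightarrow> \<delta>1 (c - c') = \<delta>1 c - \<delta>1 c'"
  using lmod_hom_minus(2)[OF F0.frag_module_left_module int_module \<epsilon>_hom]
    lmod_hom_minus(2)[OF Z1_module F0.frag_module_left_module \<delta>0_hom]
    lmod_hom_minus(2)[OF F2.frag_module_left_module Z1_module \<delta>1_hom]
    lmod_homD(1)[OF \<delta>0_hom] lmod_homD(1)[OF \<delta>1_hom]
  by (simp_all add: F0.frag_module_minus F1.frag_module_minus F2.frag_module_minus int_module_minus)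

lemma \<delta>0_path: "\<lbrakk>u \<in> NF; v \<in> lists X\<rbrakk> \<Longrightarrow> \<delta>0 (path u v) = frag_of (run u v) - frag_of u"
proof (induction v arbitrary: u)
  case Nil
  then show ?case by (simp add: hom_0)
next
  case (Cons x v)
  have c: "frag_of (u, x) \<in> carrier F1.Z" "path (step u x) v \<in> carrier F1.Z"
    using Cons step_NF path_carrier by simp_all
  show ?case using lmod_homD(2)[OF \<delta>0_hom c] Cons step_NF \<delta>0_of
    by (simp add: F0.frag_module_simps(3) F1.frag_module_simps(3))
qed

section \<open>A contracting homotopy\<close>

text \<open>Contraction of the graph to the root \<open>[]\<close>: \<open>s0\<close> joins the root to a vertex by the path in the tree of irreducible
  words, and \<open>s1\<close> sends a tree edge to zero and any other edge to the loop through it.\<close>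

definition s0 where "s0 = frag_extend (path [])"

text \<open>The loop that contains the edge \<open>(u, x)\<close> outside the tree. With \<open>u @ [x] = y z z\<^sup>\<star> z\<close>, it is based at \<open>yz\<close> if \<open>z\<close> is the
  chosen word, and otherwise the same loop is based at \<open>y z z\<^sup>\<star>\<close>.\<close>

definition cell where
  "cell u x = (let (y, z) = SOME (y, z). z \<noteq> [] \<and> u @ [x] = y @ z @ z\<^sup>\<star> @ z
     in if chosen z then (y @ z, z) else (y @ z @ z\<^sup>\<star>, z\<^sup>\<star>))"

definition s1 where "s1 = frag_extend (\<lambda>(u, x). if reducible (u @ [x]) then frag_of (cell u x) else 0)"

lemma cell_eq:
  assumes u: "\<not> reducible u" and z: "u @ [x] = y @ z @ z\<^sup>\<star> @ z" "z \<noteq> []"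
  shows "cell u x = (if chosen z then (y @ z, z) else (y @ z @ z\<^sup>\<star>, z\<^sup>\<star>))"
proof -
  have "(SOME (y, z). z \<noteq> [] \<and> u @ [x] = y @ z @ z\<^sup>\<star> @ z) = (y, z)"
  proof (rule some_equality)
    show "case (y, z) of (y, z) \<Rightarrow> z \<noteq> [] \<and> u @ [x] = y @ z @ z\<^sup>\<star> @ z" using z by simp
    fix s assume s: "case s of (y, z) \<Rightarrow> z \<noteq> [] \<and> u @ [x] = y @ z @ z\<^sup>\<star> @ z"
    obtain y' z' where yz: "s = (y', z')" by (cases s)
    then show "s = (y, z)" using reduction_unique[OF u z, of y' z'] s by simp
  qed
  then show ?thesis by (simp add: cell_def)
qed

lemma fold_context:
  assumes u: "u \<in> NF" and x: "x \<in> X" and r: "reducible (u @ [x])"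
  obtains y z where "z \<noteq> []" "u @ [x] = y @ z @ z\<^sup>\<star> @ z" "primitive z" "y \<in> lists X" "z \<in> lists X"
    "\<not> reducible (y @ z @ z\<^sup>\<star>)" "y @ z \<in> NF" "y @ z @ z\<^sup>\<star> \<in> NF" "u = (y @ z) @ z\<^sup>\<star> @ butlast z" "x = last z"
proof -
  obtain y z where z: "z \<noteq> []" "u @ [x] = y @ z @ z\<^sup>\<star> @ z"
    using reduction_exists[OF NF_irr[OF u] r] by blast
  have ux: "u = (y @ z) @ z\<^sup>\<star> @ butlast z" "x = last z"
    using arg_cong[OF z(2), of butlast] arg_cong[OF z(2), of last] z(1) by (simp_all add: butlast_append)
  have "u @ [x] \<in> lists X" using u x NF_lists by simp
  then have l: "y \<in> lists X" "z \<in> lists X" unfolding z(2) by simp_all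
  have i: "\<not> reducible (y @ z @ z\<^sup>\<star>)" "\<not> reducible (y @ z)"
    using NF_irr[OF u] reducible_append2[of "y @ z @ z\<^sup>\<star>" "butlast z"] reducible_append2[of "y @ z" "z\<^sup>\<star> @ butlast z"] ux(1)
    by auto
  show thesis
    by (rule that[OF z reduction_primitive[OF NF_irr[OF u] z(2,1)] l i(1) _ _ ux]) (use i l in \<open>simp_all add: NF_def\<close>)
qed

lemma cell_S2:
  assumes "u \<in> NF" "x \<in> X" "reducible (u @ [x])"
  shows "cell u x \<in> S2"
proof -
  obtain y z where z: "z \<noteq> []" "u @ [x] = y @ z @ z\<^sup>\<star> @ z" "primitive z" "z \<in> lists X"
    and i: "\<not> reducible (y @ z @ z\<^sup>\<star>)" "y @ z \<in> NF" "y @ z @ z\<^sup>\<star> \<in> NF"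
    by (rule fold_context[OF assms]) (rule that)
  have "run (y @ z) (z\<^sup>\<star>) = y @ z @ z\<^sup>\<star>" using run_irreducible[of "y @ z" "z\<^sup>\<star>"] i(1) by simp
  then show ?thesis
    using cell_eq[OF NF_irr[OF assms(1)] z(2,1)] run_fold_forth[OF z(3) i(1)] z i primitive_star[OF z(3)] chosen_star[OF z(3)]
    by (simp add: S2_def)
qed

text \<open>The loop through \<open>(u, x)\<close> runs from \<open>yz\<close> to \<open>u\<close> inside the tree and returns to \<open>yz = step u x\<close> along \<open>(u, x)\<close>. Its
  tree part is the difference of the tree paths from the root to \<open>u\<close> and to \<open>yz\<close>.\<close>

lemma \<delta>1_cell:
  assumes "u \<in> NF" "x \<in> X" "reducible (u @ [x])"
  shows "\<delta>1 (frag_of (cell u x)) = frag_of (u, x) + path [] u - path [] (step u x)"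
proof -
  obtain y z where z: "z \<noteq> []" "u @ [x] = y @ z @ z\<^sup>\<star> @ z" "primitive z" "z \<in> lists X"
    and i: "\<not> reducible (y @ z @ z\<^sup>\<star>)" "y @ z \<in> NF"
    and ux: "u = (y @ z) @ z\<^sup>\<star> @ butlast z" "x = last z"
    by (rule fold_context[OF assms]) (rule that)
  have r: "run (y @ z) (z\<^sup>\<star>) = y @ z @ z\<^sup>\<star>" using run_irreducible[of "y @ z" "z\<^sup>\<star>"] i(1) by simp
  have "\<delta>1 (frag_of (cell u x)) = path (y @ z) (z\<^sup>\<star> @ z)"
  proof (cases "chosen z")
    case True
    then show ?thesis using cell_eq[OF NF_irr[OF assms(1)] z(2,1)] cell_S2[OF assms] \<delta>1_of by simp
  next
    case False
    then have "\<delta>1 (frag_of (cell u x)) = path (y @ z @ z\<^sup>\<star>) (z @ z\<^sup>\<star>)"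
      using cell_eq[OF NF_irr[OF assms(1)] z(2,1)] cell_S2[OF assms] \<delta>1_of by simp
    then show ?thesis using run_fold_forth[OF z(3) i(1)] r by (simp add: path_append add.commute)
  qed
  also have "\<dots> = path (y @ z) (z\<^sup>\<star> @ butlast z) + frag_of (u, x)"
  proof -
    have "run (y @ z) (z\<^sup>\<star> @ butlast z) = u"
      using run_irreducible[of "y @ z" "z\<^sup>\<star> @ butlast z"] NF_irr[OF assms(1)] ux by metis
    then have "path (y @ z) ((z\<^sup>\<star> @ butlast z) @ [last z]) = path (y @ z) (z\<^sup>\<star> @ butlast z) + frag_of (u, x)"
      unfolding path_append by (simp add: ux(2))
    then show ?thesis using z(1) by simp
  qed
  also have "path (y @ z) (z\<^sup>\<star> @ butlast z) = path [] u - path [] (y @ z)"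
    using path_append[of "[]" "y @ z" "z\<^sup>\<star> @ butlast z"] run_Nil[OF NF_irr[OF i(2)]] ux(1) by simp
  finally show ?thesis using step_reduce[OF NF_irr[OF assms(1)] z(2,1)] by simp
qed

lemma homotopy0:
  assumes "c \<in> carrier F0.Z"
  shows "s0 c \<in> carrier F1.Z" "\<delta>0 (s0 c) = c - frag_cmul (\<epsilon> c) (frag_of [])"
proof -
  interpret Z: left_module "monoid_ring M" F1.Z by (rule Z1_module)
  have "s0 c \<in> carrier F1.Z \<and> \<delta>0 (s0 c) = c - frag_cmul (\<epsilon> c) (frag_of [])"
    using assms
  proof (induction rule: F0.frag_module_induct)
    case zero
    then show ?case by (simp add: s0_def hom_0 F1.frag_module_simps)
  next
    case (one u)
    then show ?case
      by (simp add: s0_def \<epsilon>_of \<delta>0_path path_carrier NF_lists run_Nil NF_irr)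
  next
    case (minus c c')
    then have "s0 c - s0 c' \<in> carrier F1.Z" using Z.M.minus_closed F1.frag_module_minus by metis
    then show ?case using minus
      by (simp add: s0_def frag_extend_diff hom_diff frag_cmul_diff_distrib)
  qed
  then show "s0 c \<in> carrier F1.Z" "\<delta>0 (s0 c) = c - frag_cmul (\<epsilon> c) (frag_of [])" by auto
qed

text \<open>Exactness at the edges: a cycle \<open>c\<close> is the boundary of \<open>s1 c\<close>.\<close>

lemma homotopy1:
  assumes "c \<in> carrier F1.Z"
  shows "s1 c \<in> carrier F2.Z" "\<delta>1 (s1 c) = c - s0 (\<delta>0 c)"
proof -
  interpret Z: left_module "monoid_ring M" F2.Z by (rule F2.frag_module_left_module)
  have "s1 c \<in> carrier F2.Z \<and> \<delta>1 (s1 c) = c - s0 (\<delta>0 c)"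
    using assms
  proof (induction rule: F1.frag_module_induct)
    case zero
    then show ?case by (simp add: s0_def s1_def hom_0 F2.frag_module_simps)
  next
    case (one s)
    obtain u x where s: "s = (u, x)" "u \<in> NF" "x \<in> X" using one by (auto simp: S1_def)
    have d: "s0 (\<delta>0 (frag_of s)) = path [] (step u x) - path [] u"
      using s by (simp add: s0_def \<delta>0_of frag_extend_diff)
    show ?case
    proof (cases "reducible (u @ [x])")
      case True
      then show ?thesis using d s \<delta>1_cell[OF s(2,3)] cell_S2[OF s(2,3)] by (simp add: s1_def)
    next
      case False
      then show ?thesis using d s
        by (simp add: s1_def hom_0 F2.frag_module_simps step_append path_append run_Nil NF_irr)
    qed
  next
    case (minus c c')
    then have "s1 c - s1 c' \<in> carrier F2.Z" using Z.M.minus_closed F2.frag_module_minus by metis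
    then show ?case using minus
      by (simp add: s0_def s1_def frag_extend_diff hom_diff)
  qed
  then show "s1 c \<in> carrier F2.Z" "\<delta>1 (s1 c) = c - s0 (\<delta>0 c)" by auto
qed

lemma s1_path_irreducible: "\<not> reducible (u @ v) \<Longrightarrow> s1 (path u v) = 0"
proof (induction v arbitrary: u)
  case (Cons x v)
  then have "\<not> reducible (u @ [x])" using reducible_append2[of "u @ [x]" v] by auto
  then show ?case using Cons by (simp add: s1_def frag_extend_add step_append)
qed (simp add: s1_def)

lemma s1_path_fold:
  assumes w: "primitive w" and i: "\<not> reducible (u @ w @ w\<^sup>\<star>)"
  shows "s1 (path (u @ w @ w\<^sup>\<star>) w) = frag_of (if chosen w then (u @ w, w) else (u @ w @ w\<^sup>\<star>, w\<^sup>\<star>))"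
proof -
  let ?v = "(u @ w @ w\<^sup>\<star>) @ butlast w"
  have n: "w \<noteq> []" by (rule primitiveD[OF w])
  have irr: "\<not> reducible ?v"
    using fold_forth[OF w i, of "butlast w" "[last w]"] n by simp
  have eq: "?v @ [last w] = u @ w @ w\<^sup>\<star> @ w" using n by simp
  then have r: "reducible (?v @ [last w])" using reducibleI[OF n, of u "[]"] by simp
  have "path (u @ w @ w\<^sup>\<star>) w = path (u @ w @ w\<^sup>\<star>) (butlast w) + frag_of (?v, last w)"
    using path_append[of "u @ w @ w\<^sup>\<star>" "butlast w" "[last w]"] run_irreducible[OF irr] n by simp
  then show ?thesis using s1_path_irreducible[OF irr] r cell_eq[OF irr eq n]
    by (simp add: s1_def frag_extend_add)
qed

text \<open>Injectivity of the boundary on loops: by \<open>fold_forth\<close> and \<open>fold_back\<close>, every loop has exactly one edge outside the tree, on the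
  way back along \<open>w\<close> or on the way out along \<open>w\<^sup>\<star>\<close>, and \<open>s1\<close> recovers the loop from it.\<close>

lemma homotopy2:
  assumes "c \<in> carrier F2.Z" shows "s1 (\<delta>1 c) = c"
  using assms
proof (induction rule: F2.frag_module_induct)
  case zero
  then show ?case by (simp add: s1_def hom_0)
next
  case (minus c c')
  then show ?case by (simp add: s1_def frag_extend_diff hom_diff)
next
  case (one s)
  obtain u w where s: "s = (u, w)" by (cases s)
  have u: "u \<in> NF" "w \<in> lists X" and w: "primitive w" "chosen w" and r: "run u (w\<^sup>\<star> @ w) = u"
    using one s by (auto simp: S2_def)
  have ui: "\<not> reducible u" by (rule NF_irr[OF u(1)])
  obtain u' where u': "u = u' @ w"
    using run_primitive[OF w(1), of "run u (w\<^sup>\<star>)"] irreducible_run[OF ui] r by auto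
  have "s1 (\<delta>1 (frag_of s)) = s1 (path u (w\<^sup>\<star>)) + s1 (path (run u (w\<^sup>\<star>)) w)"
    using one \<delta>1_of[of u w] by (simp add: s path_append) (simp add: s1_def frag_extend_add)
  also have "\<dots> = frag_of s"
  proof (cases "reducible (u' @ w @ w\<^sup>\<star>)")
    case False
    then have "run u (w\<^sup>\<star>) = u' @ w @ w\<^sup>\<star>" using run_irreducible[of u "w\<^sup>\<star>"] u' by simp
    then show ?thesis using False s1_path_irreducible[of u "w\<^sup>\<star>"] s1_path_fold[OF w(1) False] w(2) u' s by simp
  next
    case True
    then obtain y where y: "u' = y @ w\<^sup>\<star>" using fold_back[OF w(1)] ui u' by blast
    have i: "\<not> reducible (y @ w\<^sup>\<star> @ (w\<^sup>\<star>)\<^sup>\<star>)" using ui u' y by simp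
    note fold = run_fold_forth[OF primitive_star[OF w(1)] i] s1_path_fold[OF primitive_star[OF w(1)] i]
    have u: "u = y @ w\<^sup>\<star> @ w" using u' y by simp
    have "s1 (path (y @ w\<^sup>\<star>) w) = 0" using ui u by (intro s1_path_irreducible) simp
    then show ?thesis using fold chosen_star[OF w(1)] w(2) u s by simp
  qed
  finally show ?case .
qed

lemma \<epsilon>_\<delta>0: "c \<in> carrier F1.Z \<Longrightarrow> \<epsilon> (\<delta>0 c) = 0"
proof (induction rule: F1.frag_module_induct)
  case (one s)
  then show ?case using step_NF by (auto simp: S1_def \<delta>0_of hom_diff \<epsilon>_of)
next
  case (minus c c')
  then show ?case using lmod_homD(1)[OF \<delta>0_hom] by (simp add: hom_diff)
qed (simp add: hom_0)

lemma \<delta>0_\<delta>1: "c \<in> carrier F2.Z \<Longrightarrow> \<delta>0 (\<delta>1 c) = 0"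
proof (induction rule: F2.frag_module_induct)
  case (one s)
  then obtain u w where "s = (u, w)" "u \<in> NF" "w \<in> lists X" "run u (w\<^sup>\<star> @ w) = u" "(u, w) \<in> S2"
    by (auto simp: S2_def)
  then show ?case using \<delta>0_path[of u "w\<^sup>\<star> @ w"] by (simp add: \<delta>1_of)
next
  case (minus c c')
  then show ?case using lmod_homD(1)[OF \<delta>1_hom] by (simp add: hom_diff)
qed (simp add: hom_0)

lemma frag_cmul_Nil_carrier: "frag_cmul k (frag_of []) \<in> carrier F0.Z"
  by (auto simp: F0.frag_module_simps)

lemma \<epsilon>_surj: "\<epsilon> (frag_cmul k (frag_of [])) = k"
proof (induction k rule: int_induct[of _ 0])
  case base
  then show ?case by (simp add: hom_0)
next
  case (step1 k)
  have "frag_cmul (k + 1) (frag_of []) = frag_cmul k (frag_of []) - (0 - frag_of ([] :: ('a + 'a) list))"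
    by (simp add: frag_cmul_distrib)
  moreover have "\<epsilon> (0 - frag_of []) = -1"
    using hom_diff(1)[of 0 "frag_of []"] by (simp add: hom_0 \<epsilon>_of F0.frag_module_simps(1))
  moreover have "0 - frag_of [] \<in> carrier F0.Z" by (simp add: F0.frag_module_simps)
  ultimately show ?case
    using step1 hom_diff(1)[OF frag_cmul_Nil_carrier[of k], of "0 - frag_of []"] by simp
next
  case (step2 k)
  then show ?case using step2 frag_cmul_Nil_carrier[of k] by (simp add: frag_cmul_diff_distrib hom_diff \<epsilon>_of)
qed

lemma resolution: "resolution_start (monoid_ring M) trivial_int_module F0.Z F1.Z F2.Z \<epsilon> \<delta>0 \<delta>1"
proof (rule resolution_start.intro)
  show "left_module (monoid_ring M) trivial_int_module" "left_module (monoid_ring M) F0.Z"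
    "left_module (monoid_ring M) F1.Z" "left_module (monoid_ring M) F2.Z"
    by (rule int_module F0.frag_module_left_module F1.frag_module_left_module F2.frag_module_left_module)+
  show "\<epsilon> \<in> lmod_hom (monoid_ring M) F0.Z trivial_int_module" "\<delta>0 \<in> lmod_hom (monoid_ring M) F1.Z F0.Z"
    "\<delta>1 \<in> lmod_hom (monoid_ring M) F2.Z F1.Z" by (rule \<epsilon>_hom \<delta>0_hom \<delta>1_hom)+
  have "k \<in> \<epsilon> ` carrier F0.Z" for k
    by (rule image_eqI[of _ _ "frag_cmul k (frag_of [])"]) (simp_all add: \<epsilon>_surj frag_cmul_Nil_carrier)
  then show "\<epsilon> ` carrier F0.Z = carrier trivial_int_module" by (auto simp: int_module_simps)
  show "{x \<in> carrier F0.Z. \<epsilon> x = \<zero>\<^bsub>trivial_int_module\<^esub>} = \<delta>0 ` carrier F1.Z"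
  proof (intro equalityI subsetI)
    fix c assume "c \<in> {x \<in> carrier F0.Z. \<epsilon> x = \<zero>\<^bsub>trivial_int_module\<^esub>}"
    then show "c \<in> \<delta>0 ` carrier F1.Z"
      using homotopy0[of c] by (intro image_eqI[of _ _ "s0 c"]) (simp_all add: int_module_simps)
  qed (use \<epsilon>_\<delta>0 lmod_homD(1)[OF \<delta>0_hom] in \<open>auto simp: int_module_simps\<close>)
  show "{x \<in> carrier F1.Z. \<delta>0 x = \<zero>\<^bsub>F0.Z\<^esub>} = \<delta>1 ` carrier F2.Z"
  proof (intro equalityI subsetI)
    fix c assume "c \<in> {x \<in> carrier F1.Z. \<delta>0 x = \<zero>\<^bsub>F0.Z\<^esub>}"
    then show "c \<in> \<delta>1 ` carrier F2.Z"
      using homotopy1[of c] by (intro image_eqI[of _ _ "s1 c"]) (simp_all add: F0.frag_module_simps s0_def)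
  qed (use \<delta>0_\<delta>1 lmod_homD(1)[OF \<delta>1_hom] in \<open>auto simp: F0.frag_module_simps(2)\<close>)
qed

lemma \<delta>1_inj: "inj_on \<delta>1 (carrier F2.Z)"
  by (rule inj_on_inverseI[of _ s1]) (rule homotopy2)

section \<open>The trivial cohomological dimension\<close>

text \<open>An integral cochain \<open>k\<close> takes the same value on all edges with the same letter, since these are translates of each
  other. The loop of \<open>aa\<close>, or of its star, contains the letters \<open>a\<close> and \<open>a\<^sup>\<star>\<close> twice each.\<close>

lemma not_coboundary:
  assumes a: "a \<in> A" and k: "k \<in> lmod_hom (monoid_ring M) F1.Z trivial_int_module"
  obtains s where "s \<in> S2" "k (\<delta>1 (frag_of s)) \<noteq> 1"
proof -
  define v :: "('a + 'a) list" where "v = [Inl a, Inl a]"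
  have pv: "primitive v"
  proof -
    have "\<not> reducible v" unfolding reducible_def
    proof
      assume "\<exists>p z q. z \<noteq> [] \<and> v = p @ z @ z\<^sup>\<star> @ z @ q"
      then obtain p z q where z: "z \<noteq> []" "v = p @ z @ z\<^sup>\<star> @ z @ q" by blast
      have "length v \<ge> 3 * length z" unfolding z(2) by simp
      moreover have "length z \<ge> 1" using z(1) by (cases z) auto
      ultimately show False by (simp add: v_def)
    qed
    moreover have "v \<noteq> s @ s\<^sup>\<star> @ y \<and> v \<noteq> y @ s @ s\<^sup>\<star>" if "s \<noteq> []" for s y
    proof -
      have "v \<noteq> p @ s @ s\<^sup>\<star> @ q" for p q
      proof
        assume eq: "v = p @ s @ s\<^sup>\<star> @ q"
        have "length p + 2 * length s + length q = 2" using arg_cong[OF eq, of length] by (simp add: v_def)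
        moreover have "length s \<ge> 1" using that by (cases s) auto
        ultimately have "length s = 1" "length p = 0" by linarith+
        then have "p = []" by simp
        obtain x where "s = [x]" using \<open>length s = 1\<close> by (cases s) auto
        then show False using eq \<open>p = []\<close> by (auto simp: v_def)
      qed
      from this[of "[]" y] this[of y "[]"] show ?thesis by simp
    qed
    ultimately show ?thesis by (simp add: primitive_def v_def)
  qed
  define w where "w = (if chosen v then v else v\<^sup>\<star>)"
  have w: "primitive w" "chosen w" "w \<in> lists X"
    using pv chosen_star[OF pv] primitive_star[OF pv] a by (auto simp: w_def v_def star_alphabet_def)
  define u where "u = run [] (w\<^sup>\<star> @ w)"
  have u: "u \<in> NF" unfolding u_def by (rule run_NF) (use w in auto)
  have "run [] ((w\<^sup>\<star> @ (w\<^sup>\<star>)\<^sup>\<star> @ w\<^sup>\<star>) @ w) = run [] (w\<^sup>\<star> @ w)"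
    using run_rule[of "[]" "w\<^sup>\<star>"] by (metis run_append irreducible_Nil)
  then have s: "(u, w) \<in> S2" using u w by (simp add: S2_def u_def)
  have k1: "k (frag_of (u, x)) = k (frag_of ([], x))" if "u \<in> NF" "x \<in> X" for u x
    using lmod_homD(3)[OF k, of "delta (cl u)" "frag_of ([], x)"] that
    by (simp add: act_NF int_module_simps run_Nil NF_irr)
  have kpath: "k (path u v) = (\<Sum>x\<leftarrow>v. k (frag_of ([], x)))" if "u \<in> NF" "v \<in> lists X" for u v
    using that
  proof (induction v arbitrary: u)
    case Nil
    then show ?case using lmod_hom_minus(1)[OF Z1_module int_module k]
      by (simp add: F1.frag_module_simps(2) int_module_simps)
  next
    case (Cons x v)
    have c: "frag_of (u, x) \<in> carrier F1.Z" "path (step u x) v \<in> carrier F1.Z"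
      using Cons step_NF path_carrier by simp_all
    show ?case using lmod_homD(2)[OF k c] Cons step_NF k1[of u x]
      by (simp add: F1.frag_module_simps(3) int_module_simps)
  qed
  have "k (\<delta>1 (frag_of (u, w))) = 2 * (k (frag_of ([], Inl a)) + k (frag_of ([], Inr a)))"
    using kpath[OF u, of "w\<^sup>\<star> @ w"] w s by (simp add: \<delta>1_of w_def v_def)
  moreover have "(2 :: int) * n \<noteq> 1" for n by presburger
  ultimately have "k (\<delta>1 (frag_of (u, w))) \<noteq> 1" by metis
  then show thesis by (rule that[OF s])
qed

end

theorem corollary3p2:
  fixes A :: "'a set" and r :: nat
    and P :: "nat \<Rightarrow> (('a + 'a) list set \<Rightarrow> int, 'p) module"
    and d :: "nat \<Rightarrow> 'p \<Rightarrow> 'p" and e :: "'p \<Rightarrow> int"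
  assumes "finite A" and "card A = r" and "r \<ge> 1"
    and "projective_resolution (monoid_ring (free_regular_star_monoid A)) trivial_int_module P d e"
    and "infinite (UNIV :: 'b set)"
  shows "has_trivial_cohomological_dimension (free_regular_star_monoid A) P d TYPE('b) 2"
proof -
  interpret free_star A .
  let ?R = "monoid_ring M"
  note res = assms(4) and resD = projective_resolutionD[OF assms(4)]
  interpret resolution_comparison ?R trivial_int_module "P 0" "P 1" "P 2" e "d 0" "d 1"
    F0.Z F1.Z F2.Z \<epsilon> \<delta>0 \<delta>1 "P 3" "d 2"
  proof (intro resolution_comparison.intro resolution_comparison_axioms.intro resolution \<delta>1_inj)
    show "resolution_start ?R trivial_int_module (P 0) (P 1) (P 2) e (d 0) (d 1)"
      by (intro resolution_start.intro) (use resD resD(4)[of 0] resD(4)[of 1] resD(8)[of 0] in \<open>simp_all add: numeral_2_eq_2\<close>)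
    show "d 2 \<in> lmod_hom ?R (P 3) (P 2)" "left_module ?R (P 3)"
      "{x \<in> carrier (P 2). d 1 x = \<zero>\<^bsub>P 1\<^esub>} = d 2 ` carrier (P 3)"
      using resD(3)[of 3] resD(4)[of 2] resD(8)[of 1] by (simp_all add: numeral_2_eq_2 numeral_3_eq_3)
  qed (unfold lifts_against_def, (intro ballI impI projective_lift[OF monoid_M resD(2)] F0.frag_module_lift
        F1.frag_module_lift F2.frag_module_lift; (assumption | intro resD(3) int_module F0.frag_module_left_module
        F1.frag_module_left_module F2.frag_module_left_module))+)
  have van: "trivial_cohomology_vanishes_above M P d TYPE('b) 2"
  proof -
    obtain \<tau> where \<tau>: "\<tau> \<in> lmod_hom ?R (P 2) (P 3)" "\<And>x. x \<in> carrier (P 3) \<Longrightarrow> d 2 (\<tau> (d 2 x)) = d 2 x"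
      by (rule comparison) (rule that)
    show ?thesis unfolding trivial_cohomology_vanishes_above_def trivial_lmodule_def
    proof (intro allI impI)
      fix q :: nat and B :: "(('a + 'a) list set \<Rightarrow> int, 'b) module"
      assume "2 < int q" and B: "left_module ?R B \<and> (\<forall>m\<in>carrier M. \<forall>b\<in>carrier B. delta m \<odot>\<^bsub>B\<^esub> b = b)"
      then show "trivial_group (Ext_group ?R P d B q)"
        using Ext_group_vanishes_above[OF monoid_M res, of \<tau> 1 B q] \<tau> by (simp add: numeral_2_eq_2 numeral_3_eq_3)
    qed
  qed
  have "2 \<le> j" if j: "trivial_cohomology_vanishes_above M P d TYPE('b) j" for j
  proof (rule ccontr)
    assume "\<not> 2 \<le> j"
    \<comment> \<open>The integers, with trivial action, are moved into the infinite type \<open>'b\<close>.\<close>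
    obtain \<iota>0 :: "nat \<Rightarrow> 'b" where "inj \<iota>0" using infinite_countable_subset[OF assms(5)] by blast
    define \<iota> where "\<iota> z = \<iota>0 (int_encode z)" for z
    have \<iota>: "inj_on \<iota> (carrier trivial_int_module)"
      by (rule inj_onI) (metis \<iota>_def \<open>inj \<iota>0\<close> injD int_encode_eq)
    define B :: "(('a + 'a) list set \<Rightarrow> int, 'b) module" where "B = transport \<iota> trivial_int_module"
    note tr = transport_left_module[OF int_module \<iota>, folded B_def]
    have "trivial_lmodule M B"
      unfolding trivial_lmodule_def
    proof (intro conjI ballI tr(1))
      fix m b assume m: "m \<in> carrier M" and "b \<in> carrier B"
      then obtain z where "b = \<iota> z" by (auto simp: B_def transport_def Let_def)
      then show "delta m \<odot>\<^bsub>B\<^esub> b = b"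
        using lmod_homD(3)[OF tr(2), of "delta m" z] m by (simp add: int_module_simps)
    qed
    then have triv: "trivial_group (Ext_group ?R P d B 2)"
      using j \<open>\<not> 2 \<le> j\<close> unfolding trivial_cohomology_vanishes_above_def by simp
    define g where "g = F2.extend trivial_int_module (\<lambda>_. 1)"
    have g: "g \<in> lmod_hom ?R F2.Z trivial_int_module" "\<And>s. s \<in> S2 \<Longrightarrow> g (frag_of s) = 1"
      unfolding g_def using F2.extend_hom[OF int_module, of "\<lambda>_. 1"] by (simp_all add: int_module_simps)
    obtain a where a: "a \<in> A" using assms(1-3) by (cases "A = {}") auto
    have ncob: "\<exists>c\<in>carrier F2.Z. \<iota> (g c) \<noteq> k (\<delta>1 c)" if k: "k \<in> lmod_hom ?R F1.Z B" for k
    proof -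
      let ?\<iota> = "inv_into (carrier (trivial_int_module :: (('a + 'a) list set \<Rightarrow> int, int) module)) \<iota>"
      obtain s where s: "s \<in> S2" "?\<iota> (k (\<delta>1 (frag_of s))) \<noteq> 1"
        by (rule not_coboundary[OF a lmod_hom_comp[OF k tr(3)]]) (rule that)
      have "?\<iota> (\<iota> (g (frag_of s))) = 1" using inv_into_f_f[OF \<iota>] g(2)[OF s(1)] by (simp add: int_module_simps)
      then have "\<iota> (g (frag_of s)) \<noteq> k (\<delta>1 (frag_of s))" using s(2) by metis
      then show ?thesis using s(1) F2.frag_of_carrier by blast
    qed
    obtain f where f: "f \<in> lmod_hom ?R (P 2) B" "\<And>x. x \<in> carrier (P 3) \<Longrightarrow> f (d 2 x) = \<zero>\<^bsub>B\<^esub>"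
      "\<And>k. k \<in> lmod_hom ?R (P 1) B \<Longrightarrow> \<exists>x\<in>carrier (P 2). f x \<noteq> k (d 1 x)"
      by (rule nontrivial_cocycle[OF tr(1) lmod_hom_comp[OF g(1) tr(2)] ncob]) (assumption, rule that)
    have "\<not> trivial_group (Ext_group ?R P d B (Suc 1))"
      by (rule Ext_group_nontrivial[OF res tr(1), where f = f]) (use f in \<open>simp_all add: numeral_2_eq_2 numeral_3_eq_3\<close>)
    then show False using triv by (simp add: numeral_2_eq_2)
  qed
  then show ?thesis using van unfolding has_trivial_cohomological_dimension_def by blast
qed

end
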